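(* Let $M$ be a connected compact Riemannian manifold with Riemannian volume measure $m$, $m(M)=1$, let $1<\lambda<\Gamma$, and let $f_\infty=(f_n)_{n\ge0}$ be a sequence of maps $f_n\in\mathcal{E}(\lambda,\Gamma)$. Then $$h_{\mathrm{top}}(f_\infty)=\limsup_{n\to\infty}\frac1n\log\int_M|\det Df_0^n(x)|\,dm(x).$$
   Context: $\mathcal{E}(\lambda,\Gamma)$ is the set of $f\in C^2(M,M)$ such that $|Df(v)|\ge\lambda|v|$ for all $v\in TM$ and $\|f\|_{C^2}\le\Gamma$ (the $C^2$-norm bounds the norms of the first and second derivatives of $f$ with respect to the Riemannian metric; in particular $|Df(v)|\le\Gamma|v|$). $|\det Df|$ is the Jacobian with respect to the Riemannian metric. $f_0^n:=f_{n-1}\circ\cdots\circ f_0$, $f_0^0=\mathrm{id}$, $f_0^{-n}:=(f_0^n)^{-1}$ on sets. Topological entropy: for a sequence $\mathcal{U}_\infty=(\mathcal{U}_n)_{n\ge0}$ of open covers of $M$, $h_{\mathrm{top}}(f_\infty;\mathcal{U}_\infty):=\limsup_{n\to\infty}\frac1n\log\mathcal{N}\big(\bigvee_{i=0}^{n-1}f_0^{-i}\mathcal{U}_i\big)$, where $\mathcal{N}(\cdot)$ is the minimal cardinality of a subcover. $h_{\mathrm{top}}(f_\infty)$ is the supremum of $h_{\mathrm{top}}(f_\infty;\mathcal{U}_\infty)$ over all sequences $\mathcal{U}_\infty$ of open covers whose Lebesgue numbers are bounded away from zero. Equivalently, $h_{\mathrm{top}}(f_\infty)=\lim_{\varepsilon\searrow0}\limsup_{n\to\infty}\frac1n\log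 r(n,\varepsilon)$, where $r(n,\varepsilon)$ is either the maximal cardinality of an $(n,\varepsilon)$-separated set or the minimal cardinality of an $(n,\varepsilon)$-spanning set with respect to $d_{0,n}(x,y)=\max_{0\le j\le n}d(f_0^j(x),f_0^j(y))$, $d$ being the Riemannian distance. *)

theory Defs
  imports "HOL-Analysis.Analysis"
begin

section \<open>Smooth manifolds\<close>

text \<open>
  A manifold is carried by a whole type \<open>'a\<close> of class \<open>t2_space\<close>; its dimension is
  \<open>CARD('n)\<close>.  A chart is a domain together with a coordinate map, whose values outside the domain
  are irrelevant.
\<close>

type_synonym ('a, 'n) chart = "'a set \<times> ('a \<Rightarrow> real ^ 'n)"

abbreviation chart_dom :: "('a, 'n::finite) chart \<Rightarrow> 'a set" where
  "chart_dom c \<equiv> fst c"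

abbreviation chart_map :: "('a, 'n::finite) chart \<Rightarrow> 'a \<Rightarrow> real ^ 'n" where
  "chart_map c \<equiv> snd c"

definition chart_inv :: "('a, 'n::finite) chart \<Rightarrow> real ^ 'n \<Rightarrow> 'a" where
  "chart_inv c = inv_into (chart_dom c) (chart_map c)"

text \<open>\<open>C\<^sup>k\<close> maps between Euclidean spaces; used for open \<open>S\<close> only.\<close>

primrec Ck_on ::
  "nat \<Rightarrow> ('e::euclidean_space \<Rightarrow> 'b::real_normed_vector) \<Rightarrow> 'e set \<Rightarrow> bool" where
  "Ck_on 0 F S \<longleftrightarrow> continuous_on S F"
| "Ck_on (Suc k) F S \<longleftrightarrow>
     (\<forall>x\<in>S. F differentiable (at x)) \<and> (\<forall>v. Ck_on k (\<lambda>x. frechet_derivative F (at x) v) S)"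

definition smooth_on :: "('e::euclidean_space \<Rightarrow> 'b::real_normed_vector) \<Rightarrow> 'e set \<Rightarrow> bool" where
  "smooth_on F S \<longleftrightarrow> (\<forall>k. Ck_on k F S)"

definition smooth_atlas :: "('a::topological_space, 'n::finite) chart set \<Rightarrow> bool" where
  "smooth_atlas A \<longleftrightarrow>
     (\<forall>c\<in>A. open (chart_dom c) \<and> open (chart_map c ` chart_dom c) \<and>
        homeomorphism (chart_dom c) (chart_map c ` chart_dom c) (chart_map c) (chart_inv c)) \<and>
     (\<Union>c\<in>A. chart_dom c) = UNIV \<and>
     (\<forall>c\<in>A. \<forall>c'\<in>A.
        smooth_on (chart_map c' \<circ> chart_inv c) (chart_map c ` (chart_dom c \<inter> chart_dom c')))"

definition C2_map :: "('a::topological_space, 'n::finite) chart set \<Rightarrow> ('a \<Rightarrow> 'a) \<Rightarrow> bool" where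
  "C2_map A f \<longleftrightarrow> continuous_on UNIV f \<and>
     (\<forall>c\<in>A. \<forall>c'\<in>A.
        Ck_on 2 (chart_map c' \<circ> f \<circ> chart_inv c) (chart_map c ` (chart_dom c \<inter> f -` chart_dom c')))"


section \<open>Riemannian metrics\<close>

text \<open>
  A metric is given by its Gram matrices \<open>g c p = (g\<^sub>i\<^sub>j(p))\<close> in every chart \<open>c\<close> of the atlas around
  \<open>p\<close>.  The last conjunct is the transformation law of a covariant 2-tensor, with \<open>T\<close> the Jacobian
  matrix of the coordinate change from \<open>c\<close> to \<open>c'\<close>.
\<close>

type_synonym ('a, 'n) metric_tensor = "('a, 'n) chart \<Rightarrow> 'a \<Rightarrow> real ^ 'n ^ 'n"

definition riemannian_metric ::
  "('a::topological_space, 'n::finite) chart set \<Rightarrow> ('a, 'n) metric_tensor \<Rightarrow> bool" where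
  "riemannian_metric A g \<longleftrightarrow>
     (\<forall>c\<in>A. \<forall>p\<in>chart_dom c.
        transpose (g c p) = g c p \<and> (\<forall>v. v \<noteq> 0 \<longrightarrow> v \<bullet> (g c p *v v) > 0)) \<and>
     (\<forall>c\<in>A. smooth_on (\<lambda>x. g c (chart_inv c x)) (chart_map c ` chart_dom c)) \<and>
     (\<forall>c\<in>A. \<forall>c'\<in>A. \<forall>p\<in>chart_dom c \<inter> chart_dom c'.
        let T = matrix (frechet_derivative (chart_map c' \<circ> chart_inv c) (at (chart_map c p)))
        in g c p = transpose T ** g c' p ** T)"

definition riemannian_manifold ::
  "('a::t2_space, 'n::finite) chart set \<Rightarrow> ('a, 'n) metric_tensor \<Rightarrow> bool" where
  "riemannian_manifold A g \<longleftrightarrow> smooth_atlas A \<and> riemannian_metric A g"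

text \<open>
  The tangent space at \<open>p\<close> is identified with \<open>real ^ 'n\<close> by taking components with respect to one
  fixed chart \<open>chart_at A p\<close> around \<open>p\<close>.  All norms, Jacobians, lengths and covariant derivatives
  below are independent of this choice by the transformation law of the metric.
\<close>

definition chart_at :: "('a, 'n::finite) chart set \<Rightarrow> 'a \<Rightarrow> ('a, 'n) chart" where
  "chart_at A p = (SOME c. c \<in> A \<and> p \<in> chart_dom c)"

definition gram :: "('a, 'n::finite) chart set \<Rightarrow> ('a, 'n) metric_tensor \<Rightarrow> 'a \<Rightarrow> real ^ 'n ^ 'n" where
  "gram A g p = g (chart_at A p) p"

definition tnorm ::
  "('a, 'n::finite) chart set \<Rightarrow> ('a, 'n) metric_tensor \<Rightarrow> 'a \<Rightarrow> real ^ 'n \<Rightarrow> real" where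
  "tnorm A g p v = sqrt (v \<bullet> (gram A g p *v v))"

definition local_rep ::
  "('a, 'n::finite) chart set \<Rightarrow> ('a \<Rightarrow> 'a) \<Rightarrow> 'a \<Rightarrow> real ^ 'n \<Rightarrow> real ^ 'n" where
  "local_rep A f p = chart_map (chart_at A (f p)) \<circ> f \<circ> chart_inv (chart_at A p)"

text \<open>The derivative \<open>Df\<^sub>p : T\<^sub>pM \<rightarrow> T\<^sub>f\<^sub>(\<^sub>p\<^sub>)M\<close>.\<close>

definition tderiv ::
  "('a, 'n::finite) chart set \<Rightarrow> ('a \<Rightarrow> 'a) \<Rightarrow> 'a \<Rightarrow> real ^ 'n \<Rightarrow> real ^ 'n" where
  "tderiv A f p = frechet_derivative (local_rep A f p) (at (chart_map (chart_at A p) p))"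

text \<open>
  The Jacobian with respect to the metric, i.e. the modulus of the determinant of \<open>Df\<^sub>p\<close> in
  orthonormal bases of the tangent spaces at \<open>p\<close> and \<open>f p\<close>.
\<close>

definition riem_jacobian ::
  "('a, 'n::finite) chart set \<Rightarrow> ('a, 'n) metric_tensor \<Rightarrow> ('a \<Rightarrow> 'a) \<Rightarrow> 'a \<Rightarrow> real" where
  "riem_jacobian A g f p =
     \<bar>det (matrix (tderiv A f p))\<bar> * sqrt (det (gram A g (f p))) / sqrt (det (gram A g p))"

text \<open>
  The derivative \<open>(D\<^sub>u g)(v,w)\<close> of the metric coefficients in the chart \<open>chart_at A p\<close>, and
  \<open>christoffel A g p u v = (\<Sum>\<^sub>i\<^sub>j \<Gamma>\<^sup>l\<^sub>i\<^sub>j u\<^sub>i v\<^sub>j)\<^sub>l\<close> for the Levi-Civita connection.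
\<close>

definition metric_deriv ::
  "('a, 'n::finite) chart set \<Rightarrow> ('a, 'n) metric_tensor \<Rightarrow> 'a
     \<Rightarrow> real ^ 'n \<Rightarrow> real ^ 'n \<Rightarrow> real ^ 'n \<Rightarrow> real" where
  "metric_deriv A g p u v w =
     (let c = chart_at A p
      in v \<bullet> (frechet_derivative (\<lambda>x. g c (chart_inv c x)) (at (chart_map c p)) u *v w))"

definition christoffel ::
  "('a, 'n::finite) chart set \<Rightarrow> ('a, 'n) metric_tensor \<Rightarrow> 'a
     \<Rightarrow> real ^ 'n \<Rightarrow> real ^ 'n \<Rightarrow> real ^ 'n" where
  "christoffel A g p u v =
     matrix_inv (gram A g p) *v
       (\<chi> k. (metric_deriv A g p u v (axis k 1) + metric_deriv A g p v u (axis k 1)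
              - metric_deriv A g p (axis k 1) u v) / 2)"

text \<open>
  The second derivative of \<open>f\<close> with respect to the metric: the covariant derivative
  \<open>(\<nabla>Df)\<^sub>p(u,v) \<in> T\<^sub>f\<^sub>(\<^sub>p\<^sub>)M\<close> of \<open>Df\<close>, whose components are
  \<open>\<partial>\<^sub>i\<partial>\<^sub>j f\<^sup>a - \<Gamma>\<^sup>k\<^sub>i\<^sub>j(p) \<partial>\<^sub>k f\<^sup>a + \<Gamma>\<^sup>a\<^sub>b\<^sub>c(f p) \<partial>\<^sub>i f\<^sup>b \<partial>\<^sub>j f\<^sup>c\<close>.
\<close>

definition tderiv2 ::
  "('a, 'n::finite) chart set \<Rightarrow> ('a, 'n) metric_tensor \<Rightarrow> ('a \<Rightarrow> 'a) \<Rightarrow> 'a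
     \<Rightarrow> real ^ 'n \<Rightarrow> real ^ 'n \<Rightarrow> real ^ 'n" where
  "tderiv2 A g f p u v =
     frechet_derivative (\<lambda>x. frechet_derivative (local_rep A f p) (at x) v)
       (at (chart_map (chart_at A p) p)) u
     - tderiv A f p (christoffel A g p u v)
     + christoffel A g (f p) (tderiv A f p u) (tderiv A f p v)"

text \<open>
  The \<open>C\<^sup>2\<close>-norm is the larger of the suprema of the operator norms of the first and the second
  derivative.
\<close>

definition C2_norm ::
  "('a, 'n::finite) chart set \<Rightarrow> ('a, 'n) metric_tensor \<Rightarrow> ('a \<Rightarrow> 'a) \<Rightarrow> ereal" where
  "C2_norm A g f = Sup
     ({ereal (tnorm A g (f p) (tderiv A f p v)) | p v. tnorm A g p v = 1} \<union>
      {ereal (tnorm A g (f p) (tderiv2 A g f p u v)) | p u v. tnorm A g p u = 1 \<and> tnorm A g p v = 1})"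

text \<open>The set \<open>\<E>(\<kappa>, \<Gamma>)\<close> of uniformly expanding maps with a \<open>C\<^sup>2\<close>-bound.\<close>

definition expanding_maps ::
  "('a::t2_space, 'n::finite) chart set \<Rightarrow> ('a, 'n) metric_tensor \<Rightarrow> real \<Rightarrow> real \<Rightarrow> ('a \<Rightarrow> 'a) set" where
  "expanding_maps A g \<kappa> \<Gamma> =
     {f. C2_map A f \<and>
         (\<forall>p v. \<kappa> * tnorm A g p v \<le> tnorm A g (f p) (tderiv A f p v)) \<and>
         C2_norm A g f \<le> ereal \<Gamma>}"


section \<open>Riemannian volume and distance\<close>

definition riemannian_volume ::
  "('a::t2_space, 'n::finite) chart set \<Rightarrow> ('a, 'n) metric_tensor \<Rightarrow> 'a measure \<Rightarrow> bool" where
  "riemannian_volume A g m \<longleftrightarrow> sets m = sets borel \<and>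
     (\<forall>c\<in>A. \<forall>B\<in>sets borel. B \<subseteq> chart_dom c \<longrightarrow>
        emeasure m B =
          (\<integral>\<^sup>+ x \<in> chart_map c ` B. ennreal (sqrt (det (g c (chart_inv c x)))) \<partial>lborel))"

text \<open>
  As in the library's \<open>piecewise_C1_differentiable_on\<close>, the derivative of a piecewise \<open>C\<^sup>1\<close> curve
  need not have one-sided limits at the exceptional points.  This does not affect the infimum
  defining the Riemannian distance.
\<close>

definition piecewise_C1_path ::
  "('a::topological_space, 'n::finite) chart set \<Rightarrow> (real \<Rightarrow> 'a) \<Rightarrow> bool" where
  "piecewise_C1_path A \<gamma> \<longleftrightarrow> path \<gamma> \<and>
     (\<exists>S. finite S \<and>
        (\<forall>c\<in>A. (chart_map c \<circ> \<gamma>) C1_differentiable_on ({0<..<1} \<inter> \<gamma> -` chart_dom c - S)))"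

definition path_length_riem ::
  "('a, 'n::finite) chart set \<Rightarrow> ('a, 'n) metric_tensor \<Rightarrow> (real \<Rightarrow> 'a) \<Rightarrow> ennreal" where
  "path_length_riem A g \<gamma> =
     (\<integral>\<^sup>+ t \<in> {0..1}. ennreal (tnorm A g (\<gamma> t)
        (vector_derivative (chart_map (chart_at A (\<gamma> t)) \<circ> \<gamma>) (at t))) \<partial>lborel)"

text \<open>Real-valued, since only connected manifolds are considered.\<close>

definition rdist ::
  "('a::topological_space, 'n::finite) chart set \<Rightarrow> ('a, 'n) metric_tensor \<Rightarrow> 'a \<Rightarrow> 'a \<Rightarrow> real" where
  "rdist A g p q =
     enn2real (INF \<gamma> \<in> {\<gamma>. piecewise_C1_path A \<gamma> \<and> pathstart \<gamma> = p \<and> pathfinish \<gamma> = q}.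
                 path_length_riem A g \<gamma>)"


section \<open>Topological entropy of a nonautonomous system\<close>

primrec iter :: "(nat \<Rightarrow> 'a \<Rightarrow> 'a) \<Rightarrow> nat \<Rightarrow> 'a \<Rightarrow> 'a" where
  "iter f 0 = id"
| "iter f (Suc n) = f n \<circ> iter f n"

definition open_cover :: "'a::topological_space set set \<Rightarrow> bool" where
  "open_cover \<U> \<longleftrightarrow> (\<forall>U\<in>\<U>. open U) \<and> \<Union>\<U> = UNIV"

definition lebesgue_number :: "('a \<Rightarrow> 'a \<Rightarrow> real) \<Rightarrow> 'a set set \<Rightarrow> real \<Rightarrow> bool" where
  "lebesgue_number d \<U> \<delta> \<longleftrightarrow> \<delta> > 0 \<and> (\<forall>x. \<exists>U\<in>\<U>. {y. d x y < \<delta>} \<subseteq> U)"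

definition pullback_join :: "(nat \<Rightarrow> 'a \<Rightarrow> 'a) \<Rightarrow> (nat \<Rightarrow> 'a set set) \<Rightarrow> nat \<Rightarrow> 'a set set" where
  "pullback_join f \<U> n = {(\<Inter>i<n. iter f i -` V i) | V. \<forall>i<n. V i \<in> \<U> i}"

text \<open>Finite subcovers suffice, because the spaces considered are compact.\<close>

definition min_subcover_card :: "'a set set \<Rightarrow> nat" where
  "min_subcover_card \<U> = (LEAST k. \<exists>\<C>\<subseteq>\<U>. finite \<C> \<and> \<Union>\<C> = UNIV \<and> card \<C> = k)"

definition cover_entropy :: "(nat \<Rightarrow> 'a \<Rightarrow> 'a) \<Rightarrow> (nat \<Rightarrow> 'a set set) \<Rightarrow> ereal" where
  "cover_entropy f \<U> =
     limsup (\<lambda>n. ereal (ln (real (min_subcover_card (pullback_join f \<U> n))) / real n))"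

definition top_entropy ::
  "('a::topological_space \<Rightarrow> 'a \<Rightarrow> real) \<Rightarrow> (nat \<Rightarrow> 'a \<Rightarrow> 'a) \<Rightarrow> ereal" where
  "top_entropy d f =
     (SUP \<U> \<in> {\<U>. (\<forall>n. open_cover (\<U> n)) \<and> (\<exists>\<delta>>0. \<forall>n. lebesgue_number d (\<U> n) \<delta>)}.
        cover_entropy f \<U>)"

end

theory Submission
  imports Defs
begin

text \<open>
  Write \<open>F\<^sub>n = iter f n\<close>.  Since \<open>|Df v| \<ge> |v|\<close>, every \<open>F\<^sub>n\<close> is a local diffeomorphism of a compact
  connected manifold, hence a finite covering with the same number \<open>N\<^sub>n\<close> of preimages over every
  point.  Change of variables on pieces on which \<open>F\<^sub>n\<close> is injective gives
  \<open>\<integral> |det DF\<^sub>n| dm = \<integral> #F\<^sub>n\<^sup>-\<^sup>1(y) dm(y) = N\<^sub>n\<close>, because \<open>m(M) = 1\<close>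
  (\<open>integral_riem_jacobian\<close>).  So the claim is that the entropy is the exponential growth rate of the
  degrees \<open>N\<^sub>n\<close> (\<open>top_entropy_eq_degree_growth\<close>).

  Upper bound (\<open>small_subcover\<close>).  Given covers with Lebesgue number \<open>\<delta>\<close>, cover \<open>M\<close> by finitely many,
  say \<open>K\<close>, chart balls in which any two points are joined by a path of length less than \<open>\<delta>\<close>.
  A chart ball is simply connected, so for every \<open>n\<close> its preimage under \<open>F\<^sub>n\<close> consists of \<open>N\<^sub>n\<close>
  sheets.  Short paths in the ball lift to the sheets, and since no map \<open>f\<^sub>i\<close> shortens paths, the images
  of the lifts under \<open>F\<^sub>i\<close>, \<open>i < n\<close>, have length less than \<open>\<delta>\<close>, too.  Hence every sheet lies in an
  element of the join, and \<open>K N\<^sub>n\<close> elements cover \<open>M\<close>, with \<open>K\<close> independent of \<open>n\<close>.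

  Lower bound (\<open>card_fibre_le_subcover\<close>).  The open sets on which \<open>f\<^sub>i\<close> is injective form a cover, and
  these covers have a common Lebesgue number (\<open>uniform_local_injectivity\<close>): a path of length less
  than \<open>\<delta>\<close> is mapped by \<open>f\<^sub>i\<close> to a path of length less than \<open>\<Gamma> \<delta>\<close>, which cannot leave a chart ball, and so
  the path stays in one sheet over this ball, where \<open>f\<^sub>i\<close> is injective.  An element of the join of these
  covers contains at most one point of each fibre of \<open>F\<^sub>n\<close>, so a subcover has at least \<open>N\<^sub>n\<close>
  elements.
\<close>

section \<open>Sections and lifts of local homeomorphisms\<close>

definition locally_injective :: "('a::topological_space \<Rightarrow> 'b) \<Rightarrow> bool" where
  "locally_injective F \<longleftrightarrow> (\<forall>x. \<exists>U. open U \<and> x \<in> U \<and> inj_on F U)"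

text \<open>
  This is the part of ``\<open>V\<close> is evenly covered by \<open>F\<close>'' that the argument needs: every point above \<open>V\<close> lies
  on a continuous section over \<open>V\<close>.  For connected \<open>V\<close> and locally injective \<open>F\<close> the images of the
  sections are the sheets over \<open>V\<close>.
\<close>
definition sections_over :: "('a::topological_space \<Rightarrow> 'b::topological_space) \<Rightarrow> 'b set \<Rightarrow> bool" where
  "sections_over F V \<longleftrightarrow>
     (\<forall>x. F x \<in> V \<longrightarrow> (\<exists>G. continuous_on V G \<and> (\<forall>w\<in>V. F (G w) = w) \<and> G (F x) = x))"

text \<open>
  The set where two lifts agree is open because \<open>F\<close> is locally injective, and closed because the
  space is Hausdorff.
\<close>
lemma lift_unique:
  fixes h1 h2 :: "'b::topological_space \<Rightarrow> 'a::t2_space"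
  assumes inj: "locally_injective F" and S: "connected S"
    and c: "continuous_on S h1" "continuous_on S h2"
    and F: "\<And>s. s \<in> S \<Longrightarrow> F (h1 s) = F (h2 s)"
    and s0: "s0 \<in> S" "h1 s0 = h2 s0" and s: "s \<in> S"
  shows "h1 s = h2 s"
proof -
  have "(h1 s = h2 s) = (h1 s0 = h2 s0)"
  proof (rule connected_local_const[OF S s s0(1)], intro ballI)
    fix a assume a: "a \<in> S"
    have t: "(h1 \<longlongrightarrow> h1 a) (at a within S)" "(h2 \<longlongrightarrow> h2 a) (at a within S)"
      using c a by (auto simp: continuous_on_def)
    show "\<forall>\<^sub>F b in at a within S. (h1 a = h2 a) = (h1 b = h2 b)"
    proof (cases "h1 a = h2 a")
      case True
      obtain U where U: "open U" "h1 a \<in> U" "inj_on F U"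
        using inj by (auto simp: locally_injective_def)
      have "\<forall>\<^sub>F b in at a within S. h1 b \<in> U" "\<forall>\<^sub>F b in at a within S. h2 b \<in> U"
        using t U True by (auto simp: tendsto_def)
      moreover have "\<forall>\<^sub>F b in at a within S. b \<in> S"
        by (simp add: eventually_at_filter)
      ultimately show ?thesis
        by eventually_elim (use U True F in \<open>auto dest: inj_onD\<close>)
    next
      case False
      then obtain U V where U: "open U" "open V" "h1 a \<in> U" "h2 a \<in> V" "U \<inter> V = {}"
        using hausdorff[OF False] by metis
      have "\<forall>\<^sub>F b in at a within S. h1 b \<in> U" "\<forall>\<^sub>F b in at a within S. h2 b \<in> V"
        using t U by (auto simp: tendsto_def)
      then show ?thesis
        by eventually_elim (use U False in auto)
    qed
  qed
  then show ?thesis using s0 by simp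
qed

text \<open>
  Finitely many open sets on which \<open>F\<close> is injective cover the space, and each of them contains at most
  one point of the fibre.
\<close>
lemma finite_fibres:
  fixes F :: "'a::topological_space \<Rightarrow> 'b::t1_space"
  assumes "compact (UNIV :: 'a set)" "continuous_on UNIV F" "locally_injective F"
  shows "finite (F -` {y})"
proof -
  obtain U where U: "\<And>x. open (U x)" "\<And>x. x \<in> U x" "\<And>x. inj_on F (U x)"
    using assms(3) unfolding locally_injective_def by metis
  obtain X where X: "finite X" "(UNIV :: 'a set) \<subseteq> (\<Union>x\<in>X. U x)"
    by (rule compactE_image[OF assms(1), of UNIV U]) (use U in auto)
  have "finite (U x \<inter> F -` {y})" for x
  proof (rule finite_imageD)
    show "finite (F ` (U x \<inter> F -` {y}))" by (rule finite_subset[of _ "{y}"]) auto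
    show "inj_on F (U x \<inter> F -` {y})" using U(3) by (auto intro: inj_on_subset)
  qed
  moreover have "F -` {y} \<subseteq> (\<Union>x\<in>X. U x \<inter> F -` {y})" using X by blast
  ultimately show ?thesis using X(1) by (meson finite_UN finite_subset)
qed

lemma local_inverse_continuous:
  fixes F :: "'a::topological_space \<Rightarrow> 'b::topological_space"
  assumes "\<And>U. open U \<Longrightarrow> open (F ` U)" "open U" "inj_on F U"
  shows "continuous_on (F ` U) (inv_into U F)"
proof (subst continuous_on_open_vimage)
  show "open (F ` U)" using assms by blast
  show "\<forall>B. open B \<longrightarrow> open (inv_into U F -` B \<inter> F ` U)"
  proof (intro allI impI)
    fix B :: "'a set" assume "open B"
    have "inv_into U F -` B \<inter> F ` U = F ` (U \<inter> B)"
      using assms(3) by (auto simp: inv_into_f_f)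
    then show "open (inv_into U F -` B \<inter> F ` U)" using assms(1,2) \<open>open B\<close> by (simp add: open_Int)
  qed
qed

text \<open>
  A proper local homeomorphism is a covering.  Around the finitely many preimages of \<open>y\<close> there are
  local inverses, and compactness excludes further preimages of points close to \<open>y\<close>.
\<close>
lemma local_sections:
  fixes F :: "'a::t2_space \<Rightarrow> 'b::t2_space"
  assumes cpt: "compact (UNIV :: 'a set)" and cont: "continuous_on UNIV F"
    and opn: "\<And>U. open U \<Longrightarrow> open (F ` U)" and inj: "locally_injective F"
  shows "\<exists>W. open W \<and> y \<in> W \<and> sections_over F W"
proof -
  obtain U where U: "\<And>x. open (U x)" "\<And>x. x \<in> U x" "\<And>x. inj_on F (U x)"
    using inj unfolding locally_injective_def by metis
  define X where "X = F -` {y}"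
  have fin: "finite X" unfolding X_def by (rule finite_fibres[OF cpt cont inj])
  \<comment> \<open>the image of this compact set is closed and does not contain \<open>y\<close>\<close>
  define C where "C = UNIV - (\<Union>x\<in>X. U x)"
  have "compact C" unfolding C_def using U cpt
    by (metis Compl_eq_Diff_UNIV closed_Compl compact_Int_closed inf_top_left open_UN)
  then have cC: "closed (F ` C)"
    by (meson cont compact_continuous_image compact_imp_closed continuous_on_subset top_greatest)
  define W where "W = (\<Inter>x\<in>X. F ` U x) - F ` C"
  have "open W" unfolding W_def using fin U opn cC by (auto intro!: open_Diff open_INT)
  moreover have "y \<in> W"
    unfolding W_def C_def X_def using U(2) by (auto simp: image_iff)
  moreover have "sections_over F W"
    unfolding sections_over_def
  proof (intro allI impI)
    fix z assume z: "F z \<in> W"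
    then obtain x where x: "x \<in> X" "z \<in> U x" unfolding W_def C_def by blast
    have W: "W \<subseteq> F ` U x" using x by (auto simp: W_def)
    have "continuous_on W (inv_into (U x) F)"
      using continuous_on_subset[OF local_inverse_continuous[OF opn U(1,3)] W] .
    moreover have "\<forall>w\<in>W. F (inv_into (U x) F w) = w"
      using W by (meson f_inv_into_f subsetD)
    moreover have "inv_into (U x) F (F z) = z" using x U by simp
    ultimately show "\<exists>G. continuous_on W G \<and> (\<forall>w\<in>W. F (G w) = w) \<and> G (F z) = z" by blast
  qed
  ultimately show ?thesis by blast
qed

text \<open>
  A step of homotopy lifting: a lift over the convex set \<open>D\<close> extends to a slightly larger convex set
  \<open>D'\<close>.  The extension at \<open>p\<close> uses the section through the lift of the nearest point \<open>\<pi> p\<close> of \<open>D\<close>, over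
  the image of a ball around \<open>\<pi> p\<close> that contains \<open>p\<close>.
\<close>
lemma lift_enlarge:
  fixes F :: "'a::t2_space \<Rightarrow> 'b::topological_space" and \<sigma> :: "'e::euclidean_space \<Rightarrow> 'b"
  assumes inj: "locally_injective F"
    and C: "convex C" "continuous_on C \<sigma>"
    and D: "convex D" "closed D" "D \<noteq> {}" "D \<subseteq> C" and D': "convex D'" "D \<subseteq> D'" "D' \<subseteq> C"
    and near: "\<And>p. p \<in> D' \<Longrightarrow> \<exists>q\<in>D. dist p q \<le> e / 2"
    and e: "e > 0" and W: "\<And>p. p \<in> C \<Longrightarrow> \<exists>W. \<sigma> ` (C \<inter> ball p e) \<subseteq> W \<and> sections_over F W"
    and G: "continuous_on D G" "\<And>p. p \<in> D \<Longrightarrow> F (G p) = \<sigma> p"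
  shows "\<exists>G'. continuous_on D' G' \<and> (\<forall>p\<in>D'. F (G' p) = \<sigma> p) \<and> (\<forall>p\<in>D. G' p = G p)"
proof -
  define \<pi> where "\<pi> = closest_point D"
  have \<pi>D: "\<pi> p \<in> D" for p unfolding \<pi>_def using D by (simp add: closest_point_in_set)
  have \<pi>d: "dist p (\<pi> p) \<le> e / 2" if "p \<in> D'" for p
    using near[OF that] closest_point_le[OF D(2)] unfolding \<pi>_def by (metis order_trans)
  have \<pi>l: "dist (\<pi> p) (\<pi> q) \<le> dist p q" for p q
    unfolding \<pi>_def using D by (intro closest_point_lipschitz) auto
  have "\<exists>h. continuous_on (C \<inter> ball (\<pi> p) e) h \<and> (\<forall>q\<in>C \<inter> ball (\<pi> p) e. F (h q) = \<sigma> q) \<and> h (\<pi> p) = G (\<pi> p)"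
    for p
  proof -
    have pC: "\<pi> p \<in> C \<inter> ball (\<pi> p) e" using \<pi>D D e by auto
    obtain W' where W': "\<sigma> ` (C \<inter> ball (\<pi> p) e) \<subseteq> W'" "sections_over F W'" using W pC by blast
    have "F (G (\<pi> p)) \<in> W'" using W' pC G(2)[OF \<pi>D] by auto
    then obtain s where s: "continuous_on W' s" "\<forall>w\<in>W'. F (s w) = w" "s (F (G (\<pi> p))) = G (\<pi> p)"
      using W'(2) unfolding sections_over_def by blast
    have "continuous_on (C \<inter> ball (\<pi> p) e) (\<lambda>q. s (\<sigma> q))"
      by (rule continuous_on_compose2[OF s(1)]) (use W' C in \<open>auto intro: continuous_on_subset\<close>)
    moreover have "\<forall>q\<in>C \<inter> ball (\<pi> p) e. F (s (\<sigma> q)) = \<sigma> q" using s W' by auto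
    moreover have "s (\<sigma> (\<pi> p)) = G (\<pi> p)" using s(3) G(2)[OF \<pi>D] by simp
    ultimately show ?thesis by blast
  qed
  then obtain h where h0: "\<And>p. continuous_on (C \<inter> ball (\<pi> p) e) (h p) \<and>
      (\<forall>q\<in>C \<inter> ball (\<pi> p) e. F (h p q) = \<sigma> q) \<and> h p (\<pi> p) = G (\<pi> p)"
    by metis
  then have h: "\<And>p. continuous_on (C \<inter> ball (\<pi> p) e) (h p)"
      "\<And>p q. q \<in> C \<Longrightarrow> q \<in> ball (\<pi> p) e \<Longrightarrow> F (h p q) = \<sigma> q" "\<And>p. h p (\<pi> p) = G (\<pi> p)"
    by blast+
  define G' where "G' p = h p p" for p
  have self: "p \<in> ball (\<pi> p) e" if "p \<in> D'" for p
    using \<pi>d[OF that] e by (simp add: dist_commute)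
  \<comment> \<open>close to \<open>p0\<close> all these sections are the one at \<open>p0\<close>, by uniqueness of lifts along segments; so \<open>G'\<close> is continuous\<close>
  have loc: "G' p = h p0 p" if p: "p0 \<in> D'" "p \<in> D'" "dist p p0 < e / 4" for p p0
  proof -
    have b1: "\<pi> p \<in> ball (\<pi> p0) e" using \<pi>l[of p0 p] p e by (simp add: dist_commute)
    have b2: "p \<in> ball (\<pi> p0) e"
      using dist_triangle[of "\<pi> p0" p p0] \<pi>d[OF p(1)] p e by (simp add: dist_commute)
    have conv: "convex (D \<inter> ball (\<pi> p0) e)" "convex (C \<inter> ball (\<pi> p0) e \<inter> ball (\<pi> p) e)"
      using D C by (auto intro: convex_Int)
    have eq1: "h p0 (\<pi> p) = G (\<pi> p)"
    proof (rule lift_unique[OF inj convex_connected[OF conv(1)],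
            where ?h1.0 = "h p0" and ?h2.0 = G and ?s0.0 = "\<pi> p0"])
      show "continuous_on (D \<inter> ball (\<pi> p0) e) (h p0)"
        by (rule continuous_on_subset[OF h(1)]) (use D in auto)
      show "continuous_on (D \<inter> ball (\<pi> p0) e) G"
        by (rule continuous_on_subset[OF G(1)]) auto
      show "F (h p0 s) = F (G s)" if "s \<in> D \<inter> ball (\<pi> p0) e" for s
        using that h(2)[of s p0] G(2)[of s] D by auto
      show "\<pi> p0 \<in> D \<inter> ball (\<pi> p0) e" "\<pi> p \<in> D \<inter> ball (\<pi> p0) e" using \<pi>D e b1 by auto
      show "h p0 (\<pi> p0) = G (\<pi> p0)" by (rule h(3))
    qed
    show ?thesis unfolding G'_def
    proof (rule lift_unique[OF inj convex_connected[OF conv(2)],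
            where ?h1.0 = "h p" and ?h2.0 = "h p0" and ?s0.0 = "\<pi> p"])
      show "continuous_on (C \<inter> ball (\<pi> p0) e \<inter> ball (\<pi> p) e) (h p)"
        using h(1) by (rule continuous_on_subset) auto
      show "continuous_on (C \<inter> ball (\<pi> p0) e \<inter> ball (\<pi> p) e) (h p0)"
        using h(1) by (rule continuous_on_subset) auto
      show "F (h p s) = F (h p0 s)" if "s \<in> C \<inter> ball (\<pi> p0) e \<inter> ball (\<pi> p) e" for s
        using that h(2)[of s p0] h(2)[of s p] by auto
      show "\<pi> p \<in> C \<inter> ball (\<pi> p0) e \<inter> ball (\<pi> p) e" using \<pi>D[of p] D(4) e b1 by auto
      show "p \<in> C \<inter> ball (\<pi> p0) e \<inter> ball (\<pi> p) e" using self[OF p(2)] p(2) D'(3) b2 by auto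
      show "h p (\<pi> p) = h p0 (\<pi> p)" using h(3)[of p] eq1 by simp
    qed
  qed
  have "continuous_on D' G'"
    unfolding continuous_on_eq_continuous_within
  proof
    fix p0 assume p0: "p0 \<in> D'"
    have "continuous_on (D' \<inter> ball p0 (e/4)) (h p0)"
    proof (rule continuous_on_subset[OF h(1)[of p0]], rule)
      fix p assume "p \<in> D' \<inter> ball p0 (e/4)"
      then show "p \<in> C \<inter> ball (\<pi> p0) e"
        using dist_triangle[of "\<pi> p0" p p0] \<pi>d[OF p0] D' e by (auto simp: dist_commute)
    qed
    then have "continuous_on (D' \<inter> ball p0 (e/4)) G'"
      by (rule continuous_on_eq) (metis Int_iff mem_ball dist_commute loc p0)
    then have "continuous (at p0 within D' \<inter> ball p0 (e/4)) G'"
      using p0 e by (simp add: continuous_on_eq_continuous_within)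
    moreover have "at p0 within D' \<inter> ball p0 (e/4) = at p0 within D'"
      by (rule at_within_nhd[of _ "ball p0 (e/4)"]) (use e in auto)
    ultimately show "continuous (at p0 within D') G'" by simp
  qed
  moreover have "F (G' p) = \<sigma> p" if "p \<in> D'" for p
    unfolding G'_def using h self that D' by blast
  moreover have "G' p = G p" if "p \<in> D" for p
  proof -
    have "\<pi> p = p" using that D by (simp add: \<pi>_def closest_point_self)
    then show ?thesis unfolding G'_def using h(3)[of p] by simp
  qed
  ultimately show ?thesis by blast
qed

text \<open>
  Lifting along a map of a compact convex set, by enlarging the domain of the lift from \<open>{c0}\<close> through
  concentric balls whose radii grow by half a Lebesgue number.
\<close>
lemma lift_convex:
  fixes F :: "'a::t2_space \<Rightarrow> 'b::topological_space" and \<sigma> :: "'e::euclidean_space \<Rightarrow> 'b"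
  assumes inj: "locally_injective F"
    and loc: "\<And>y. \<exists>W. open W \<and> y \<in> W \<and> sections_over F W"
    and C: "convex C" "compact C" "continuous_on C \<sigma>"
    and c0: "c0 \<in> C" "F x0 = \<sigma> c0"
  shows "\<exists>G. continuous_on C G \<and> (\<forall>p\<in>C. F (G p) = \<sigma> p) \<and> G c0 = x0"
proof -
  obtain W where W: "\<And>y. open (W y)" "\<And>y. y \<in> W y" "\<And>y. sections_over F (W y)"
    using loc by metis
  have "\<exists>T. open T \<and> C \<inter> \<sigma> -` W y = C \<inter> T" for y
    using continuous_openin_preimage_gen[OF C(3) W(1)[of y]] by (auto simp: openin_open)
  then obtain T where T: "\<And>y. open (T y)" "\<And>y. C \<inter> \<sigma> -` W y = C \<inter> T y" by metis
  have cov: "C \<subseteq> \<Union> (range T)"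
  proof
    fix c assume "c \<in> C"
    then have "c \<in> C \<inter> \<sigma> -` W (\<sigma> c)" using W(2) by simp
    then show "c \<in> \<Union> (range T)" using T(2) by blast
  qed
  obtain \<delta> where \<delta>: "0 < \<delta>" "\<And>S. \<lbrakk>S \<subseteq> C; diameter S < \<delta>\<rbrakk> \<Longrightarrow> \<exists>B\<in>range T. S \<subseteq> B"
    using Lebesgue_number_lemma[OF C(2) _ cov] T(1) by blast
  define e where "e = \<delta> / 4"
  have e: "e > 0" using \<delta> by (simp add: e_def)
  have We: "\<exists>V. \<sigma> ` (C \<inter> ball p e) \<subseteq> V \<and> sections_over F V" if "p \<in> C" for p
  proof -
    have "diameter (C \<inter> ball p e) \<le> diameter (ball p e)"
      by (rule diameter_subset) auto
    also have "\<dots> < \<delta>" using e \<delta> by (simp add: e_def)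
    finally obtain y where "C \<inter> ball p e \<subseteq> T y" using \<delta>(2)[of "C \<inter> ball p e"] by auto
    then have "C \<inter> ball p e \<subseteq> C \<inter> \<sigma> -` W y" unfolding T(2) by blast
    then show ?thesis using W(3)[of y] by blast
  qed
  define D where "D k = C \<inter> cball c0 (real k * (e / 2))" for k
  have D: "convex (D k)" "closed (D k)" "D k \<subseteq> C" "c0 \<in> D k" for k
    using C c0 e by (auto simp: D_def intro: convex_Int compact_imp_closed)
  have "\<exists>G. continuous_on (D k) G \<and> (\<forall>p\<in>D k. F (G p) = \<sigma> p) \<and> G c0 = x0" for k
  proof (induction k)
    case 0
    have "D 0 = {c0}" using c0 by (auto simp: D_def)
    then show ?case using c0 by (intro exI[of _ "\<lambda>_. x0"]) auto
  next
    case (Suc k)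
    then obtain G where G: "continuous_on (D k) G" "\<And>p. p \<in> D k \<Longrightarrow> F (G p) = \<sigma> p" "G c0 = x0"
      by blast
    have mono: "D k \<subseteq> D (Suc k)" using e by (auto simp: D_def algebra_simps intro: order_trans)
    \<comment> \<open>shrinking \<open>p\<close> towards \<open>c0\<close> by the factor \<open>k / (k + 1)\<close> moves it by at most \<open>e / 2\<close>\<close>
    have near: "\<exists>q\<in>D k. dist p q \<le> e / 2" if p: "p \<in> D (Suc k)" for p
    proof -
      define t where "t = real k / real (Suc k)"
      have t: "0 \<le> t" "t \<le> 1" "1 - t = 1 / real (Suc k)" by (auto simp: t_def field_simps)
      define q where "q = (1 - t) *\<^sub>R c0 + t *\<^sub>R p"
      have q0: "q - c0 = t *\<^sub>R (p - c0)" "p - q = (1 - t) *\<^sub>R (p - c0)"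
        by (auto simp: q_def algebra_simps)
      have pd: "norm (p - c0) \<le> real (Suc k) * (e / 2)"
        using p by (simp add: D_def dist_norm norm_minus_commute)
      have "t * norm (p - c0) \<le> t * (real (Suc k) * (e / 2))"
        by (rule mult_left_mono[OF pd t(1)])
      also have "\<dots> = real k * (e / 2)" by (simp add: t_def)
      finally have "norm (q - c0) \<le> real k * (e / 2)" unfolding q0 using t by simp
      moreover have "q \<in> C" unfolding q_def using p c0 t(1,2) C(1) by (intro convexD_alt) (auto simp: D_def)
      ultimately have "q \<in> D k" by (simp add: D_def dist_norm norm_minus_commute)
      moreover have "(1 - t) * norm (p - c0) \<le> (1 - t) * (real (Suc k) * (e / 2))"
        by (rule mult_left_mono[OF pd]) (use t in simp)
      then have "norm (p - q) \<le> e / 2" unfolding q0 using t by simp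
      ultimately show ?thesis by (auto simp: dist_norm)
    qed
    have "\<exists>G'. continuous_on (D (Suc k)) G' \<and> (\<forall>p\<in>D (Suc k). F (G' p) = \<sigma> p) \<and> (\<forall>p\<in>D k. G' p = G p)"
      by (rule lift_enlarge[OF inj C(1,3) D(1,2) _ D(3,1) mono D(3) near e We G(1,2)]) (use D(4)[of k] in auto)
    then show ?case using G(3) D(4)[of k] by auto
  qed
  moreover obtain k where "D k = C"
  proof -
    obtain r where r: "C \<subseteq> cball c0 r"
      using compact_imp_bounded[OF C(2)] bounded_any_center[of C c0] by (metis mem_cball subsetI)
    obtain k where "r \<le> real k * (e / 2)"
      using reals_Archimedean3[OF half_gt_zero[OF e]] by (meson less_imp_le)
    then have "D k = C" using r by (force simp: D_def)
    then show thesis by (rule that)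
  qed
  ultimately show ?thesis by metis
qed

text \<open>
  Simply connected sets are evenly covered, in the case of a set \<open>V\<close> that is parametrised by a part of a
  compact convex set.
\<close>
lemma sections_over_convex:
  fixes F :: "'a::t2_space \<Rightarrow> 'b::topological_space" and \<psi> :: "'e::euclidean_space \<Rightarrow> 'b"
  assumes inj: "locally_injective F"
    and loc: "\<And>y. \<exists>W. open W \<and> y \<in> W \<and> sections_over F W"
    and C: "convex C" "compact C" "continuous_on C \<psi>"
    and V: "continuous_on V \<phi>" "\<phi> ` V \<subseteq> C" "\<And>w. w \<in> V \<Longrightarrow> \<psi> (\<phi> w) = w"
  shows "sections_over F V"
  unfolding sections_over_def
proof (intro allI impI)
  fix x assume x: "F x \<in> V"
  obtain G where G: "continuous_on C G" "\<forall>p\<in>C. F (G p) = \<psi> p" "G (\<phi> (F x)) = x"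
    using lift_convex[OF inj loc C, of "\<phi> (F x)" x] x V by (metis image_subset_iff)
  have "continuous_on V (G \<circ> \<phi>)"
    using continuous_on_compose[OF V(1)] G(1) V(2) continuous_on_subset by blast
  then show "\<exists>G. continuous_on V G \<and> (\<forall>w\<in>V. F (G w) = w) \<and> G (F x) = x"
    by (rule exI[of _ "G \<circ> \<phi>", OF conjI]) (use G V in auto)
qed

text \<open>
  Near each of its points, a section is a local inverse of \<open>F\<close>.
\<close>
lemma section_image_open:
  fixes F :: "'a::topological_space \<Rightarrow> 'b::topological_space"
  assumes cont: "continuous_on UNIV F" and inj: "locally_injective F"
    and V: "open V" and G: "continuous_on V G" "\<And>w. w \<in> V \<Longrightarrow> F (G w) = w"
  shows "open (G ` V)"
proof (subst open_subopen, intro ballI)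
  fix z assume "z \<in> G ` V"
  then obtain w where w: "w \<in> V" "z = G w" by blast
  obtain U where U: "open U" "z \<in> U" "inj_on F U"
    using inj unfolding locally_injective_def by blast
  have oV: "open (G -` U \<inter> V)"
    using G(1) V U(1) by (simp add: continuous_on_open_vimage)
  have "open (U \<inter> F -` (G -` U \<inter> V))"
    by (intro open_Int U(1) open_vimage oV cont)
  moreover have "z \<in> U \<inter> F -` (G -` U \<inter> V)" using w U G by auto
  moreover have "U \<inter> F -` (G -` U \<inter> V) \<subseteq> G ` V"
  proof
    fix u assume u: "u \<in> U \<inter> F -` (G -` U \<inter> V)"
    then have "F (G (F u)) = F u" using G(2) by simp
    then have "G (F u) = u" using U(3) u by (auto dest: inj_onD)
    then show "u \<in> G ` V" using u by force
  qed
  ultimately show "\<exists>T. open T \<and> z \<in> T \<and> T \<subseteq> G ` V" by blast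
qed

text \<open>
  Sections over a connected set transport the points of one fibre injectively to another one.
\<close>
lemma card_fibre_le:
  fixes F :: "'a::t2_space \<Rightarrow> 'b::t1_space"
  assumes fin: "finite (F -` {y'})" and inj: "locally_injective F"
    and V: "connected V" "sections_over F V" "y \<in> V" "y' \<in> V"
  shows "card (F -` {y}) \<le> card (F -` {y'})"
proof -
  have "\<forall>x. \<exists>G. F x = y \<longrightarrow> continuous_on V G \<and> (\<forall>w\<in>V. F (G w) = w) \<and> G y = x"
    using V unfolding sections_over_def by metis
  then obtain G where G: "\<And>x. F x = y \<Longrightarrow> continuous_on V (G x)"
      "\<And>x w. F x = y \<Longrightarrow> w \<in> V \<Longrightarrow> F (G x w) = w" "\<And>x. F x = y \<Longrightarrow> G x y = x"
    by metis
  have "inj_on (\<lambda>x. G x y') (F -` {y})"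
  proof (rule inj_onI)
    fix x x' assume x: "x \<in> F -` {y}" "x' \<in> F -` {y}" and eq: "G x y' = G x' y'"
    have "G x y = G x' y"
      by (rule lift_unique[OF inj V(1), where ?h1.0 = "G x" and ?h2.0 = "G x'" and ?s0.0 = y'])
        (use x eq G V in auto)
    then show "x = x'" using x G(3) by simp
  qed
  then show ?thesis
    by (rule card_inj_on_le) (use G V fin in auto)
qed

lemma card_fibre_const:
  fixes F :: "'a::t2_space \<Rightarrow> 'b::t1_space"
  assumes fin: "\<And>y. finite (F -` {y})" and inj: "locally_injective F"
    and conn: "connected (UNIV :: 'b set)"
    and V: "\<And>y. \<exists>V. open V \<and> connected V \<and> y \<in> V \<and> sections_over F V"
  shows "card (F -` {y}) = card (F -` {y'})"
proof (rule connected_local_const[OF conn], simp_all, intro allI)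
  fix a
  obtain V where V: "open V" "connected V" "a \<in> V" "sections_over F V" using V by blast
  have "\<forall>\<^sub>F b in nhds a. b \<in> V" using V by (simp add: eventually_nhds_in_open)
  then have "\<forall>\<^sub>F b in at a. b \<in> V" by (simp add: eventually_at_filter eventually_mono)
  then show "\<forall>\<^sub>F b in at a. card (F -` {a}) = card (F -` {b})"
    by eventually_elim (use V card_fibre_le[OF fin inj V(2,4)] in \<open>auto intro: antisym\<close>)
qed

section \<open>Change of variables\<close>

text \<open>
  The theorem \<open>has_absolute_integral_change_of_variables\<close> is about vectors with a well-ordered index type.
  Every finite type can be well-ordered, so a copy of the index type is equipped with a well-order, and the
  formula is transported along the resulting renaming of coordinates.
\<close>
typedef 'n wo = "UNIV :: 'n set" by auto

lemma Rep_wo_bij: "bij Rep_wo"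
  by (metis Rep_wo_inject Rep_wo_inverse Abs_wo_inverse UNIV_I bijI inj_def surj_def)

instance wo :: (finite) finite
proof
  have "inj (Rep_wo :: 'a wo \<Rightarrow> 'a)" using Rep_wo_bij by (rule bij_is_inj)
  then show "finite (UNIV :: 'a wo set)" by (rule finite_imageD[rotated]) simp
qed

instantiation wo :: (finite) wellorder
begin

definition less_eq_wo :: "'a wo \<Rightarrow> 'a wo \<Rightarrow> bool" where
  "less_eq_wo a b \<longleftrightarrow> to_nat (Rep_wo a) \<le> to_nat (Rep_wo b)"

definition less_wo :: "'a wo \<Rightarrow> 'a wo \<Rightarrow> bool" where
  "less_wo a b \<longleftrightarrow> to_nat (Rep_wo a) < to_nat (Rep_wo b)"

instance
proof
  fix P :: "'a wo \<Rightarrow> bool" and a :: "'a wo"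
  assume H: "\<And>x. (\<And>y. y < x \<Longrightarrow> P y) \<Longrightarrow> P x"
  show "P a"
    by (rule measure_induct_rule[of "\<lambda>a. to_nat (Rep_wo a)"]) (use H less_wo_def in blast)
qed (auto simp: less_eq_wo_def less_wo_def Rep_wo_inject)

end

text \<open>
  Conjugation with the bijection \<open>e\<close> preserves the sign of permutations.
\<close>
lemma det_reindex:
  fixes A :: "'a::comm_ring_1^'n^'n" and e :: "'m::finite \<Rightarrow> 'n::finite"
  assumes e: "bij e"
  shows "det (\<chi> i j. A $ e i $ e j) = det A"
proof -
  let ?m = "map_permutation UNIV e"
  have inj: "inj e" using e by (rule bij_is_inj)
  have bij: "bij_betw ?m {p. p permutes UNIV} {p. p permutes (UNIV :: 'n set)}"
  proof (rule bij_betw_byWitness[where f' = "map_permutation UNIV (inv e)"])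
    show "\<forall>p\<in>{p. p permutes UNIV}. map_permutation UNIV (inv e) (?m p) = p"
      using e by (auto intro!: map_permutation_compose_inv simp: bij_is_inj)
    show "\<forall>p\<in>{p. p permutes UNIV}. ?m (map_permutation UNIV (inv e) p) = p"
      using e by (auto intro!: map_permutation_compose_inv simp: bij_imp_bij_inv bij_is_surj surj_f_inv_f)
  qed (use e in \<open>auto intro!: map_permutation_permutes simp: bij_imp_bij_inv\<close>)
  have "det A = (\<Sum>p | p permutes UNIV. of_int (sign (?m p)) * (\<Prod>i\<in>UNIV. A $ i $ ?m p i))"
    unfolding det_def by (rule sum.reindex_bij_betw[OF bij, symmetric])
  also have "\<dots> = (\<Sum>p | p permutes UNIV. of_int (sign p) * (\<Prod>i\<in>UNIV. A $ e i $ e (p i)))"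
  proof (rule sum.cong[OF refl])
    fix p :: "'m \<Rightarrow> 'm" assume p: "p \<in> {p. p permutes UNIV}"
    have "sign (?m p) = sign p" using p inj by (intro sign_map_permutation) auto
    moreover have "(\<Prod>i\<in>UNIV. A $ i $ ?m p i) = (\<Prod>i\<in>UNIV. A $ e i $ ?m p (e i))"
      by (rule prod.reindex_bij_betw[OF e, symmetric])
    ultimately show "of_int (sign (?m p)) * (\<Prod>i\<in>UNIV. A $ i $ ?m p i) =
        of_int (sign p) * (\<Prod>i\<in>UNIV. A $ e i $ e (p i))"
      using inj by (simp add: map_permutation_apply)
  qed
  finally show ?thesis unfolding det_def by simp
qed

definition reindex :: "real ^ 'n wo \<Rightarrow> real ^ 'n::finite" where
  "reindex v = (\<chi> i. v $ Abs_wo i)"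

definition unreindex :: "real ^ 'n::finite \<Rightarrow> real ^ 'n wo" where
  "unreindex v = (\<chi> i. v $ Rep_wo i)"

lemma reindex_inverse [simp]: "reindex (unreindex v) = v" "unreindex (reindex w) = w"
  by (auto simp: reindex_def unreindex_def vec_eq_iff Abs_wo_inverse Rep_wo_inverse)

lemma bounded_linear_reindex: "bounded_linear reindex" "bounded_linear unreindex"
  by (auto simp: linear_conv_bounded_linear[symmetric] reindex_def unreindex_def linear_iff vec_eq_iff)

lemma measurable_reindex [measurable]: "reindex \<in> borel_measurable borel" "unreindex \<in> borel_measurable borel"
  using bounded_linear_reindex
  by (auto intro: borel_measurable_continuous_onI linear_continuous_on)

lemma distr_reindex: "distr lborel borel reindex = (lborel :: (real ^ 'n::finite) measure)"
proof (rule lborel_eqI[symmetric])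
  fix l u :: "real ^ 'n" assume lu: "\<And>b. b \<in> Basis \<Longrightarrow> l \<bullet> b \<le> u \<bullet> b"
  have lu': "l $ i \<le> u $ i" for i
    using lu[of "axis i 1"] by (simp add: inner_axis axis_in_Basis_iff)
  have "reindex -` box l u = box (unreindex l) (unreindex u)"
  proof -
    have "reindex v \<in> box l u \<longleftrightarrow> v \<in> box (unreindex l) (unreindex u)" for v
      unfolding mem_box_cart reindex_def unreindex_def
      by (simp, metis Rep_wo_inverse Abs_wo_inverse UNIV_I)
    then show ?thesis by auto
  qed
  then have "emeasure (distr lborel borel reindex) (box l u) =
      emeasure lborel (box (unreindex l) (unreindex u))"
    by (simp add: emeasure_distr)
  also have "\<dots> = ennreal (\<Prod>b\<in>Basis. (unreindex u - unreindex l) \<bullet> b)"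
    by (subst emeasure_lborel_box) (auto simp: Basis_vec_def inner_axis unreindex_def lu')
  also have "(\<Prod>b\<in>Basis. (unreindex u - unreindex l) \<bullet> b) = (\<Prod>i\<in>UNIV. (u - l) $ Rep_wo i)"
    unfolding Basis_vec_def
    by (subst prod.UNION_disjoint) (auto simp: inner_axis axis_eq_axis unreindex_def)
  also have "\<dots> = (\<Prod>i\<in>UNIV. (u - l) $ i)"
    by (rule prod.reindex_bij_betw[OF Rep_wo_bij])
  also have "\<dots> = (\<Prod>b\<in>Basis. (u - l) \<bullet> b)"
    unfolding Basis_vec_def by (subst prod.UNION_disjoint) (auto simp: inner_axis axis_eq_axis)
  finally show "emeasure (distr lborel borel reindex) (box l u) = (\<Prod>b\<in>Basis. (u - l) \<bullet> b)" .
qed simp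

lemma sets_borel_homeomorphic_image:
  assumes "open T'" "homeomorphism T T' H h" "S \<in> sets borel" "S \<subseteq> T"
  shows "H ` S \<in> sets borel"
proof -
  have c: "continuous_on T' h" using assms(2) by (simp add: homeomorphism_def)
  have "h -` S \<inter> space (restrict_space borel T') \<in> sets (restrict_space borel T')"
    by (rule measurable_sets[OF borel_measurable_continuous_on_restrict[OF c] assms(3)])
  moreover have "h -` S \<inter> space (restrict_space borel T') = H ` S"
    using assms(2,4) by (force simp: homeomorphism_def space_restrict_space)
  ultimately show ?thesis using assms(1) by (auto simp: sets_restrict_space_iff)
qed

lemma borel_measurable_cont_indicator:
  fixes u :: "'a::topological_space \<Rightarrow> real"
  assumes "continuous_on T u" "open T" "S \<in> sets borel" "S \<subseteq> T"
  shows "(\<lambda>x. ennreal (u x) * indicator S x) \<in> borel_measurable borel"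
proof -
  have "(\<lambda>x. indicator S x *\<^sub>R u x) \<in> borel_measurable borel"
    by (rule borel_measurable_continuous_on_indicator)
      (use assms in \<open>auto intro: continuous_on_subset\<close>)
  then have "(\<lambda>x. ennreal (indicator S x *\<^sub>R u x)) \<in> borel_measurable borel" by measurable
  moreover have "(\<lambda>x. ennreal (indicator S x *\<^sub>R u x)) = (\<lambda>x. ennreal (u x) * indicator S x)"
    by (auto simp: indicator_def)
  ultimately show ?thesis by simp
qed

text \<open>
  The formula for Henstock--Kurzweil integrals says that the image has finite measure iff the
  Jacobian is integrable; this turns it into an identity in \<open>[0, \<infinity>]\<close>.
\<close>
lemma emeasure_image_wo:
  fixes H :: "real ^ 'n::{finite,wellorder} \<Rightarrow> real ^ 'n::_"
  assumes T: "open T" and der: "\<And>x. x \<in> T \<Longrightarrow> (H has_derivative H' x) (at x)"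
    and cont: "continuous_on T (\<lambda>x. det (matrix (H' x)))" and inj: "inj_on H T"
    and S: "S \<in> sets borel" "S \<subseteq> T"
  shows "emeasure lborel (H ` S) = (\<integral>\<^sup>+x. ennreal \<bar>det (matrix (H' x))\<bar> * indicator S x \<partial>lborel)"
proof -
  let ?D = "\<lambda>x. \<bar>det (matrix (H' x))\<bar>"
  have cH: "continuous_on T H"
    using der by (meson continuous_at_imp_continuous_on has_derivative_continuous)
  obtain h where "homeomorphism T (H ` T) H h"
    using invariance_of_domain_homeomorphism[OF T cH _ inj] by auto
  then have B: "H ` S \<in> sets borel"
    using sets_borel_homeomorphic_image invariance_of_domain[OF cH T inj] S by metis
  have S': "S \<in> sets lebesgue" using S by (simp add: borel_measurableI)
  note A = S' has_derivative_at_withinI[OF der[OF subsetD[OF S(2)]]] inj_on_subset[OF inj S(2)]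
  have D: "(\<lambda>x. ennreal (?D x) * indicator S x) \<in> borel_measurable borel"
    by (rule borel_measurable_cont_indicator[OF _ T S]) (intro continuous_intros cont)
  show ?thesis
  proof (cases "emeasure lborel (H ` S) < \<infinity>")
    case True
    then have l: "H ` S \<in> lmeasurable" using B by (simp add: fmeasurable_def)
    then have "(?D has_integral measure lebesgue (H ` S)) S"
      using has_measure_differentiable_image[OF A] by blast
    then have "(\<integral>\<^sup>+x. ennreal (?D x) * indicator S x \<partial>lborel) = ennreal (measure lebesgue (H ` S))"
      by (intro nn_integral_has_integral_lebesgue') auto
    also have "\<dots> = emeasure lebesgue (H ` S)" using l by (simp add: emeasure_eq_measure2)
    finally show ?thesis using B by simp
  next
    case False
    have "\<not> (\<integral>\<^sup>+x. ennreal (?D x) * indicator S x \<partial>lborel) < \<infinity>"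
    proof
      assume fin: "(\<integral>\<^sup>+x. ennreal (?D x) * indicator S x \<partial>lborel) < \<infinity>"
      have eq: "(\<lambda>x. ennreal (?D x) * indicator S x) = (\<lambda>x. ennreal (indicator S x * ?D x))"
        by (auto simp: indicator_def)
      have "(\<lambda>x. enn2real (ennreal (indicator S x * ?D x))) \<in> borel_measurable borel"
        using D unfolding eq by measurable
      then have m: "(\<lambda>x. indicator S x * ?D x) \<in> borel_measurable borel" by simp
      have "(\<lambda>x. indicator S x * ?D x) integrable_on UNIV"
        by (rule nn_integral_integrable_on[OF m]) (use fin in \<open>auto simp: eq\<close>)
      then have "(\<lambda>x. if x \<in> S then ?D x else 0) integrable_on UNIV"
        by (rule integrable_eq) (auto simp: indicator_def)
      then have "?D integrable_on S" by (simp add: integrable_restrict_UNIV)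
      then have "H ` S \<in> lmeasurable" using measurable_differentiable_image_eq[OF A] by blast
      then show False using False B by (simp add: fmeasurable_def)
    qed
    then show ?thesis using False unfolding infinity_ennreal_def top.not_eq_extremum[symmetric] by simp
  qed
qed

lemma matrix_reindex:
  fixes f :: "real ^ 'n::finite \<Rightarrow> real ^ 'n"
  shows "matrix (unreindex \<circ> f \<circ> reindex) = (\<chi> i j. matrix f $ Rep_wo i $ Rep_wo j)"
proof -
  have "reindex (axis j 1) = axis (Rep_wo j) 1" for j :: "'n wo"
    by (auto simp: reindex_def axis_def vec_eq_iff Rep_wo_inverse Abs_wo_inverse)
  then show ?thesis by (simp add: matrix_def unreindex_def)
qed

lemma emeasure_image:
  fixes H :: "real ^ 'n::finite \<Rightarrow> real ^ 'n"
  assumes T: "open T" and der: "\<And>x. x \<in> T \<Longrightarrow> (H has_derivative H' x) (at x)"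
    and cont: "continuous_on T (\<lambda>x. det (matrix (H' x)))" and inj: "inj_on H T"
    and S: "S \<in> sets borel" "S \<subseteq> T"
  shows "emeasure lborel (H ` S) = (\<integral>\<^sup>+x. ennreal \<bar>det (matrix (H' x))\<bar> * indicator S x \<partial>lborel)"
proof -
  let ?L = "reindex :: real ^ 'n wo \<Rightarrow> real ^ 'n"
  let ?H = "unreindex \<circ> H \<circ> ?L"
  have cH: "continuous_on T H"
    using der by (meson continuous_at_imp_continuous_on has_derivative_continuous)
  obtain h where "homeomorphism T (H ` T) H h"
    using invariance_of_domain_homeomorphism[OF T cH _ inj] by auto
  then have B: "H ` S \<in> sets borel"
    using sets_borel_homeomorphic_image invariance_of_domain[OF cH T inj] S by metis
  have det: "det (matrix (unreindex \<circ> H' x \<circ> ?L)) = det (matrix (H' x))" for x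
    unfolding matrix_reindex by (rule det_reindex[OF Rep_wo_bij])
  have cL: "continuous_on X ?L" for X
    by (rule linear_continuous_on[OF bounded_linear_reindex(1)])
  have "emeasure lborel (H ` S) = emeasure (distr lborel borel ?L) (H ` S)"
    by (simp add: distr_reindex)
  also have "\<dots> = emeasure lborel (?L -` (H ` S))" using B by (simp add: emeasure_distr)
  also have "?L -` (H ` S) = ?H ` (?L -` S)"
  proof (intro equalityI subsetI)
    fix y assume "y \<in> ?L -` (H ` S)"
    then obtain s where s: "?L y = H s" "s \<in> S" by auto
    then have "y = ?H (unreindex s)" by (metis comp_apply reindex_inverse)
    moreover have "unreindex s \<in> ?L -` S" using s by simp
    ultimately show "y \<in> ?H ` (?L -` S)" by (rule image_eqI)
  qed auto
  also have "emeasure lborel (?H ` (?L -` S)) =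
      (\<integral>\<^sup>+x. ennreal \<bar>det (matrix (unreindex \<circ> H' (?L x) \<circ> ?L))\<bar> * indicator (?L -` S) x \<partial>lborel)"
  proof (rule emeasure_image_wo)
    show "open (?L -` T)" by (rule open_vimage[OF T cL])
    show "(?H has_derivative (unreindex \<circ> H' (?L x) \<circ> ?L)) (at x)" if "x \<in> ?L -` T" for x
      unfolding comp_assoc
      by (intro diff_chain_at has_derivative_linear[of ?L] )
        (use that der bounded_linear_reindex in \<open>auto intro: bounded_linear_imp_has_derivative\<close>)
    show "continuous_on (?L -` T) (\<lambda>x. det (matrix (unreindex \<circ> H' (?L x) \<circ> ?L)))"
      unfolding det by (rule continuous_on_compose2[OF cont cL]) auto
    show "inj_on ?H (?L -` T)"
      using inj by (auto simp: inj_on_def) (metis reindex_inverse)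
    show "?L -` S \<in> sets borel" using measurable_sets_borel[OF measurable_reindex(1) S(1)] by simp
  qed (use S in auto)
  also have "\<dots> = (\<integral>\<^sup>+x. ennreal \<bar>det (matrix (H' (?L x)))\<bar> * indicator S (?L x) \<partial>lborel)"
    unfolding det by (simp add: indicator_vimage o_def)
  also have "\<dots> = (\<integral>\<^sup>+x. ennreal \<bar>det (matrix (H' x))\<bar> * indicator S x \<partial>distr lborel borel ?L)"
    by (rule nn_integral_distr[symmetric])
      (auto intro!: borel_measurable_cont_indicator[OF _ T S] continuous_intros cont)
  finally show ?thesis by (simp add: distr_reindex)
qed

text \<open>
  An identity between measures of Borel sets, namely that \<open>K\<close> maps the measure with density \<open>D\<close> to \<open>M\<close>
  restricted to \<open>P\<close>, extends to integrals.
\<close>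
lemma nn_integral_transfer:
  fixes M :: "'b::topological_space measure" and K :: "'e::euclidean_space \<Rightarrow> 'b"
  assumes sM: "sets M = sets borel" and P: "P \<in> sets borel" and K: "K \<in> borel_measurable borel"
    and D: "D \<in> borel_measurable borel" and h: "(\<lambda>p. h p * indicator P p) \<in> borel_measurable borel"
    and eq: "\<And>X. X \<in> sets borel \<Longrightarrow> emeasure M (P \<inter> X) = (\<integral>\<^sup>+x. D x * indicator (K -` X) x \<partial>lborel)"
  shows "(\<integral>\<^sup>+p. h p * indicator P p \<partial>M) = (\<integral>\<^sup>+x. D x * (h (K x) * indicator P (K x)) \<partial>lborel)"
proof -
  let ?v = "\<lambda>p. h p * indicator P p"
  have v: "?v \<in> borel_measurable M" using h by (simp add: measurable_cong_sets[OF sM])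
  have "density M (indicator P) = distr (density lborel D) borel K"
  proof (rule measure_eqI)
    fix X assume "X \<in> sets (density M (indicator P :: _ \<Rightarrow> ennreal))"
    then have X: "X \<in> sets borel" using sM by simp
    have KX: "K -` X \<in> sets borel" using measurable_sets_borel[OF K X] by simp
    show "emeasure (density M (indicator P)) X = emeasure (distr (density lborel D) borel K) X"
      using P X sM eq[OF X] KX K D
      by (simp add: emeasure_density emeasure_distr indicator_inter_arith[symmetric])
  qed (use sM in simp)
  moreover have "(\<integral>\<^sup>+p. ?v p \<partial>M) = (\<integral>\<^sup>+p. ?v p \<partial>density M (indicator P))"
    using v P sM by (subst nn_integral_density) (auto intro!: nn_integral_cong simp: indicator_def)
  ultimately have "(\<integral>\<^sup>+p. ?v p \<partial>M) = (\<integral>\<^sup>+x. ?v (K x) \<partial>density lborel D)"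
    using K h by (simp add: nn_integral_distr)
  also have "\<dots> = (\<integral>\<^sup>+x. D x * ?v (K x) \<partial>lborel)"
    by (rule nn_integral_density) (use D measurable_compose[OF K h] in auto)
  finally show ?thesis .
qed

text \<open>
  The formula for images of Borel sets says that \<open>H\<close> maps the measure with density \<open>|det DH|\<close> on \<open>S\<close>
  to Lebesgue measure on \<open>H ` S\<close>.
\<close>
lemma nn_integral_image:
  fixes H :: "real ^ 'n::finite \<Rightarrow> real ^ 'n"
  assumes T: "open T" and der: "\<And>x. x \<in> T \<Longrightarrow> (H has_derivative H' x) (at x)"
    and cont: "continuous_on T (\<lambda>x. det (matrix (H' x)))" and inj: "inj_on H T"
    and S: "S \<in> sets borel" "S \<subseteq> T" and u: "(\<lambda>y. u y * indicator (H ` S) y) \<in> borel_measurable borel"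
  shows "(\<integral>\<^sup>+y. u y * indicator (H ` S) y \<partial>lborel) =
         (\<integral>\<^sup>+x. ennreal \<bar>det (matrix (H' x))\<bar> * u (H x) * indicator S x \<partial>lborel)"
proof -
  let ?D = "\<lambda>x. \<bar>det (matrix (H' x))\<bar>"
  \<comment> \<open>a Borel function on the whole space that agrees with \<open>H\<close> on \<open>S\<close>\<close>
  define K where "K x = indicator S x *\<^sub>R H x" for x
  have cH: "continuous_on T H"
    using der by (meson continuous_at_imp_continuous_on has_derivative_continuous)
  have K: "K \<in> borel_measurable borel" unfolding K_def
    by (rule borel_measurable_continuous_on_indicator)
      (use S cH in \<open>auto intro: continuous_on_subset\<close>)
  have D: "(\<lambda>x. ennreal (?D x) * indicator S x) \<in> borel_measurable borel"
    by (rule borel_measurable_cont_indicator[OF _ T S]) (intro continuous_intros cont)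
  obtain h where "homeomorphism T (H ` T) H h"
    using invariance_of_domain_homeomorphism[OF T cH _ inj] by auto
  then have B: "H ` S \<in> sets borel"
    using sets_borel_homeomorphic_image invariance_of_domain[OF cH T inj] S by metis
  have eq: "emeasure lborel (H ` S \<inter> X) =
      (\<integral>\<^sup>+x. (ennreal (?D x) * indicator S x) * indicator (K -` X) x \<partial>lborel)" if X: "X \<in> sets borel" for X
  proof -
    have KX: "K -` X \<in> sets borel" using measurable_sets_borel[OF K X] by simp
    have "H ` S \<inter> X = H ` (S \<inter> K -` X)" by (auto simp: K_def)
    also have "emeasure lborel \<dots> = (\<integral>\<^sup>+x. ennreal (?D x) * indicator (S \<inter> K -` X) x \<partial>lborel)"
      by (rule emeasure_image[OF T der cont inj]) (use S KX in auto)
    finally show ?thesis by (simp add: indicator_inter_arith mult.assoc)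
  qed
  have "(\<integral>\<^sup>+y. u y * indicator (H ` S) y \<partial>lborel) =
      (\<integral>\<^sup>+x. (ennreal (?D x) * indicator S x) * (u (K x) * indicator (H ` S) (K x)) \<partial>lborel)"
    by (rule nn_integral_transfer[OF _ B K D u eq]) simp
  also have "\<dots> = (\<integral>\<^sup>+x. ennreal (?D x) * u (H x) * indicator S x \<partial>lborel)"
    by (rule nn_integral_cong) (auto simp: K_def indicator_def)
  finally show ?thesis .
qed

section \<open>Maps of class \<open>C\<^sup>1\<close> near a point\<close>

text \<open>
  A pointwise form of \<open>Ck_on 1\<close>, which depends only on the germ of \<open>F\<close> at \<open>x\<close>.  It covers curves
  as well as maps in charts.
\<close>
definition C1_at :: "('e::euclidean_space \<Rightarrow> 'b::real_normed_vector) \<Rightarrow> 'e \<Rightarrow> bool" where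
  "C1_at F x \<longleftrightarrow> (\<forall>\<^sub>F y in nhds x. F differentiable (at y)) \<and>
     (\<forall>v. isCont (\<lambda>y. frechet_derivative F (at y) v) x)"

lemma C1_at_differentiable: "C1_at F x \<Longrightarrow> F differentiable (at x)"
  unfolding C1_at_def by (auto dest: eventually_nhds_x_imp_x)

lemma C1_at_has_derivative: "C1_at F x \<Longrightarrow> (F has_derivative frechet_derivative F (at x)) (at x)"
  using C1_at_differentiable frechet_derivative_works by blast

lemma C1_at_linear: "C1_at F x \<Longrightarrow> linear (frechet_derivative F (at x))"
  using C1_at_differentiable linear_frechet_derivative by blast

lemma C1_at_isCont: "C1_at F x \<Longrightarrow> isCont F x"
  using C1_at_differentiable differentiable_imp_continuous_within by blast

lemma isCont_eventually_nhds:
  assumes "isCont f x" "open S" "f x \<in> S"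
  shows "\<forall>\<^sub>F y in nhds x. f y \<in> S"
proof -
  have "\<forall>\<^sub>F y in at x. f y \<in> S"
    using assms by (auto simp: isCont_def tendsto_def)
  then have "\<forall>\<^sub>F y in nhds x. y \<noteq> x \<longrightarrow> f y \<in> S" by (simp add: eventually_at_filter)
  then show ?thesis by (rule eventually_mono) (use assms(3) in auto)
qed

lemma has_derivative_eventually_cong:
  assumes "\<forall>\<^sub>F y in nhds x. F y = G y"
  shows "(F has_derivative D) (at x) \<longleftrightarrow> (G has_derivative D) (at x)"
proof -
  have "\<forall>\<^sub>F y in at x. F y = G y" using assms by (simp add: eventually_at_filter eventually_mono)
  moreover have "F x = G x" using assms by (rule eventually_nhds_x_imp_x)
  moreover have "\<forall>\<^sub>F y in at x. G y = F y" using calculation(1) by (rule eventually_mono) simp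
  ultimately show ?thesis
    using has_derivative_transform_eventually[of F D x UNIV G] has_derivative_transform_eventually[of G D x UNIV F]
    by auto
qed

lemma frechet_derivative_eventually_cong:
  assumes "\<forall>\<^sub>F y in nhds x. F y = G y"
  shows "frechet_derivative F (at x) = frechet_derivative G (at x)"
  unfolding frechet_derivative_def has_derivative_eventually_cong[OF assms] ..

lemma C1_at_cong:
  assumes ev: "\<forall>\<^sub>F y in nhds x. F y = G y" and F: "C1_at F x"
  shows "C1_at G x"
proof -
  have ev2: "\<forall>\<^sub>F y in nhds x. \<forall>\<^sub>F z in nhds y. F z = G z"
    using ev by (simp add: eventually_eventually)
  have "\<forall>\<^sub>F y in nhds x. G differentiable (at y)"
    using ev2 F[unfolded C1_at_def, THEN conjunct1]
    by eventually_elim (simp add: differentiable_def has_derivative_eventually_cong)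
  moreover have "isCont (\<lambda>y. frechet_derivative G (at y) v) x" for v
  proof -
    have "\<forall>\<^sub>F y in nhds x. frechet_derivative F (at y) v = frechet_derivative G (at y) v"
      using ev2 by eventually_elim (simp add: frechet_derivative_eventually_cong)
    moreover have "isCont (\<lambda>y. frechet_derivative F (at y) v) x" using F by (simp add: C1_at_def)
    ultimately show ?thesis by (simp add: isCont_cong)
  qed
  ultimately show ?thesis by (simp add: C1_at_def)
qed

lemma C1_at_eventually:
  assumes "C1_at F x" shows "\<forall>\<^sub>F y in nhds x. F differentiable (at y)"
  using assms by (simp add: C1_at_def)

lemma frechet_derivative_comp:
  assumes "C1_at F x" "C1_at G (F x)"
  shows "frechet_derivative (G \<circ> F) (at x) = frechet_derivative G (at (F x)) \<circ> frechet_derivative F (at x)"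
  using assms by (intro frechet_derivative_compose C1_at_differentiable)

lemma C1_at_comp:
  fixes F :: "'e::euclidean_space \<Rightarrow> 'b::euclidean_space" and G :: "'b \<Rightarrow> 'c::real_normed_vector"
  assumes F: "C1_at F x" and G: "C1_at G (F x)"
  shows "C1_at (G \<circ> F) x"
proof -
  obtain S where S: "open S" "F x \<in> S" "\<And>y. y \<in> S \<Longrightarrow> G differentiable (at y)"
    using C1_at_eventually[OF G] unfolding eventually_nhds by blast
  have ev: "\<forall>\<^sub>F y in nhds x. G differentiable (at (F y)) \<and> F differentiable (at y)"
    using isCont_eventually_nhds[OF C1_at_isCont[OF F] S(1,2)] C1_at_eventually[OF F]
    by eventually_elim (use S(3) in auto)
  then have "\<forall>\<^sub>F y in nhds x. (G \<circ> F) differentiable (at y)"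
    by eventually_elim (auto intro: differentiable_chain_at)
  moreover have "isCont (\<lambda>y. frechet_derivative (G \<circ> F) (at y) v) x" for v
  proof -
    \<comment> \<open>the chain rule, expanded in a basis so that only derivatives in fixed directions occur\<close>
    have "\<forall>\<^sub>F y in nhds x. frechet_derivative (G \<circ> F) (at y) v =
       (\<Sum>b\<in>Basis. (frechet_derivative F (at y) v \<bullet> b) *\<^sub>R frechet_derivative G (at (F y)) b)"
      using ev
    proof eventually_elim
      case (elim y)
      have lin: "linear (frechet_derivative G (at (F y)))" using elim linear_frechet_derivative by blast
      have "frechet_derivative (G \<circ> F) (at y) v = frechet_derivative G (at (F y)) (frechet_derivative F (at y) v)"
        using elim by (simp add: frechet_derivative_compose)
      also have "\<dots> = frechet_derivative G (at (F y)) (\<Sum>b\<in>Basis. (frechet_derivative F (at y) v \<bullet> b) *\<^sub>R b)"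
        by (simp add: euclidean_representation)
      also have "\<dots> = (\<Sum>b\<in>Basis. (frechet_derivative F (at y) v \<bullet> b) *\<^sub>R frechet_derivative G (at (F y)) b)"
        by (simp add: linear_sum[OF lin] linear_scale[OF lin])
      finally show ?case .
    qed
    moreover have "isCont (\<lambda>y. \<Sum>b\<in>Basis. (frechet_derivative F (at y) v \<bullet> b) *\<^sub>R frechet_derivative G (at (F y)) b) x"
    proof (intro continuous_intros)
      show "isCont (\<lambda>y. frechet_derivative F (at y) v) x" using F by (simp add: C1_at_def)
      fix b :: 'b
      show "isCont (\<lambda>y. frechet_derivative G (at (F y)) b) x"
        by (rule isCont_o2[OF C1_at_isCont[OF F], of "\<lambda>z. frechet_derivative G (at z) b"])
          (use G in \<open>simp add: C1_at_def\<close>)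
    qed
    ultimately show ?thesis by (simp add: isCont_cong)
  qed
  ultimately show ?thesis by (simp add: C1_at_def)
qed

lemma Ck_on_C1_at:
  fixes F :: "'e::euclidean_space \<Rightarrow> 'b::real_normed_vector"
  assumes F: "Ck_on (Suc 0) F S" and S: "open S" "x \<in> S"
  shows "C1_at F x"
proof -
  have "\<forall>\<^sub>F y in nhds x. y \<in> S" using S by (simp add: eventually_nhds_in_open)
  then have "\<forall>\<^sub>F y in nhds x. F differentiable (at y)" by eventually_elim (use F in auto)
  moreover have "isCont (\<lambda>y. frechet_derivative F (at y) v) x" for v
    using F S by (simp add: continuous_on_eq_continuous_at)
  ultimately show ?thesis by (simp add: C1_at_def)
qed

lemma Ck_on_2_imp_1:
  assumes "Ck_on 2 F S"
  shows "Ck_on (Suc 0) F S"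
proof -
  have "Ck_on (Suc (Suc 0)) F S" using assms by (simp add: numeral_2_eq_2)
  then show ?thesis
    by (auto intro!: continuous_at_imp_continuous_on differentiable_imp_continuous_within)
qed

lemma isCont_matrix_entry:
  fixes H :: "real ^ 'n::finite \<Rightarrow> real ^ 'm::finite"
  assumes "C1_at H x"
  shows "isCont (\<lambda>y. matrix (frechet_derivative H (at y)) $ i $ j) x"
proof -
  have "isCont (\<lambda>y. frechet_derivative H (at y) (axis j 1) $ i) x"
    using assms by (intro continuous_intros) (simp add: C1_at_def)
  then show ?thesis by (simp add: matrix_def)
qed

lemma isCont_det:
  fixes M :: "'b::t2_space \<Rightarrow> real ^ 'n::finite ^ 'n"
  assumes "\<And>i j. isCont (\<lambda>y. M y $ i $ j) x"
  shows "isCont (\<lambda>y. det (M y)) x"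
  unfolding det_def by (intro continuous_intros assms)

text \<open>
  The inverse function theorem.  Continuity of the derivative of the inverse follows from Cramer's
  rule.
\<close>
lemma C1_local_inverse:
  fixes H :: "real ^ 'n::finite \<Rightarrow> real ^ 'n"
  assumes H: "C1_at H x0" and inj: "inj (frechet_derivative H (at x0))"
  obtains U h where "open U" "x0 \<in> U" "inj_on H U" "open (H ` U)" "\<And>x. x \<in> U \<Longrightarrow> h (H x) = x"
    "C1_at h (H x0)"
proof -
  let ?D = "\<lambda>x. frechet_derivative H (at x)"
  let ?J = "\<lambda>x. matrix (?D x)"
  have lin: "linear (?D x0)" by (rule C1_at_linear[OF H])
  have det0: "det (?J x0) \<noteq> 0" using det_nz_iff_inj[OF lin] inj by blast
  have "isCont (\<lambda>y. det (?J y)) x0" by (intro isCont_det isCont_matrix_entry H)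
  then have ev_det: "\<forall>\<^sub>F y in nhds x0. det (?J y) \<noteq> 0"
    using isCont_eventually_nhds[where x = x0 and S = "- {0}"] det0 by fastforce
  have "\<forall>\<^sub>F y in nhds x0. H differentiable (at y) \<and> det (?J y) \<noteq> 0"
    using C1_at_eventually[OF H] ev_det by (rule eventually_conj)
  then obtain S where S: "open S" "x0 \<in> S" "\<And>y. y \<in> S \<Longrightarrow> H differentiable (at y)" "\<And>y. y \<in> S \<Longrightarrow> det (?J y) \<noteq> 0"
    unfolding eventually_nhds by blast
  have der: "(H has_derivative ?D y) (at y)" if "y \<in> S" for y
    using S(3)[OF that] frechet_derivative_works by blast
  have linS: "linear (?D y)" if "y \<in> S" for y using S(3)[OF that] linear_frechet_derivative by blast
  obtain B where B: "linear B" "B \<circ> ?D x0 = id"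
    using linear_injective_left_inverse[OF lin inj] by blast
  have on: "\<exists>d>0. \<forall>x. dist x0 x < d \<longrightarrow> onorm (\<lambda>v. ?D x v - ?D x0 v) < e" if e: "e > 0" for e
  proof -
    \<comment> \<open>a bound on the entries of a matrix bounds its operator norm up to the number of entries\<close>
    define \<epsilon> where "\<epsilon> = e / (2 * real CARD('n) * real CARD('n))"
    have \<epsilon>: "\<epsilon> > 0" using e by (simp add: \<epsilon>_def)
    have "\<forall>\<^sub>F y in nhds x0. \<bar>?J y $ i $ j - ?J x0 $ i $ j\<bar> < \<epsilon>" for i j
    proof -
      have "\<forall>\<^sub>F y in nhds x0. ?J y $ i $ j \<in> ball (?J x0 $ i $ j) \<epsilon>"
        by (rule isCont_eventually_nhds[OF isCont_matrix_entry[OF H]]) (use \<epsilon> in auto)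
      then show ?thesis by eventually_elim (simp add: dist_real_def abs_minus_commute)
    qed
    then have "\<forall>\<^sub>F y in nhds x0. \<forall>i j. \<bar>?J y $ i $ j - ?J x0 $ i $ j\<bar> < \<epsilon>"
      by (intro eventually_all_finite)
    moreover have "\<forall>\<^sub>F y in nhds x0. y \<in> S" using S by (simp add: eventually_nhds_in_open)
    ultimately have "\<forall>\<^sub>F y in nhds x0. y \<in> S \<and> (\<forall>i j. \<bar>?J y $ i $ j - ?J x0 $ i $ j\<bar> < \<epsilon>)"
      by (simp add: eventually_conj)
    then obtain d where d: "d > 0" "\<And>y. dist y x0 < d \<Longrightarrow> y \<in> S \<and> (\<forall>i j. \<bar>?J y $ i $ j - ?J x0 $ i $ j\<bar> < \<epsilon>)"
      unfolding eventually_nhds_metric by blast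
    have "onorm (\<lambda>v. ?D x v - ?D x0 v) < e" if "dist x0 x < d" for x
    proof -
      have x: "x \<in> S" "\<And>i j. \<bar>?J x $ i $ j - ?J x0 $ i $ j\<bar> < \<epsilon>" using d(2)[of x] that by (auto simp: dist_commute)
      have "(\<lambda>v. ?D x v - ?D x0 v) = (*v) (?J x - ?J x0)"
        using linS[OF x(1)] lin by (auto simp: matrix_vector_mult_diff_rdistrib matrix_works)
      then have "onorm (\<lambda>v. ?D x v - ?D x0 v) \<le> real CARD('n) * real CARD('n) * \<epsilon>"
        using onorm_le_matrix_component[of "?J x - ?J x0" \<epsilon>] x(2) by (simp add: less_imp_le)
      also have "\<dots> < e" using e by (simp add: \<epsilon>_def)
      finally show ?thesis .
    qed
    then show ?thesis using d(1) by blast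
  qed
  obtain r where r: "r > 0" "ball x0 r \<subseteq> S" "inj_on H (ball x0 r)"
    by (rule has_derivative_locally_injective[where f = H and f' = ?D, OF S(2,1) _ B(2) der on])
      (use B linear_conv_bounded_linear in auto)
  define U where "U = ball x0 r"
  have U: "open U" "x0 \<in> U" "inj_on H U" "U \<subseteq> S" using r by (auto simp: U_def)
  have cH: "continuous_on U H"
    using der U(4) by (meson continuous_at_imp_continuous_on has_derivative_continuous subsetD)
  have opn: "open (H ` U)" by (rule invariance_of_domain[OF cH U(1,3)])
  define h where "h = inv_into U H"
  have hH: "h (H x) = x" if "x \<in> U" for x using that U by (simp add: h_def)
  \<comment> \<open>\<open>K x\<close> is the inverse of the derivative of \<open>H\<close> at \<open>x\<close>\<close>
  define K :: "real ^ 'n \<Rightarrow> real ^ 'n \<Rightarrow> real ^ 'n" where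
    "K x v = (\<chi> k. det (\<chi> i j. if j = k then v $ i else ?J x $ i $ j) / det (?J x))" for x v
  have K: "?D x (K x v) = v" if "x \<in> S" for x v
  proof -
    have "?J x *v K x v = v" unfolding K_def by (simp add: cramer[OF S(4)[OF that]])
    then show ?thesis using linS[OF that] by (simp add: matrix_works)
  qed
  have derh: "(h has_derivative K x) (at (H x))" if "x \<in> U" for x
    by (rule has_derivative_inverse_strong[OF U(1) that cH hH der]) (use that U K in \<open>auto simp: fun_eq_iff\<close>)
  have Dh: "frechet_derivative h (at (H x)) = K x" if "x \<in> U" for x
    using frechet_derivative_at[OF derh[OF that]] by simp
  have "C1_at h (H x0)"
    unfolding C1_at_def
  proof (intro conjI allI)
    have evU: "\<forall>\<^sub>F y in nhds (H x0). y \<in> H ` U" using opn U by (simp add: eventually_nhds_in_open)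
    then show "\<forall>\<^sub>F y in nhds (H x0). h differentiable (at y)"
      by eventually_elim (use derh differentiable_def in blast)
    fix v
    have "\<forall>\<^sub>F y in nhds (H x0). frechet_derivative h (at y) v = K (h y) v"
      using evU by eventually_elim (use Dh hH in auto)
    moreover have "isCont (\<lambda>y. K (h y) v) (H x0)"
    proof (rule isCont_o2[where g = "\<lambda>x. K x v"])
      show "isCont h (H x0)" using derh[OF U(2)] by (rule has_derivative_continuous)
      have "isCont (\<lambda>x. K x v $ k) x0" for k
      proof -
        have "isCont (\<lambda>x. (\<chi> i j. if j = k then v $ i else ?J x $ i $ j) $ i $ j) x0" for i j
          using isCont_matrix_entry[OF H, of i j] by (cases "j = k") auto
        then have "isCont (\<lambda>x. det (\<chi> i j. if j = k then v $ i else ?J x $ i $ j)) x0"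
          by (rule isCont_det)
        moreover have "isCont (\<lambda>x. det (?J x)) x0" by (intro isCont_det isCont_matrix_entry H)
        ultimately show ?thesis unfolding K_def vec_lambda_beta
          using det0 by (intro continuous_divide) auto
      qed
      then have "isCont (\<lambda>x. K x v) x0" unfolding isCont_def by (intro vec_tendstoI)
      then show "isCont (\<lambda>x. K x v) (h (H x0))" using hH U by simp
    qed
    ultimately show "isCont (\<lambda>y. frechet_derivative h (at y) v) (H x0)" by (simp add: isCont_cong)
  qed
  then show thesis using that U opn hH by blast
qed

lemma C1_at_affine: "C1_at (\<lambda>s. k * s + d) (t :: real)"
  and frechet_derivative_affine: "frechet_derivative (\<lambda>s. k * s + d) (at (t :: real)) = (\<lambda>h. k * h)"
proof -
  have der: "((\<lambda>s. k * s + d) has_derivative (\<lambda>h. k * h)) (at s)" for s :: real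
    by (auto intro!: derivative_eq_intros)
  have eq: "frechet_derivative (\<lambda>s. k * s + d) (at s) = (\<lambda>h. k * h)" for s :: real
    by (rule frechet_derivative_at[OF der, symmetric])
  then show "frechet_derivative (\<lambda>s. k * s + d) (at t) = (\<lambda>h. k * h)" .
  show "C1_at (\<lambda>s. k * s + d) t"
    unfolding C1_at_def eq using der by (auto simp: differentiable_def intro!: always_eventually)
qed

text \<open>
  The displacement of a piecewise \<open>C\<^sup>1\<close> curve is at most the integral of its speed.  The constant \<open>k\<close> is
  kept on the side of the continuous derivative, so that the majorant \<open>l\<close>, in applications the speed of a path
  on the manifold, may be any function.
\<close>
lemma norm_increment_le:
  fixes u :: "real \<Rightarrow> 'b::euclidean_space"
  assumes b: "0 \<le> b" "b \<le> 1" and u: "continuous_on {0..b} u" and S: "finite S"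
    and C: "\<And>t. t \<in> {0<..<b} - S \<Longrightarrow> C1_at u t"
    and le: "\<And>t. t \<in> {0<..<b} - S \<Longrightarrow> k * norm (frechet_derivative u (at t) 1) \<le> l t" and k: "0 < k"
  shows "ennreal (k * norm (u b - u 0)) \<le> (\<integral>\<^sup>+ t \<in> {0..1}. ennreal (l t) \<partial>lborel)"
proof (cases "(\<integral>\<^sup>+ t \<in> {0..1}. ennreal (l t) \<partial>lborel) < \<infinity>")
  case False then show ?thesis by (simp add: less_top[symmetric])
next
  case True
  let ?X = "{0<..<b} - S"
  \<comment> \<open>\<open>w\<close> is measurable, being continuous on an open set and zero outside; it differs from the derivative at finitely many points\<close>
  define w where "w t = indicator ?X t *\<^sub>R (k *\<^sub>R frechet_derivative u (at t) 1)" for t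
  have X: "open ?X" using S by (simp add: open_Diff finite_imp_closed)
  have "continuous_on ?X (\<lambda>t. frechet_derivative u (at t) 1)"
    using C by (auto simp: C1_at_def intro!: continuous_at_imp_continuous_on)
  then have wm: "w \<in> borel_measurable borel"
    unfolding w_def using X by (intro borel_measurable_continuous_on_indicator continuous_intros) auto
  have "(\<integral>\<^sup>+t. ennreal (norm (w t)) \<partial>lborel) \<le> (\<integral>\<^sup>+ t \<in> {0..1}. ennreal (l t) \<partial>lborel)"
    by (rule nn_integral_mono) (use b le k in \<open>auto simp: w_def indicator_def intro!: ennreal_leI\<close>)
  then have fin: "(\<integral>\<^sup>+t. ennreal (norm (w t)) \<partial>lborel) < \<infinity>" using True by (rule le_less_trans)
  have int: "integrable lborel w" using wm fin by (intro integrableI_bounded) auto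
  have "((\<lambda>t. k *\<^sub>R frechet_derivative u (at t) 1) has_integral (k *\<^sub>R u b - k *\<^sub>R u 0)) {0..b}"
  proof (rule fundamental_theorem_of_calculus_interior_strong[OF S b(1)])
    show "continuous_on {0..b} (\<lambda>t. k *\<^sub>R u t)" using u by (intro continuous_intros)
    fix t assume t: "t \<in> {0<..<b} - S"
    have "(u has_vector_derivative frechet_derivative u (at t) 1) (at t)"
      using C1_at_differentiable[OF C[OF t]]
      by (simp add: frechet_derivative_eq_vector_derivative vector_derivative_works[symmetric])
    then show "((\<lambda>t. k *\<^sub>R u t) has_vector_derivative k *\<^sub>R frechet_derivative u (at t) 1) (at t)"
      by (intro derivative_eq_intros) auto
  qed
  then have "(w has_integral (k *\<^sub>R u b - k *\<^sub>R u 0)) {0..b}"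
    by (rule has_integral_spike_finite[of "S \<union> {0, b}", rotated 2]) (use S in \<open>auto simp: w_def\<close>)
  then have "(w has_integral (k *\<^sub>R u b - k *\<^sub>R u 0)) UNIV"
    by (rule has_integral_on_superset) (auto simp: w_def)
  then have "k *\<^sub>R u b - k *\<^sub>R u 0 = integral\<^sup>L lborel w"
    using has_integral_integral_lborel[OF int] has_integral_unique by blast
  then have "ennreal (norm (k *\<^sub>R u b - k *\<^sub>R u 0)) \<le> (\<integral>\<^sup>+t. ennreal (norm (w t)) \<partial>lborel)"
    using integral_norm_bound_ennreal[OF int] by simp
  moreover have "norm (k *\<^sub>R u b - k *\<^sub>R u 0) = k * norm (u b - u 0)"
    using k by (simp add: scaleR_diff_right[symmetric])
  ultimately show ?thesis
    using \<open>(\<integral>\<^sup>+t. ennreal (norm (w t)) \<partial>lborel) \<le> _\<close> by simp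
qed

section \<open>Differentiable maps of a Riemannian manifold\<close>

locale riem =
  fixes A :: "('a::t2_space, 'n::finite) chart set" and g :: "('a, 'n) metric_tensor"
  assumes rm: "riemannian_manifold A g"
begin

lemma chart_homeomorphism:
  "c \<in> A \<Longrightarrow> homeomorphism (chart_dom c) (chart_map c ` chart_dom c) (chart_map c) (chart_inv c)"
  and open_chart_dom: "c \<in> A \<Longrightarrow> open (chart_dom c)"
  and open_chart_range: "c \<in> A \<Longrightarrow> open (chart_map c ` chart_dom c)"
  using rm by (auto simp: riemannian_manifold_def smooth_atlas_def)

lemma chart_at: "chart_at A p \<in> A" "p \<in> chart_dom (chart_at A p)"
proof -
  have "p \<in> (\<Union>c\<in>A. chart_dom c)" using rm by (simp add: riemannian_manifold_def smooth_atlas_def)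
  then have "\<exists>c. c \<in> A \<and> p \<in> chart_dom c" by blast
  then have "chart_at A p \<in> A \<and> p \<in> chart_dom (chart_at A p)"
    unfolding chart_at_def by (rule someI_ex)
  then show "chart_at A p \<in> A" "p \<in> chart_dom (chart_at A p)" by auto
qed

lemma chart_inv_map [simp]: "c \<in> A \<Longrightarrow> p \<in> chart_dom c \<Longrightarrow> chart_inv c (chart_map c p) = p"
  using chart_homeomorphism by (meson homeomorphism_def)

lemma chart_map_inv: "c \<in> A \<Longrightarrow> x \<in> chart_map c ` chart_dom c \<Longrightarrow> chart_map c (chart_inv c x) = x"
  by auto

lemma continuous_chart_map: "c \<in> A \<Longrightarrow> continuous_on (chart_dom c) (chart_map c)"
  and continuous_chart_inv: "c \<in> A \<Longrightarrow> continuous_on (chart_map c ` chart_dom c) (chart_inv c)"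
  using chart_homeomorphism by (meson homeomorphism_def)+

lemma isCont_chart_map: "c \<in> A \<Longrightarrow> p \<in> chart_dom c \<Longrightarrow> isCont (chart_map c) p"
  using continuous_chart_map open_chart_dom continuous_on_eq_continuous_at by blast

lemma isCont_chart_inv: "c \<in> A \<Longrightarrow> p \<in> chart_dom c \<Longrightarrow> isCont (chart_inv c) (chart_map c p)"
  using continuous_chart_inv open_chart_range continuous_on_eq_continuous_at by blast

lemma eventually_chart_inv:
  assumes "c \<in> A" "p \<in> chart_dom c" "open X" "p \<in> X"
  shows "\<forall>\<^sub>F x in nhds (chart_map c p). x \<in> chart_map c ` chart_dom c \<and> chart_inv c x \<in> chart_dom c \<inter> X"
proof -
  have "\<forall>\<^sub>F x in nhds (chart_map c p). x \<in> chart_map c ` chart_dom c"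
    using assms open_chart_range by (simp add: eventually_nhds_in_open)
  moreover have "\<forall>\<^sub>F x in nhds (chart_map c p). chart_inv c x \<in> chart_dom c \<inter> X"
    by (rule isCont_eventually_nhds[OF isCont_chart_inv[OF assms(1,2)]
          open_Int[OF open_chart_dom[OF assms(1)] assms(3)]]) (use assms in simp)
  ultimately show ?thesis by (rule eventually_conj)
qed

lemma open_chart_image:
  assumes c: "c \<in> A" and X: "open X" "X \<subseteq> chart_dom c"
  shows "open (chart_map c ` X)"
proof -
  have "open (chart_inv c -` X \<inter> chart_map c ` chart_dom c)"
    using continuous_chart_inv[OF c] open_chart_range[OF c] X(1)
    by (simp add: continuous_on_open_vimage)
  moreover have "chart_inv c -` X \<inter> chart_map c ` chart_dom c = chart_map c ` X"
    using X(2) c by (auto simp: image_iff)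
  ultimately show ?thesis by simp
qed

lemma open_chart_vimage:
  assumes c: "c \<in> A" and Y: "open Y"
  shows "open (chart_dom c \<inter> chart_map c -` Y)"
  using continuous_chart_map[OF c] open_chart_dom[OF c] Y
  by (simp add: continuous_on_open_vimage Int_commute)

definition C1_map :: "('a \<Rightarrow> 'a) \<Rightarrow> bool" where
  "C1_map F \<longleftrightarrow> continuous_on UNIV F \<and> (\<forall>c\<in>A. \<forall>c'\<in>A. \<forall>p\<in>chart_dom c.
     F p \<in> chart_dom c' \<longrightarrow> C1_at (chart_map c' \<circ> F \<circ> chart_inv c) (chart_map c p))"

text \<open>
  The derivative \<open>DF\<^sub>p\<close> in arbitrary charts \<open>c\<close> and \<open>c'\<close>, while \<open>tderiv\<close> uses the charts chosen by
  \<open>chart_at\<close>.  The case \<open>F = id\<close> is the derivative of the coordinate change from \<open>c\<close> to \<open>c'\<close>.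
\<close>
definition dmap :: "('a, 'n) chart \<Rightarrow> ('a, 'n) chart \<Rightarrow> ('a \<Rightarrow> 'a) \<Rightarrow> 'a \<Rightarrow> real ^ 'n \<Rightarrow> real ^ 'n" where
  "dmap c c' F p = frechet_derivative (chart_map c' \<circ> F \<circ> chart_inv c) (at (chart_map c p))"

lemma C1_mapD:
  assumes "C1_map F" "c \<in> A" "c' \<in> A" "p \<in> chart_dom c" "F p \<in> chart_dom c'"
  shows "C1_at (chart_map c' \<circ> F \<circ> chart_inv c) (chart_map c p)"
  using assms by (simp add: C1_map_def)

lemma C1_map_isCont: "C1_map F \<Longrightarrow> isCont F p"
  by (simp add: C1_map_def continuous_on_eq_continuous_at)

lemma dmap_linear:
  assumes "C1_map F" "c \<in> A" "c' \<in> A" "p \<in> chart_dom c" "F p \<in> chart_dom c'"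
  shows "linear (dmap c c' F p)"
  unfolding dmap_def by (rule C1_at_linear[OF C1_mapD[OF assms]])

lemma C1_map_id: "C1_map id"
proof -
  have "C1_at (chart_map c' \<circ> chart_inv c) (chart_map c p)"
    if "c \<in> A" "c' \<in> A" "p \<in> chart_dom c" "p \<in> chart_dom c'" for c c' p
  proof (rule Ck_on_C1_at)
    show "Ck_on (Suc 0) (chart_map c' \<circ> chart_inv c) (chart_map c ` (chart_dom c \<inter> chart_dom c'))"
      using rm that by (simp add: riemannian_manifold_def smooth_atlas_def smooth_on_def del: Ck_on.simps)
    show "open (chart_map c ` (chart_dom c \<inter> chart_dom c'))"
      using that by (intro open_chart_image) (auto intro: open_chart_dom)
  qed (use that in auto)
  then show ?thesis by (simp add: C1_map_def)
qed

lemma C2_map_imp_C1_map: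
  assumes "C2_map A F" shows "C1_map F"
proof -
  have cF: "continuous_on UNIV F" using assms by (simp add: C2_map_def)
  have "C1_at (chart_map c' \<circ> F \<circ> chart_inv c) (chart_map c p)"
    if "c \<in> A" "c' \<in> A" "p \<in> chart_dom c" "F p \<in> chart_dom c'" for c c' p
  proof (rule Ck_on_C1_at)
    show "Ck_on (Suc 0) (chart_map c' \<circ> F \<circ> chart_inv c) (chart_map c ` (chart_dom c \<inter> F -` chart_dom c'))"
      using assms that by (intro Ck_on_2_imp_1) (simp add: C2_map_def del: Ck_on.simps)
    show "open (chart_map c ` (chart_dom c \<inter> F -` chart_dom c'))"
      using that cF by (intro open_chart_image) (auto intro: open_chart_dom open_vimage)
  qed (use that in auto)
  then show ?thesis using cF by (simp add: C1_map_def)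
qed

lemma eventually_comp_chart:
  assumes G: "C1_map G" and c: "c \<in> A" "c' \<in> A" "p \<in> chart_dom c" "G p \<in> chart_dom c'"
  shows "\<forall>\<^sub>F x in nhds (chart_map c p). ((k \<circ> chart_inv c') \<circ> (chart_map c' \<circ> G \<circ> chart_inv c)) x = (k \<circ> G \<circ> chart_inv c) x"
proof -
  have "open (G -` chart_dom c')"
    using G c by (simp add: C1_map_def open_vimage open_chart_dom)
  from eventually_chart_inv[OF c(1,3) this]
  show ?thesis using c by (auto elim!: eventually_mono)
qed

lemma
  assumes F: "C1_map F" and G: "C1_map G"
    and c: "c \<in> A" "c' \<in> A" "c'' \<in> A" "p \<in> chart_dom c" "G p \<in> chart_dom c'" "F (G p) \<in> chart_dom c''"
  shows dmap_comp: "dmap c c'' (F \<circ> G) p = dmap c' c'' F (G p) \<circ> dmap c c' G p"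
    and C1_at_comp_chart: "C1_at (chart_map c'' \<circ> (F \<circ> G) \<circ> chart_inv c) (chart_map c p)"
proof -
  let ?G = "chart_map c' \<circ> G \<circ> chart_inv c" and ?F = "chart_map c'' \<circ> F \<circ> chart_inv c'"
  have 1: "C1_at ?G (chart_map c p)" using C1_mapD[OF G] c by blast
  have eq: "?G (chart_map c p) = chart_map c' (G p)" using c by simp
  have 2: "C1_at ?F (?G (chart_map c p))" unfolding eq using C1_mapD[OF F] c by blast
  have ev: "\<forall>\<^sub>F x in nhds (chart_map c p). (?F \<circ> ?G) x = (chart_map c'' \<circ> (F \<circ> G) \<circ> chart_inv c) x"
    using eventually_comp_chart[OF G c(1,2,4,5), of "chart_map c'' \<circ> F"] by (simp add: comp_assoc)
  show "C1_at (chart_map c'' \<circ> (F \<circ> G) \<circ> chart_inv c) (chart_map c p)"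
    by (rule C1_at_cong[OF ev C1_at_comp[OF 1 2]])
  show "dmap c c'' (F \<circ> G) p = dmap c' c'' F (G p) \<circ> dmap c c' G p"
    unfolding dmap_def frechet_derivative_eventually_cong[OF ev, symmetric] frechet_derivative_comp[OF 1 2] eq ..
qed

lemma C1_map_comp:
  assumes F: "C1_map F" and G: "C1_map G" shows "C1_map (F \<circ> G)"
  unfolding C1_map_def
proof (intro conjI ballI impI)
  show "continuous_on UNIV (F \<circ> G)"
    using F G by (metis C1_map_def continuous_on_compose continuous_on_subset top_greatest)
  fix c c' p assume "c \<in> A" "c' \<in> A" "p \<in> chart_dom c" "(F \<circ> G) p \<in> chart_dom c'"
  then show "C1_at (chart_map c' \<circ> (F \<circ> G) \<circ> chart_inv c) (chart_map c p)"
    using C1_at_comp_chart[OF F G, of c "chart_at A (G p)" c' p] chart_at by simp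
qed

text \<open>
  The norm of the tangent vector at \<open>p\<close> with components \<open>v\<close> in the chart \<open>c\<close>.
\<close>
definition cnorm :: "('a, 'n) chart \<Rightarrow> 'a \<Rightarrow> real ^ 'n \<Rightarrow> real" where
  "cnorm c p v = sqrt (v \<bullet> (g c p *v v))"

lemma tnorm_eq_cnorm: "tnorm A g p v = cnorm (chart_at A p) p v"
  by (simp add: tnorm_def cnorm_def gram_def)

lemma metric_pos: "c \<in> A \<Longrightarrow> p \<in> chart_dom c \<Longrightarrow> v \<noteq> 0 \<Longrightarrow> v \<bullet> (g c p *v v) > 0"
  using rm by (auto simp: riemannian_manifold_def riemannian_metric_def)

lemma metric_trans:
  assumes "c \<in> A" "c' \<in> A" "p \<in> chart_dom c" "p \<in> chart_dom c'"
  shows "g c p = transpose (matrix (dmap c c' id p)) ** g c' p ** matrix (dmap c c' id p)"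
proof -
  have "\<forall>c\<in>A. \<forall>c'\<in>A. \<forall>p\<in>chart_dom c \<inter> chart_dom c'.
        let T = matrix (frechet_derivative (chart_map c' \<circ> chart_inv c) (at (chart_map c p)))
        in g c p = transpose T ** g c' p ** T"
    using rm unfolding riemannian_manifold_def riemannian_metric_def by blast
  from this[unfolded Let_def, rule_format, OF assms(1,2) IntI[OF assms(3,4)]]
  show ?thesis unfolding dmap_def comp_id .
qed

lemma cnorm_ge_0 [simp]: "c \<in> A \<Longrightarrow> p \<in> chart_dom c \<Longrightarrow> 0 \<le> cnorm c p v"
  using metric_pos[of c p v] by (cases "v = 0") (auto simp: cnorm_def)

lemma cnorm_zero_iff: "c \<in> A \<Longrightarrow> p \<in> chart_dom c \<Longrightarrow> cnorm c p v \<le> 0 \<longleftrightarrow> v = 0"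
  using metric_pos[of c p v] by (cases "v = 0") (auto simp: cnorm_def not_le)

lemma cnorm_scale: "cnorm c p (r *\<^sub>R v) = \<bar>r\<bar> * cnorm c p v"
  by (simp add: cnorm_def scaleR_matrix_vector_assoc[symmetric] matrix_vector_mult_scaleR
      real_sqrt_mult flip: mult.assoc)

lemma cnorm_transition:
  assumes "c \<in> A" "c' \<in> A" "p \<in> chart_dom c" "p \<in> chart_dom c'"
  shows "cnorm c' p (dmap c c' id p v) = cnorm c p v"
proof -
  let ?T = "matrix (dmap c c' id p)"
  have T: "dmap c c' id p v = ?T *v v"
    using dmap_linear[OF C1_map_id, of c c' p] assms by (simp add: matrix_works)
  have "v \<bullet> (g c p *v v) = v \<bullet> (transpose ?T *v (g c' p *v (?T *v v)))"
    by (subst metric_trans[OF assms]) (simp add: matrix_vector_mul_assoc matrix_mul_assoc)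
  also have "\<dots> = (?T *v v) \<bullet> (g c' p *v (?T *v v))"
    by (metis dot_lmul_matrix inner_commute transpose_matrix_vector)
  finally show ?thesis by (simp add: cnorm_def T)
qed

lemma tderiv_eq_dmap: "tderiv A F p = dmap (chart_at A p) (chart_at A (F p)) F p"
  by (simp add: tderiv_def dmap_def local_rep_def)

text \<open>
  Norm estimates for \<open>tderiv\<close> carry over to \<open>dmap\<close> in all charts: \<open>w\<close> represents in the chosen chart
  the vector that has components \<open>v\<close> in \<open>c\<close>.
\<close>
lemma tderiv_in_charts:
  assumes F: "C1_map F" and c: "c \<in> A" "c' \<in> A" "p \<in> chart_dom c" "F p \<in> chart_dom c'"
  obtains w where "tnorm A g p w = cnorm c p v"
    "tnorm A g (F p) (tderiv A F p w) = cnorm c' (F p) (dmap c c' F p v)"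
proof
  let ?b = "chart_at A p" and ?b' = "chart_at A (F p)"
  let ?w = "dmap c ?b id p v"
  show "tnorm A g p ?w = cnorm c p v"
    unfolding tnorm_eq_cnorm using cnorm_transition c chart_at by blast
  have 1: "dmap c c' (id \<circ> F) p = dmap ?b' c' id (F p) \<circ> dmap c ?b' F p"
    by (rule dmap_comp[OF C1_map_id F]) (use c chart_at in auto)
  have 2: "dmap c ?b' (F \<circ> id) p = dmap ?b ?b' F (id p) \<circ> dmap c ?b id p"
    by (rule dmap_comp[OF F C1_map_id]) (use c chart_at in auto)
  have "dmap c c' F p v = dmap ?b' c' id (F p) (tderiv A F p ?w)"
    using 1 2 by (simp add: tderiv_eq_dmap)
  moreover have "cnorm c' (F p) (dmap ?b' c' id (F p) (tderiv A F p ?w)) = cnorm ?b' (F p) (tderiv A F p ?w)"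
    by (rule cnorm_transition) (use c chart_at in auto)
  ultimately show "tnorm A g (F p) (tderiv A F p ?w) = cnorm c' (F p) (dmap c c' F p v)"
    by (simp add: tnorm_eq_cnorm)
qed

text \<open>
  Expansion is meant in the weak sense, so that the class contains \<open>id\<close> and is closed under
  composition.
\<close>
definition expands :: "('a \<Rightarrow> 'a) \<Rightarrow> bool" where
  "expands F \<longleftrightarrow> C1_map F \<and> (\<forall>p v. tnorm A g p v \<le> tnorm A g (F p) (tderiv A F p v))"

lemma expands_C1: "expands F \<Longrightarrow> C1_map F"
  by (simp add: expands_def)

lemma expands_cont: "expands F \<Longrightarrow> continuous_on UNIV F"
  by (simp add: expands_def C1_map_def)

lemma expands_chart:
  assumes F: "expands F" and c: "c \<in> A" "c' \<in> A" "p \<in> chart_dom c" "F p \<in> chart_dom c'"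
  shows "cnorm c p v \<le> cnorm c' (F p) (dmap c c' F p v)"
proof -
  obtain w where "tnorm A g p w = cnorm c p v"
    "tnorm A g (F p) (tderiv A F p w) = cnorm c' (F p) (dmap c c' F p v)"
    using tderiv_in_charts[OF expands_C1[OF F] c] by blast
  then show ?thesis using F unfolding expands_def by metis
qed

lemma expands_id: "expands id"
  unfolding expands_def tnorm_eq_cnorm tderiv_eq_dmap
  using C1_map_id cnorm_transition chart_at by simp

lemma expands_comp:
  assumes F: "expands F" and G: "expands G" shows "expands (F \<circ> G)"
  unfolding expands_def
proof (intro conjI allI)
  show "C1_map (F \<circ> G)" using F G by (simp add: expands_C1 C1_map_comp)
  fix p v
  have "tderiv A (F \<circ> G) p = tderiv A F (G p) \<circ> tderiv A G p"
    unfolding tderiv_eq_dmap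
    using dmap_comp[OF expands_C1[OF F] expands_C1[OF G]] chart_at by simp
  moreover have "tnorm A g p v \<le> tnorm A g (G p) (tderiv A G p v)"
    using G by (simp add: expands_def)
  moreover have "tnorm A g (G p) w \<le> tnorm A g (F (G p)) (tderiv A F (G p) w)" for w
    using F by (simp add: expands_def)
  ultimately show "tnorm A g p v \<le> tnorm A g ((F \<circ> G) p) (tderiv A (F \<circ> G) p v)"
    by (auto intro: order_trans)
qed

lemma expands_iter: "(\<And>n. expands (f n)) \<Longrightarrow> expands (iter f n)"
  by (induction n) (auto intro: expands_id expands_comp)

lemma expanding_maps_C1: "F \<in> expanding_maps A g \<kappa> \<Gamma> \<Longrightarrow> C1_map F"
  by (simp add: expanding_maps_def C2_map_imp_C1_map)

lemma tnorm_ge_0 [simp]: "0 \<le> tnorm A g p v"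
  by (simp add: tnorm_eq_cnorm chart_at)

lemma expanding_maps_expands:
  assumes "F \<in> expanding_maps A g \<kappa> \<Gamma>" "1 < \<kappa>" shows "expands F"
  unfolding expands_def
proof (intro conjI allI)
  show "C1_map F" by (rule expanding_maps_C1[OF assms(1)])
  fix p v
  have "1 * tnorm A g p v \<le> \<kappa> * tnorm A g p v" using assms by (intro mult_right_mono) auto
  also have "\<dots> \<le> tnorm A g (F p) (tderiv A F p v)" using assms by (simp add: expanding_maps_def)
  finally show "tnorm A g p v \<le> tnorm A g (F p) (tderiv A F p v)" by simp
qed

text \<open>
  The bound on unit vectors that is contained in the \<open>C\<^sup>2\<close>-norm, extended by homogeneity.
\<close>
lemma expanding_maps_bounded:
  assumes F: "F \<in> expanding_maps A g \<kappa> \<Gamma>"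
  shows "tnorm A g (F p) (tderiv A F p v) \<le> \<Gamma> * tnorm A g p v"
proof (cases "v = 0")
  case True
  have "linear (tderiv A F p)"
    unfolding tderiv_eq_dmap using dmap_linear[OF expanding_maps_C1[OF F]] chart_at by blast
  then show ?thesis using True by (simp add: linear_0 tnorm_def)
next
  case False
  let ?t = "tnorm A g p v"
  have lin: "linear (tderiv A F p)"
    unfolding tderiv_eq_dmap using dmap_linear[OF expanding_maps_C1[OF F]] chart_at by blast
  have t: "?t > 0" using False cnorm_zero_iff chart_at by (metis not_le tnorm_eq_cnorm)
  let ?u = "(1 / ?t) *\<^sub>R v"
  have "tnorm A g p ?u = 1" using t by (simp add: tnorm_eq_cnorm cnorm_scale)
  then have "ereal (tnorm A g (F p) (tderiv A F p ?u)) \<le> C2_norm A g F"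
    unfolding C2_norm_def by (intro Sup_upper) blast
  also have "\<dots> \<le> ereal \<Gamma>" using F by (simp add: expanding_maps_def)
  finally have "tnorm A g (F p) (tderiv A F p ?u) \<le> \<Gamma>" by simp
  moreover have "tderiv A F p v = ?t *\<^sub>R tderiv A F p ?u" using t lin by (simp add: linear_scale)
  ultimately show ?thesis using t by (simp add: tnorm_eq_cnorm cnorm_scale mult.commute)
qed

lemma chart_rep:
  assumes "c \<in> A" "c' \<in> A" "U \<subseteq> chart_dom c" "F ` U \<subseteq> chart_dom c'"
  defines "H \<equiv> chart_map c' \<circ> F \<circ> chart_inv c"
  shows chart_rep_eq: "p \<in> U \<Longrightarrow> H (chart_map c p) = chart_map c' (F p)"
    and chart_rep_image: "P \<subseteq> U \<Longrightarrow> H ` chart_map c ` P = chart_map c' ` F ` P"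
    and chart_rep_inj: "inj_on F U \<Longrightarrow> inj_on H (chart_map c ` U)"
proof -
  show eq: "H (chart_map c p) = chart_map c' (F p)" if "p \<in> U" for p
    using that assms by (auto simp: subset_iff)
  show "H ` chart_map c ` P = chart_map c' ` F ` P" if "P \<subseteq> U"
    unfolding image_image by (rule image_cong[OF refl eq]) (use that in blast)
  have "chart_map c p = chart_map c q"
    if "inj_on F U" "p \<in> U" "q \<in> U" "H (chart_map c p) = H (chart_map c q)" for p q
  proof -
    have "chart_inv c' (chart_map c' (F p)) = chart_inv c' (chart_map c' (F q))"
      using eq that by metis
    moreover have "F p \<in> chart_dom c'" "F q \<in> chart_dom c'" using that assms(4) by auto
    ultimately have "F p = F q" using chart_inv_map[OF assms(2)] by metis
    then show ?thesis using that by (auto dest: inj_onD)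
  qed
  then show "inj_on F U \<Longrightarrow> inj_on H (chart_map c ` U)" by (auto intro!: inj_onI)
qed

lemma dmap_inj:
  assumes F: "expands F" and c: "c \<in> A" "c' \<in> A" "p \<in> chart_dom c" "F p \<in> chart_dom c'"
  shows "inj (dmap c c' F p)"
proof -
  have lin: "linear (dmap c c' F p)" by (rule dmap_linear[OF expands_C1[OF F] c])
  have "v = 0" if "dmap c c' F p v = 0" for v
    using expands_chart[OF F c, of v] that c by (metis cnorm_zero_iff order_trans order_refl)
  then show ?thesis by (simp add: linear_injective_0[OF lin])
qed

text \<open>
  An expanding derivative is injective, so the inverse function theorem applies in charts.
\<close>
lemma local_diffeo:
  assumes F: "expands F" and c: "c \<in> A" "c' \<in> A" "p \<in> chart_dom c" "F p \<in> chart_dom c'"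
  obtains U where "open U" "p \<in> U" "U \<subseteq> chart_dom c" "F ` U \<subseteq> chart_dom c'" "inj_on F U"
proof -
  let ?H = "chart_map c' \<circ> F \<circ> chart_inv c"
  have "C1_at ?H (chart_map c p)" by (rule C1_mapD[OF expands_C1[OF F] c])
  moreover have "inj (frechet_derivative ?H (at (chart_map c p)))"
    using dmap_inj[OF F c] by (simp add: dmap_def)
  ultimately obtain V where V: "open V" "chart_map c p \<in> V" "inj_on ?H V"
    by (rule C1_local_inverse)
  define U where "U = (chart_dom c \<inter> chart_map c -` V) \<inter> F -` chart_dom c'"
  have "open U"
    unfolding U_def using c V expands_cont[OF F]
    by (intro open_Int open_chart_vimage open_vimage open_chart_dom)
  moreover have "inj_on F U"
  proof (rule inj_onI)
    fix x y assume xy: "x \<in> U" "y \<in> U" "F x = F y"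
    then have "?H (chart_map c x) = ?H (chart_map c y)" using c by (simp add: U_def)
    then have "chart_map c x = chart_map c y" 
      by (rule inj_onD[OF V(3)]) (use xy in \<open>auto simp: U_def\<close>)
    then have "chart_inv c (chart_map c x) = chart_inv c (chart_map c y)" by simp
    then show "x = y" using xy c by (simp add: U_def)
  qed
  ultimately show thesis using that c V by (auto simp: U_def)
qed

lemma expands_locally_injective: "expands F \<Longrightarrow> locally_injective F"
  unfolding locally_injective_def by (metis local_diffeo chart_at)

text \<open>
  Invariance of domain, applied in charts in which the map is injective.
\<close>
lemma expands_open_map:
  assumes F: "expands F" and X: "open X" shows "open (F ` X)"
proof (subst open_subopen, intro ballI)
  fix y assume "y \<in> F ` X"
  then obtain x where x: "x \<in> X" "y = F x" by blast
  let ?c = "chart_at A x" and ?c' = "chart_at A (F x)"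
  obtain U where U: "open U" "x \<in> U" "U \<subseteq> chart_dom ?c" "F ` U \<subseteq> chart_dom ?c'" "inj_on F U"
    using local_diffeo[OF F chart_at(1) chart_at(1) chart_at(2) chart_at(2)] .
  let ?W = "U \<inter> X" and ?H = "chart_map ?c' \<circ> F \<circ> chart_inv ?c"
  have "continuous_on (chart_map ?c ` ?W) ?H"
  proof (intro continuous_on_compose)
    show "continuous_on (chart_map ?c ` ?W) (chart_inv ?c)"
      by (rule continuous_on_subset[OF continuous_chart_inv[OF chart_at(1)]]) (use U in auto)
    show "continuous_on (chart_inv ?c ` chart_map ?c ` ?W) F"
      using expands_cont[OF F] by (rule continuous_on_subset) auto
    show "continuous_on (F ` chart_inv ?c ` chart_map ?c ` ?W) (chart_map ?c')"
      by (rule continuous_on_subset[OF continuous_chart_map[OF chart_at(1)]])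
        (use U chart_at in \<open>auto simp: subset_iff\<close>)
  qed
  moreover have "open (chart_map ?c ` ?W)"
    by (rule open_chart_image) (use U X chart_at in auto)
  moreover have W: "?W \<subseteq> chart_dom ?c" "F ` ?W \<subseteq> chart_dom ?c'" using U by auto
  moreover have "inj_on ?H (chart_map ?c ` ?W)"
    using chart_rep_inj[OF chart_at(1) chart_at(1) W] U(5) inj_on_subset by blast
  ultimately have "open (?H ` chart_map ?c ` ?W)" by (intro invariance_of_domain)
  then have "open (chart_map ?c' ` F ` ?W)"
    by (simp only: chart_rep_image[OF chart_at(1) chart_at(1) W order_refl])
  then have "open (chart_dom ?c' \<inter> chart_map ?c' -` (chart_map ?c' ` F ` ?W))"
    by (rule open_chart_vimage[OF chart_at(1)])
  moreover have "chart_dom ?c' \<inter> chart_map ?c' -` (chart_map ?c' ` F ` ?W) = F ` ?W"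
    using W(2) inj_on_inverseI[of "chart_dom ?c'" "chart_inv ?c'" "chart_map ?c'"] chart_inv_map[OF chart_at(1)]
    by (auto dest: inj_onD)
  ultimately have "open (F ` ?W)" by simp
  then show "\<exists>T. open T \<and> y \<in> T \<and> T \<subseteq> F ` X" using x U by blast
qed

section \<open>Curves and their length\<close>

text \<open>
  Being \<open>C\<^sup>1\<close> near \<open>t\<close> in one chart implies it in all charts (\<open>regularI\<close>), so this is a condition on the
  germ of the curve.
\<close>
definition regular :: "(real \<Rightarrow> 'a) \<Rightarrow> real \<Rightarrow> bool" where
  "regular \<gamma> t \<longleftrightarrow> isCont \<gamma> t \<and> (\<forall>c\<in>A. \<gamma> t \<in> chart_dom c \<longrightarrow> C1_at (chart_map c \<circ> \<gamma>) t)"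

definition velocity :: "('a, 'n) chart \<Rightarrow> (real \<Rightarrow> 'a) \<Rightarrow> real \<Rightarrow> real ^ 'n" where
  "velocity c \<gamma> t = frechet_derivative (chart_map c \<circ> \<gamma>) (at t) 1"

definition speed :: "(real \<Rightarrow> 'a) \<Rightarrow> real \<Rightarrow> real" where
  "speed \<gamma> t = tnorm A g (\<gamma> t) (vector_derivative (chart_map (chart_at A (\<gamma> t)) \<circ> \<gamma>) (at t))"

lemma velocity_eq_vector_derivative:
  "(chart_map c \<circ> \<gamma>) differentiable (at t) \<Longrightarrow> velocity c \<gamma> t = vector_derivative (chart_map c \<circ> \<gamma>) (at t)"
  by (simp add: velocity_def frechet_derivative_eq_vector_derivative)

lemma eventually_curve_in_chart:
  assumes "isCont \<gamma> t" "c \<in> A" "\<gamma> t \<in> chart_dom c"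
  shows "\<forall>\<^sub>F s in nhds t. \<gamma> s \<in> chart_dom c"
  by (rule isCont_eventually_nhds[OF assms(1) open_chart_dom[OF assms(2)] assms(3)])

lemma image_curve:
  assumes \<gamma>: "isCont \<gamma> t" and F: "C1_map F"
    and c: "c \<in> A" "c' \<in> A" "\<gamma> t \<in> chart_dom c" "F (\<gamma> t) \<in> chart_dom c'"
    and reg: "C1_at (chart_map c \<circ> \<gamma>) t"
  shows "C1_at (chart_map c' \<circ> (F \<circ> \<gamma>)) t"
    and "velocity c' (F \<circ> \<gamma>) t = dmap c c' F (\<gamma> t) (velocity c \<gamma> t)"
proof -
  let ?H = "chart_map c' \<circ> F \<circ> chart_inv c"
  have ev: "\<forall>\<^sub>F s in nhds t. (?H \<circ> (chart_map c \<circ> \<gamma>)) s = (chart_map c' \<circ> (F \<circ> \<gamma>)) s"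
    using eventually_curve_in_chart[OF \<gamma> c(1,3)] by eventually_elim (use c in simp)
  have H: "C1_at ?H ((chart_map c \<circ> \<gamma>) t)" using C1_mapD[OF F c] by simp
  show "C1_at (chart_map c' \<circ> (F \<circ> \<gamma>)) t"
    by (rule C1_at_cong[OF ev C1_at_comp[OF reg H]])
  show "velocity c' (F \<circ> \<gamma>) t = dmap c c' F (\<gamma> t) (velocity c \<gamma> t)"
    unfolding velocity_def frechet_derivative_eventually_cong[OF ev, symmetric]
      frechet_derivative_comp[OF reg H] by (simp add: dmap_def)
qed

lemma regularI:
  assumes "isCont \<gamma> t" "c \<in> A" "\<gamma> t \<in> chart_dom c" "C1_at (chart_map c \<circ> \<gamma>) t"
  shows "regular \<gamma> t"
  unfolding regular_def
  using image_curve(1)[OF assms(1) C1_map_id assms(2) _ assms(3) _ assms(4)] assms(1) by simp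

lemma regularD: "regular \<gamma> t \<Longrightarrow> c \<in> A \<Longrightarrow> \<gamma> t \<in> chart_dom c \<Longrightarrow> C1_at (chart_map c \<circ> \<gamma>) t"
  by (simp add: regular_def)

lemma speed_in_chart:
  assumes "regular \<gamma> t" "c \<in> A" "\<gamma> t \<in> chart_dom c"
  shows "speed \<gamma> t = cnorm c (\<gamma> t) (velocity c \<gamma> t)"
proof -
  let ?b = "chart_at A (\<gamma> t)"
  have r: "C1_at (chart_map ?b \<circ> \<gamma>) t" using regularD[OF assms(1)] chart_at by blast
  have "velocity c (id \<circ> \<gamma>) t = dmap ?b c id (\<gamma> t) (velocity ?b \<gamma> t)"
    by (rule image_curve(2)[OF _ C1_map_id]) (use assms r chart_at in \<open>auto simp: regular_def\<close>)
  moreover have "speed \<gamma> t = cnorm ?b (\<gamma> t) (velocity ?b \<gamma> t)"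
    unfolding speed_def tnorm_eq_cnorm
    by (simp add: velocity_eq_vector_derivative[OF C1_at_differentiable[OF r]])
  moreover have "cnorm c (\<gamma> t) (dmap ?b c id (\<gamma> t) (velocity ?b \<gamma> t)) = cnorm ?b (\<gamma> t) (velocity ?b \<gamma> t)"
    by (rule cnorm_transition) (use assms chart_at in auto)
  ultimately show ?thesis by simp
qed

lemma regular_image:
  assumes "regular \<gamma> t" "C1_map F" shows "regular (F \<circ> \<gamma>) t"
proof (rule regularI)
  show "isCont (F \<circ> \<gamma>) t"
    using assms by (intro continuous_at_compose) (auto simp: regular_def C1_map_isCont)
  show "C1_at (chart_map (chart_at A (F (\<gamma> t))) \<circ> (F \<circ> \<gamma>)) t"
    by (rule image_curve(1)[where c = "chart_at A (\<gamma> t)"])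
      (use assms chart_at in \<open>auto simp: regular_def\<close>)
qed (use chart_at in auto)

lemma speed_image:
  assumes "regular \<gamma> t" "C1_map F"
  shows "speed (F \<circ> \<gamma>) t = tnorm A g (F (\<gamma> t)) (tderiv A F (\<gamma> t) (velocity (chart_at A (\<gamma> t)) \<gamma> t))"
    and "speed \<gamma> t = tnorm A g (\<gamma> t) (velocity (chart_at A (\<gamma> t)) \<gamma> t)"
proof -
  let ?c = "chart_at A (\<gamma> t)" and ?c' = "chart_at A (F (\<gamma> t))"
  have "velocity ?c' (F \<circ> \<gamma>) t = dmap ?c ?c' F (\<gamma> t) (velocity ?c \<gamma> t)"
    by (rule image_curve(2)) (use assms chart_at in \<open>auto simp: regular_def\<close>)
  then show "speed (F \<circ> \<gamma>) t = tnorm A g (F (\<gamma> t)) (tderiv A F (\<gamma> t) (velocity ?c \<gamma> t))"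
    using speed_in_chart[OF regular_image[OF assms], of ?c'] chart_at
    by (simp add: tnorm_eq_cnorm tderiv_eq_dmap)
  show "speed \<gamma> t = tnorm A g (\<gamma> t) (velocity ?c \<gamma> t)"
    using speed_in_chart[OF assms(1), of ?c] chart_at by (simp add: tnorm_eq_cnorm)
qed

lemma regular_cong:
  assumes ev: "\<forall>\<^sub>F s in nhds t. \<gamma> s = \<sigma> s" and "regular \<gamma> t"
  shows "regular \<sigma> t"
proof (rule regularI)
  have eq: "\<gamma> t = \<sigma> t" using ev by (rule eventually_nhds_x_imp_x)
  show "isCont \<sigma> t" using assms by (auto simp: regular_def isCont_cong)
  have "C1_at (chart_map (chart_at A (\<sigma> t)) \<circ> \<gamma>) t"
    by (rule regularD[OF assms(2)]) (use chart_at eq in auto)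
  moreover have "\<forall>\<^sub>F s in nhds t. (chart_map (chart_at A (\<sigma> t)) \<circ> \<gamma>) s = (chart_map (chart_at A (\<sigma> t)) \<circ> \<sigma>) s"
    using ev by eventually_elim simp
  ultimately show "C1_at (chart_map (chart_at A (\<sigma> t)) \<circ> \<sigma>) t" by (rule C1_at_cong[rotated])
qed (use chart_at in auto)

lemma speed_cong:
  assumes ev: "\<forall>\<^sub>F s in nhds t. \<gamma> s = \<sigma> s" and r: "regular \<gamma> t"
  shows "speed \<gamma> t = speed \<sigma> t"
proof -
  let ?c = "chart_at A (\<sigma> t)"
  have eq: "\<gamma> t = \<sigma> t" using ev by (rule eventually_nhds_x_imp_x)
  have "\<forall>\<^sub>F s in nhds t. (chart_map ?c \<circ> \<gamma>) s = (chart_map ?c \<circ> \<sigma>) s"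
    using ev by eventually_elim simp
  from frechet_derivative_eventually_cong[OF this] have "velocity ?c \<gamma> t = velocity ?c \<sigma> t"
    unfolding velocity_def by (rule fun_cong)
  then show ?thesis
    using speed_in_chart[OF r, of ?c] speed_in_chart[OF regular_cong[OF ev r], of ?c] chart_at eq by simp
qed

text \<open>
  Near \<open>t\<close> the lift \<open>\<gamma>\<close> is the composition of \<open>E \<circ> \<gamma>\<close> with a local inverse of \<open>E\<close>.
\<close>
lemma regular_lift:
  assumes E: "expands E" and \<gamma>: "isCont \<gamma> t" and r: "regular (E \<circ> \<gamma>) t"
  shows "regular \<gamma> t"
proof (rule regularI)
  let ?c = "chart_at A (\<gamma> t)" and ?c' = "chart_at A (E (\<gamma> t))"
  let ?H = "chart_map ?c' \<circ> E \<circ> chart_inv ?c"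
  have c: "?c \<in> A" "?c' \<in> A" "\<gamma> t \<in> chart_dom ?c" "E (\<gamma> t) \<in> chart_dom ?c'" using chart_at by auto
  have "C1_at ?H (chart_map ?c (\<gamma> t))" by (rule C1_mapD[OF expands_C1[OF E] c])
  moreover have "inj (frechet_derivative ?H (at (chart_map ?c (\<gamma> t))))"
    using dmap_inj[OF E c] by (simp add: dmap_def)
  ultimately obtain U h where U: "open U" "chart_map ?c (\<gamma> t) \<in> U" "\<And>x. x \<in> U \<Longrightarrow> h (?H x) = x"
      "C1_at h (?H (chart_map ?c (\<gamma> t)))"
    by (rule C1_local_inverse) blast
  have "isCont (chart_map ?c \<circ> \<gamma>) t"
    by (rule continuous_at_compose[OF \<gamma> isCont_chart_map[OF c(1,3)]])
  then have "\<forall>\<^sub>F s in nhds t. (chart_map ?c \<circ> \<gamma>) s \<in> U"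
    by (rule isCont_eventually_nhds) (use U in auto)
  then have ev: "\<forall>\<^sub>F s in nhds t. (h \<circ> (chart_map ?c' \<circ> (E \<circ> \<gamma>))) s = (chart_map ?c \<circ> \<gamma>) s"
    using eventually_curve_in_chart[OF \<gamma> c(1,3)]
    by eventually_elim (use U(3) c in \<open>force simp del: o_apply simp: o_def\<close>)
  have "C1_at (chart_map ?c' \<circ> (E \<circ> \<gamma>)) t" by (rule regularD[OF r]) (use c in auto)
  moreover have "C1_at h ((chart_map ?c' \<circ> (E \<circ> \<gamma>)) t)" using U(4) c by simp
  ultimately have "C1_at (h \<circ> (chart_map ?c' \<circ> (E \<circ> \<gamma>))) t" by (rule C1_at_comp)
  then show "C1_at (chart_map ?c \<circ> \<gamma>) t" by (rule C1_at_cong[OF ev])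
qed (use \<gamma> chart_at in auto)

lemma speed_lift:
  assumes E: "expands E" and r: "regular \<gamma> t"
  shows "speed \<gamma> t \<le> speed (E \<circ> \<gamma>) t"
  unfolding speed_image[OF r expands_C1[OF E]] using E by (simp add: expands_def)

lemma speed_push:
  assumes F: "F \<in> expanding_maps A g \<kappa> \<Gamma>" and r: "regular \<gamma> t"
  shows "speed (F \<circ> \<gamma>) t \<le> \<Gamma> * speed \<gamma> t"
  unfolding speed_image[OF r expanding_maps_C1[OF F]] by (rule expanding_maps_bounded[OF F])

definition regular_path :: "real set \<Rightarrow> (real \<Rightarrow> 'a) \<Rightarrow> bool" where
  "regular_path S \<gamma> \<longleftrightarrow> path \<gamma> \<and> finite S \<and> (\<forall>t\<in>{0<..<1} - S. regular \<gamma> t)"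

lemma path_isCont: "path \<gamma> \<Longrightarrow> t \<in> {0<..<1} \<Longrightarrow> isCont \<gamma> t"
  unfolding path_def by (rule continuous_on_interior) auto

lemma piecewise_C1_path_iff: "piecewise_C1_path A \<gamma> \<longleftrightarrow> (\<exists>S. regular_path S \<gamma>)"
proof
  assume p: "piecewise_C1_path A \<gamma>"
  then obtain S where S: "finite S" "\<And>c. c \<in> A \<Longrightarrow> (chart_map c \<circ> \<gamma>) C1_differentiable_on ({0<..<1} \<inter> \<gamma> -` chart_dom c - S)"
    and \<gamma>: "path \<gamma>" unfolding piecewise_C1_path_def by blast
  have "regular \<gamma> t" if t: "t \<in> {0<..<1} - S" for t
  proof (rule regularI)
    let ?c = "chart_at A (\<gamma> t)" and ?X = "{0<..<1} \<inter> \<gamma> -` chart_dom (chart_at A (\<gamma> t)) - S"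
    let ?h = "chart_map ?c \<circ> \<gamma>"
    show "isCont \<gamma> t" using path_isCont \<gamma> t by blast
    have "continuous_on {0<..<1} \<gamma>" using path_isCont[OF \<gamma>] by (simp add: continuous_at_imp_continuous_on)
    then have "open (\<gamma> -` chart_dom ?c \<inter> {0<..<1})"
      using open_chart_dom[OF chart_at(1)] by (simp add: continuous_on_open_vimage)
    then have X: "open ?X" using S(1) by (simp add: open_Diff finite_imp_closed Int_commute)
    have tX: "t \<in> ?X" using t chart_at by simp
    have C: "\<And>x. x \<in> ?X \<Longrightarrow> ?h differentiable (at x)" "continuous_on ?X (\<lambda>x. vector_derivative ?h (at x))"
      using S(2)[OF chart_at(1)] unfolding C1_differentiable_on_eq by blast+
    have ev: "\<forall>\<^sub>F s in nhds t. s \<in> ?X" using X tX by (rule eventually_nhds_in_open)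
    have "\<forall>\<^sub>F s in nhds t. ?h differentiable (at s)" using ev by eventually_elim (rule C(1))
    moreover have "isCont (\<lambda>s. frechet_derivative ?h (at s) v) t" for v
    proof -
      have "\<forall>\<^sub>F s in nhds t. frechet_derivative ?h (at s) v = v *\<^sub>R vector_derivative ?h (at s)"
        using ev by eventually_elim (simp add: frechet_derivative_eq_vector_derivative C(1))
      moreover have "isCont (\<lambda>s. v *\<^sub>R vector_derivative ?h (at s)) t"
        using C(2) X tX by (intro continuous_intros) (simp add: continuous_on_eq_continuous_at)
      ultimately show ?thesis by (simp add: isCont_cong)
    qed
    ultimately show "C1_at ?h t" by (simp add: C1_at_def)
  qed (use chart_at in auto)
  then show "\<exists>S. regular_path S \<gamma>" using \<gamma> S(1) by (auto simp: regular_path_def)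
next
  assume "\<exists>S. regular_path S \<gamma>"
  then obtain S where \<gamma>: "path \<gamma>" and S: "finite S" "\<And>t. t \<in> {0<..<1} - S \<Longrightarrow> regular \<gamma> t"
    unfolding regular_path_def by blast
  have "(chart_map c \<circ> \<gamma>) C1_differentiable_on ({0<..<1} \<inter> \<gamma> -` chart_dom c - S)" if c: "c \<in> A" for c
    unfolding C1_differentiable_on_eq
  proof (intro conjI ballI continuous_at_imp_continuous_on)
    let ?h = "chart_map c \<circ> \<gamma>"
    fix t assume t: "t \<in> {0<..<1} \<inter> \<gamma> -` chart_dom c - S"
    have C: "C1_at ?h t" by (rule regularD[OF S(2)]) (use t c in auto)
    then show "?h differentiable (at t)" by (rule C1_at_differentiable)
    have "\<forall>\<^sub>F s in nhds t. frechet_derivative ?h (at s) 1 = vector_derivative ?h (at s)"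
      using C1_at_eventually[OF C] by eventually_elim (simp add: frechet_derivative_eq_vector_derivative)
    moreover have "isCont (\<lambda>s. frechet_derivative ?h (at s) 1) t" using C by (simp add: C1_at_def)
    ultimately show "isCont (\<lambda>s. vector_derivative ?h (at s)) t" by (simp add: isCont_cong)
  qed
  then show "piecewise_C1_path A \<gamma>" using \<gamma> S(1) unfolding piecewise_C1_path_def by blast
qed

text \<open>
  Finitely many parameters, in particular both ends of the path, do not contribute to the integral.
\<close>
lemma path_length_mono:
  assumes "finite S" "\<And>t. t \<in> {0<..<1} - S \<Longrightarrow> speed \<gamma> t \<le> h t"
  shows "path_length_riem A g \<gamma> \<le> (\<integral>\<^sup>+ t \<in> {0..1}. ennreal (h t) \<partial>lborel)"
proof -
  have "AE t in lborel. t \<notin> S \<union> {0, 1}"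
    by (rule AE_not_in) (use assms(1) in \<open>simp add: finite_imp_null_set_lborel\<close>)
  then show ?thesis
    unfolding path_length_riem_def speed_def[symmetric]
    by (intro nn_integral_mono_AE, elim eventually_mono)
      (use assms(2) in \<open>auto simp: indicator_def intro!: ennreal_leI\<close>)
qed

lemma path_length_eq: "path_length_riem A g \<gamma> = (\<integral>\<^sup>+ t \<in> {0..1}. ennreal (speed \<gamma> t) \<partial>lborel)"
  by (simp add: path_length_riem_def speed_def)

lemma rdist_less:
  assumes "regular_path S \<gamma>" "path_length_riem A g \<gamma> < ennreal \<delta>"
  shows "rdist A g (\<gamma> 0) (\<gamma> 1) < \<delta>"
proof -
  let ?I = "INF \<gamma>' \<in> {\<gamma>'. piecewise_C1_path A \<gamma>' \<and> pathstart \<gamma>' = \<gamma> 0 \<and> pathfinish \<gamma>' = \<gamma> 1}. path_length_riem A g \<gamma>'"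
  have "?I \<le> path_length_riem A g \<gamma>"
    by (rule INF_lower) (use assms in \<open>auto simp: piecewise_C1_path_iff pathstart_def pathfinish_def\<close>)
  then have "?I < ennreal \<delta>" using assms(2) by (rule le_less_trans)
  then have "enn2real ?I < \<delta>"
    by (cases ?I rule: ennreal_cases) (auto simp: ennreal_less_iff)
  then show ?thesis unfolding rdist_def .
qed

text \<open>
  Expanding maps do not shorten paths, so lifts of short paths are short.
\<close>
lemma rdist_lift:
  assumes E: "expands E" and \<gamma>: "path \<gamma>" and \<sigma>: "regular_path S \<sigma>"
    and eq: "\<And>t. t \<in> {0..1} \<Longrightarrow> E (\<gamma> t) = \<sigma> t" and len: "path_length_riem A g \<sigma> < ennreal \<delta>"
  shows "rdist A g (\<gamma> 0) (\<gamma> 1) < \<delta>"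
proof (rule rdist_less)
  have r: "regular \<gamma> t" "speed \<gamma> t \<le> speed \<sigma> t" if t: "t \<in> {0<..<1} - S" for t
  proof -
    have ev: "\<forall>\<^sub>F s in nhds t. \<sigma> s = (E \<circ> \<gamma>) s"
      using eventually_nhds_in_open[of "{0<..<1::real}" t] t by (auto simp: eq elim!: eventually_mono)
    have rs: "regular \<sigma> t" using \<sigma> t by (simp add: regular_path_def)
    show "regular \<gamma> t"
      by (rule regular_lift[OF E path_isCont[OF \<gamma>] regular_cong[OF ev rs]]) (use t in auto)
    then show "speed \<gamma> t \<le> speed \<sigma> t"
      using speed_lift[OF E] speed_cong[OF ev rs] by (simp add: o_def)
  qed
  show "regular_path S \<gamma>" using \<gamma> \<sigma> r by (simp add: regular_path_def)
  have "path_length_riem A g \<gamma> \<le> path_length_riem A g \<sigma>"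
    using path_length_mono[of S \<gamma> "speed \<sigma>"] r \<sigma> by (simp add: regular_path_def path_length_eq)
  then show "path_length_riem A g \<gamma> < ennreal \<delta>" using len by simp
qed


section \<open>Comparison with Euclidean balls in charts\<close>

text \<open>
  By compactness of \<open>K\<close> and of the unit sphere, the quadratic form of the metric has positive bounds
  on \<open>K\<close>.
\<close>
lemma chart_metric_bounds:
  assumes c: "c \<in> A" and K: "compact K" "K \<subseteq> chart_map c ` chart_dom c"
  shows "\<exists>a>0. \<exists>B>0. \<forall>x\<in>K. \<forall>v. a * norm v \<le> cnorm c (chart_inv c x) v \<and> cnorm c (chart_inv c x) v \<le> B * norm v"
proof (cases "K = {}")
  case True then show ?thesis by (intro exI[of _ "1::real"] conjI) auto
next
  case False
  define Q where "Q z = snd z \<bullet> (g c (chart_inv c (fst z)) *v snd z)" for z :: "(real ^ 'n) \<times> (real ^ 'n)"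
  let ?S = "K \<times> sphere (0 :: real ^ 'n) 1"
  have "Ck_on 0 (\<lambda>x. g c (chart_inv c x)) (chart_map c ` chart_dom c)"
    using rm c unfolding riemannian_manifold_def riemannian_metric_def smooth_on_def by blast
  then have "continuous_on (chart_map c ` chart_dom c) (\<lambda>x. g c (chart_inv c x))" by simp
  then have cg: "continuous_on K (\<lambda>x. g c (chart_inv c x))" by (rule continuous_on_subset) (rule K)
  have cg2: "continuous_on ?S (\<lambda>z. g c (chart_inv c (fst z)))"
    by (rule continuous_on_compose2[OF cg]) (auto intro: continuous_intros)
  have cQ: "continuous_on ?S Q"
    unfolding Q_def inner_vec_def matrix_vector_mult_def inner_real_def vec_lambda_beta
    by (intro continuous_intros cg2)
  have cpt: "compact ?S" using K by (intro compact_Times compact_sphere)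
  have "axis undefined 1 \<in> sphere (0 :: real ^ 'n) 1" by simp
  then have ne: "?S \<noteq> {}" using False by blast
  obtain z0 where z0: "z0 \<in> ?S" "\<And>z. z \<in> ?S \<Longrightarrow> Q z0 \<le> Q z"
    using continuous_attains_inf[OF cpt ne cQ] by blast
  obtain z1 where z1: "z1 \<in> ?S" "\<And>z. z \<in> ?S \<Longrightarrow> Q z \<le> Q z1"
    using continuous_attains_sup[OF cpt ne cQ] by blast
  have pos: "Q z > 0" if "z \<in> ?S" for z
    unfolding Q_def by (rule metric_pos[OF c]) (use that K c in \<open>auto simp: subset_iff\<close>)
  have "sqrt (Q z0) * norm v \<le> cnorm c (chart_inv c x) v \<and> cnorm c (chart_inv c x) v \<le> sqrt (Q z1) * norm v"
    if x: "x \<in> K" for x v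
  proof (cases "v = 0")
    case True then show ?thesis by (simp add: cnorm_def)
  next
    case False
    let ?u = "(1 / norm v) *\<^sub>R v"
    have "(x, ?u) \<in> ?S" using x False by simp
    then have "sqrt (Q z0) \<le> cnorm c (chart_inv c x) ?u" "cnorm c (chart_inv c x) ?u \<le> sqrt (Q z1)"
      using z0(2) z1(2) by (fastforce simp: Q_def cnorm_def)+
    moreover have "cnorm c (chart_inv c x) v = norm v * cnorm c (chart_inv c x) ?u"
      using False by (simp add: cnorm_scale)
    ultimately show ?thesis by (auto simp: mult.commute[of _ "norm v"] intro!: mult_left_mono)
  qed
  then show ?thesis using pos[OF z0(1)] pos[OF z1(1)]
    by (intro exI[of _ "sqrt (Q z0)"] exI[of _ "sqrt (Q z1)"] conjI) auto
qed

definition chart_ball :: "('a, 'n) chart \<Rightarrow> real ^ 'n \<Rightarrow> real \<Rightarrow> 'a set" where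
  "chart_ball c x r = chart_dom c \<inter> chart_map c -` ball x r"

lemma open_chart_ball: "c \<in> A \<Longrightarrow> open (chart_ball c x r)"
  unfolding chart_ball_def by (rule open_chart_vimage) auto

lemma chart_ball_eq_image:
  assumes "c \<in> A" "cball x r \<subseteq> chart_map c ` chart_dom c"
  shows "chart_ball c x r = chart_inv c ` ball x r"
proof (intro equalityI subsetI)
  fix q assume "q \<in> chart_ball c x r"
  then show "q \<in> chart_inv c ` ball x r"
    using assms(1) by (auto simp: chart_ball_def intro!: image_eqI[of _ _ "chart_map c q"])
next
  fix q assume "q \<in> chart_inv c ` ball x r"
  then obtain y where y: "y \<in> ball x r" "q = chart_inv c y" by blast
  then have "y \<in> chart_map c ` chart_dom c" using assms(2) by (auto simp: subset_iff)
  then show "q \<in> chart_ball c x r" using y assms(1) by (auto simp: chart_ball_def)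
qed

lemma connected_chart_ball:
  assumes "c \<in> A" "cball x r \<subseteq> chart_map c ` chart_dom c"
  shows "connected (chart_ball c x r)"
  unfolding chart_ball_eq_image[OF assms]
  by (rule connected_continuous_image[OF continuous_on_subset[OF continuous_chart_inv[OF assms(1)]]])
    (use assms(2) ball_subset_cball in auto)

lemma sections_over_chart_ball:
  assumes cpt: "compact (UNIV :: 'a set)" and E: "expands E"
    and c: "c \<in> A" "cball x r \<subseteq> chart_map c ` chart_dom c"
  shows "sections_over E (chart_ball c x r)"
proof (rule sections_over_convex[where C = "cball x r" and \<psi> = "chart_inv c" and \<phi> = "chart_map c"])
  show "locally_injective E" by (rule expands_locally_injective[OF E])
  show "\<exists>W. open W \<and> y \<in> W \<and> sections_over E W" for y
    by (rule local_sections[OF cpt expands_cont[OF E] expands_open_map[OF E] expands_locally_injective[OF E]])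
  show "continuous_on (cball x r) (chart_inv c)"
    by (rule continuous_on_subset[OF continuous_chart_inv[OF c(1)] c(2)])
  show "continuous_on (chart_ball c x r) (chart_map c)"
    by (rule continuous_on_subset[OF continuous_chart_map[OF c(1)]]) (auto simp: chart_ball_def)
qed (use c in \<open>auto simp: chart_ball_def\<close>)

lemma
  assumes r: "regular \<gamma> (k * t + d)"
  shows regular_affine: "regular (\<lambda>s. \<gamma> (k * s + d)) t"
    and speed_affine: "speed (\<lambda>s. \<gamma> (k * s + d)) t = \<bar>k\<bar> * speed \<gamma> (k * t + d)"
proof -
  let ?c = "chart_at A (\<gamma> (k * t + d))" and ?a = "\<lambda>s. k * s + d"
  have h: "C1_at (chart_map ?c \<circ> \<gamma>) (?a t)" by (rule regularD[OF r]) (use chart_at in auto)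
  have eq: "chart_map ?c \<circ> (\<lambda>s. \<gamma> (k * s + d)) = (chart_map ?c \<circ> \<gamma>) \<circ> ?a" by auto
  have cont: "isCont (\<lambda>s. \<gamma> (k * s + d)) t"
    by (rule isCont_o2[of t ?a \<gamma>]) (use r in \<open>auto simp: regular_def intro!: continuous_intros\<close>)
  show reg: "regular (\<lambda>s. \<gamma> (k * s + d)) t"
  proof (rule regularI[OF cont, of ?c])
    show "C1_at (chart_map ?c \<circ> (\<lambda>s. \<gamma> (k * s + d))) t"
      unfolding eq by (rule C1_at_comp[OF C1_at_affine h])
  qed (use chart_at in auto)
  have lin: "linear (frechet_derivative (chart_map ?c \<circ> \<gamma>) (at (?a t)))" by (rule C1_at_linear[OF h])
  have "velocity ?c (\<lambda>s. \<gamma> (k * s + d)) t = k *\<^sub>R velocity ?c \<gamma> (?a t)"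
    unfolding velocity_def eq frechet_derivative_comp[OF C1_at_affine h] frechet_derivative_affine
    using linear_scale[OF lin, of k 1] by simp
  then show "speed (\<lambda>s. \<gamma> (k * s + d)) t = \<bar>k\<bar> * speed \<gamma> (k * t + d)"
    using speed_in_chart[OF reg, of ?c] speed_in_chart[OF r, of ?c] chart_at by (simp add: cnorm_scale)
qed

text \<open>
  The bound on the speed ensures a finite length, and it is easier to preserve than the length when paths
  are joined.
\<close>
definition linked :: "'a \<Rightarrow> 'a \<Rightarrow> bool" where
  "linked x y \<longleftrightarrow> (\<exists>\<gamma> S B. regular_path S \<gamma> \<and> \<gamma> 0 = x \<and> \<gamma> 1 = y \<and> (\<forall>t\<in>{0<..<1} - S. speed \<gamma> t \<le> B))"

lemma path_length_bound:
  assumes S: "finite S" and B: "\<And>t. t \<in> {0<..<1} - S \<Longrightarrow> speed \<gamma> t \<le> B"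
  shows "path_length_riem A g \<gamma> \<le> ennreal B"
proof -
  have "path_length_riem A g \<gamma> \<le> (\<integral>\<^sup>+ t \<in> {0..1::real}. ennreal B \<partial>lborel)"
    by (rule path_length_mono[OF S, of \<gamma> "\<lambda>_. B"]) (rule B)
  also have "\<dots> = ennreal B" by (subst nn_integral_cmult_indicator) auto
  finally show ?thesis .
qed

text \<open>
  Each half of the joined path is traversed at twice the original speed.
\<close>
lemma linked_trans:
  assumes "linked x y" "linked y z" shows "linked x z"
proof -
  obtain \<gamma>1 S1 B1 where 1: "regular_path S1 \<gamma>1" "\<gamma>1 0 = x" "\<gamma>1 1 = y" "\<And>t. t \<in> {0<..<1} - S1 \<Longrightarrow> speed \<gamma>1 t \<le> B1"
    using assms(1) unfolding linked_def by blast
  obtain \<gamma>2 S2 B2 where 2: "regular_path S2 \<gamma>2" "\<gamma>2 0 = y" "\<gamma>2 1 = z" "\<And>t. t \<in> {0<..<1} - S2 \<Longrightarrow> speed \<gamma>2 t \<le> B2"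
    using assms(2) unfolding linked_def by blast
  let ?\<gamma> = "\<gamma>1 +++ \<gamma>2"
  define S where "S = insert (1/2) ((\<lambda>t. t / 2) ` S1 \<union> (\<lambda>t. (t + 1) / 2) ` S2)"
  have fin: "finite S" using 1 2 by (simp add: S_def regular_path_def)
  have half: "regular ?\<gamma> t \<and> speed ?\<gamma> t \<le> max (2 * B1) (2 * B2)"
    if r: "regular_path S' \<gamma>'" "2 * t + d \<in> {0<..<1} - S'" "2 * speed \<gamma>' (2 * t + d) \<le> max (2 * B1) (2 * B2)"
      and ev: "\<forall>\<^sub>F s in nhds t. \<gamma>' (2 * s + d) = ?\<gamma> s" for \<gamma>' S' d t
  proof -
    have r1: "regular \<gamma>' (2 * t + d)" using r(1,2) unfolding regular_path_def by blast
    have r2: "regular (\<lambda>s. \<gamma>' (2 * s + d)) t" by (rule regular_affine[OF r1])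
    have "speed ?\<gamma> t = 2 * speed \<gamma>' (2 * t + d)"
      using speed_cong[OF ev r2] speed_affine[OF r1] by simp
    then show ?thesis using regular_cong[OF ev r2] r(3) by simp
  qed
  have r: "regular ?\<gamma> t \<and> speed ?\<gamma> t \<le> max (2 * B1) (2 * B2)" if t: "t \<in> {0<..<1} - S" for t
  proof (cases "t < 1/2")
    case True
    have t1: "2 * t + 0 \<in> {0<..<1} - S1"
      using t True by (auto simp: S_def image_iff mult.commute)
    have ev: "\<forall>\<^sub>F s in nhds t. \<gamma>1 (2 * s + 0) = ?\<gamma> s"
      using eventually_nhds_in_open[OF open_lessThan, of t "1/2"] True
      by (auto simp: joinpaths_def elim!: eventually_mono)
    show ?thesis by (rule half[OF 1(1) t1 _ ev]) (use 1(4)[OF t1] in auto)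
  next
    case False
    then have tg: "t > 1/2" using t by (auto simp: S_def)
    have t1: "2 * t + (-1) \<in> {0<..<1} - S2"
      using t tg by (force simp: S_def image_iff)
    have ev: "\<forall>\<^sub>F s in nhds t. \<gamma>2 (2 * s + (-1)) = ?\<gamma> s"
      using eventually_nhds_in_open[OF open_greaterThan, of t "1/2"] tg
      by (auto simp: joinpaths_def elim!: eventually_mono)
    show ?thesis by (rule half[OF 2(1) t1 _ ev]) (use 2(4)[OF t1] in auto)
  qed
  have "path ?\<gamma>" using 1 2 by (intro path_join_imp) (auto simp: regular_path_def pathstart_def pathfinish_def)
  then have "regular_path S ?\<gamma>" using fin r by (simp add: regular_path_def)
  moreover have "?\<gamma> 0 = x" "?\<gamma> 1 = z" using 1 2 by (auto simp: joinpaths_def)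
  ultimately show ?thesis unfolding linked_def using r by blast
qed

lemma chart_segment:
  assumes c: "c \<in> A" and K: "convex K" "K \<subseteq> chart_map c ` chart_dom c" "a \<in> K" "b \<in> K"
    and B: "\<And>y v. y \<in> K \<Longrightarrow> cnorm c (chart_inv c y) v \<le> B * norm v"
  shows "regular_path {} (chart_inv c \<circ> linepath a b)"
    and "t \<in> {0<..<1} \<Longrightarrow> speed (chart_inv c \<circ> linepath a b) t \<le> B * norm (b - a)"
proof -
  let ?\<sigma> = "chart_inv c \<circ> linepath a b"
  have inK: "linepath a b t \<in> K" if "t \<in> {0..1}" for t
    using that K closed_segment_subset[OF K(3,4,1)] linepath_in_path[of t a b] by auto
  have path: "path ?\<sigma>"
    by (rule path_continuous_image[OF path_linepath])
      (rule continuous_on_subset[OF continuous_chart_inv[OF c]], use closed_segment_subset[OF K(3,4,1)] K(2) in auto)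
  have C: "C1_at (linepath a b) t" and D: "frechet_derivative (linepath a b) (at t) 1 = b - a" for t :: real
  proof -
    have der: "(linepath a b has_derivative (\<lambda>h. h *\<^sub>R (b - a))) (at s)" for s
      using has_vector_derivative_linepath_within[of a b s UNIV] by (simp add: has_vector_derivative_def)
    have eq: "frechet_derivative (linepath a b) (at s) = (\<lambda>h. h *\<^sub>R (b - a))" for s
      by (rule frechet_derivative_at[OF der, symmetric])
    show "C1_at (linepath a b) t"
      unfolding C1_at_def eq using der by (auto simp: differentiable_def intro!: always_eventually)
    show "frechet_derivative (linepath a b) (at t) 1 = b - a" unfolding eq by simp
  qed
  have r: "regular ?\<sigma> t" "speed ?\<sigma> t \<le> B * norm (b - a)" if t: "t \<in> {0<..<1}" for t
  proof -
    have d: "?\<sigma> t \<in> chart_dom c" "linepath a b t \<in> K" using inK[of t] K(2) c t by (auto simp: subset_iff)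
    have "open (chart_map c ` chart_dom c)" "linepath a b t \<in> chart_map c ` chart_dom c"
      using open_chart_range[OF c] d(2) K(2) by auto
    then have "\<forall>\<^sub>F s in nhds t. linepath a b s \<in> chart_map c ` chart_dom c"
      by (rule isCont_eventually_nhds[OF C1_at_isCont[OF C]])
    then have ev: "\<forall>\<^sub>F s in nhds t. linepath a b s = (chart_map c \<circ> ?\<sigma>) s"
      by eventually_elim (use chart_map_inv[OF c] in simp)
    have r: "regular ?\<sigma> t"
      by (rule regularI[OF path_isCont[OF path t] c d(1) C1_at_cong[OF ev C]])
    then show "regular ?\<sigma> t" .
    have "velocity c ?\<sigma> t = b - a"
      unfolding velocity_def frechet_derivative_eventually_cong[OF ev, symmetric] D ..
    then have "speed ?\<sigma> t = cnorm c (?\<sigma> t) (b - a)" unfolding speed_in_chart[OF r c d(1)] by (rule arg_cong)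
    moreover have "?\<sigma> t = chart_inv c (linepath a b t)" by simp
    ultimately show "speed ?\<sigma> t \<le> B * norm (b - a)" using B[OF d(2), of "b - a"] by metis
  qed
  show "regular_path {} ?\<sigma>" using path r by (simp add: regular_path_def)
  show "t \<in> {0<..<1} \<Longrightarrow> speed ?\<sigma> t \<le> B * norm (b - a)" by (rule r(2))
qed

text \<open>
  On the ball of radius \<open>2 R\<close> the metric is comparable to the Euclidean one, and paths that start in the ball of
  radius \<open>R\<close> with the same centre have room in it.
\<close>
definition controlled_ball :: "('a, 'n) chart \<Rightarrow> real ^ 'n \<Rightarrow> real \<Rightarrow> real \<Rightarrow> real \<Rightarrow> bool" where
  "controlled_ball c x R a B \<longleftrightarrow> 0 < R \<and> 0 < a \<and> 0 < B \<and> cball x (2 * R) \<subseteq> chart_map c ` chart_dom c \<and>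
     (\<forall>y\<in>cball x (2 * R). \<forall>v. a * norm v \<le> cnorm c (chart_inv c y) v \<and> cnorm c (chart_inv c y) v \<le> B * norm v)"

lemma controlled_ball_exists:
  "\<exists>R a B. controlled_ball (chart_at A p) (chart_map (chart_at A p) p) R a B"
proof -
  let ?c = "chart_at A p"
  have "open (chart_map ?c ` chart_dom ?c)" "chart_map ?c p \<in> chart_map ?c ` chart_dom ?c"
    using open_chart_range chart_at by auto
  then obtain e where e: "e > 0" "cball (chart_map ?c p) e \<subseteq> chart_map ?c ` chart_dom ?c"
    by (meson open_contains_cball)
  have R: "e / 2 > 0" "cball (chart_map ?c p) (2 * (e / 2)) \<subseteq> chart_map ?c ` chart_dom ?c"
    using e by auto
  obtain a B where "a > 0" "B > 0" "\<forall>x\<in>cball (chart_map ?c p) (2 * (e / 2)). \<forall>v.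
      a * norm v \<le> cnorm ?c (chart_inv ?c x) v \<and> cnorm ?c (chart_inv ?c x) v \<le> B * norm v"
    using chart_metric_bounds[OF chart_at(1) compact_cball R(2)] by metis
  then have "controlled_ball ?c (chart_map ?c p) (e / 2) a B" unfolding controlled_ball_def using R by blast
  then show ?thesis by blast
qed

text \<open>
  Before it leaves the chart ball of radius \<open>2 R\<close>, a path that starts in the one of radius \<open>R\<close> has to
  cover a Euclidean distance of at least \<open>R\<close>, and so a Riemannian length of at least \<open>a R\<close>.  The form
  with \<open>\<Gamma>\<close> and \<open>l\<close> is for the image \<open>\<sigma>\<close> of a path of speed \<open>l\<close> under a map that stretches vectors by at most
  \<open>\<Gamma>\<close>.
\<close>
lemma short_path_stays:
  assumes \<sigma>: "regular_path S \<sigma>" and c: "c \<in> A" and ctl: "controlled_ball c x R a B"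
    and 0: "\<sigma> 0 \<in> chart_ball c x R"
    and \<Gamma>: "0 < \<Gamma>" "\<And>t. t \<in> {0<..<1} - S \<Longrightarrow> speed \<sigma> t \<le> \<Gamma> * l t"
    and len: "(\<integral>\<^sup>+ t \<in> {0..1}. ennreal (l t) \<partial>lborel) < ennreal (a * R / \<Gamma>)"
    and t: "t \<in> {0..1}"
  shows "\<sigma> t \<in> chart_ball c x (2 * R)"
proof (rule ccontr)
  have R: "0 < R" "cball x (2 * R) \<subseteq> chart_map c ` chart_dom c"
    and a: "0 < a" "\<And>y v. y \<in> cball x (2 * R) \<Longrightarrow> a * norm v \<le> cnorm c (chart_inv c y) v"
    using ctl by (simp_all add: controlled_ball_def)
  assume neg: "\<sigma> t \<notin> chart_ball c x (2 * R)"
  have cont: "continuous_on {0..1} \<sigma>" using \<sigma> by (simp add: regular_path_def path_def)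
  define T where "T = {0..1} \<inter> \<sigma> -` (- chart_ball c x (2 * R))"
  have "closed T" unfolding T_def
    using cont open_chart_ball[OF c] by (intro continuous_closed_preimage) auto
  moreover have "T \<noteq> {}" "bdd_below T" using neg t by (auto simp: T_def)
  ultimately have T0: "Inf T \<in> T" by (intro closed_contains_Inf)
  \<comment> \<open>the first exit time\<close>
  define t0 where "t0 = Inf T"
  have t0: "t0 \<in> T" using T0 by (simp add: t0_def)
  have "\<sigma> 0 \<notin> - chart_ball c x (2 * R)" using 0 R by (auto simp: chart_ball_def)
  then have t0p: "0 < t0" "t0 \<le> 1" using t0 by (auto simp: T_def intro: less_le_trans le_neq_trans)
  have before: "\<sigma> s \<in> chart_ball c x (2 * R)" if "0 \<le> s" "s < t0" for s
  proof (rule ccontr)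
    assume "\<sigma> s \<notin> chart_ball c x (2 * R)"
    then have "s \<in> T" using that t0p by (simp add: T_def)
    then have "t0 \<le> s" unfolding t0_def using \<open>bdd_below T\<close> by (rule cInf_lower)
    then show False using that by simp
  qed
  define q where "q = enn2real (\<integral>\<^sup>+ t \<in> {0..1}. ennreal (l t) \<partial>lborel)"
  have q: "(\<integral>\<^sup>+ t \<in> {0..1}. ennreal (l t) \<partial>lborel) = ennreal q"
    unfolding q_def using len by (metis ennreal_enn2real ennreal_less_top order_less_trans)
  have q0: "0 \<le> q" by (simp add: q_def)
  have qR: "q * \<Gamma> / a < R"
    using len a \<Gamma> q0 unfolding q by (simp add: ennreal_less_iff field_simps)
  let ?u = "chart_map c \<circ> \<sigma>"
  have close: "dist (?u 0) (?u b) \<le> q * \<Gamma> / a" if b: "0 \<le> b" "b < t0" for b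
  proof -
    have V: "\<sigma> s \<in> chart_dom c" "?u s \<in> ball x (2 * R)" if "s \<in> {0..b}" for s
      using before[of s] that b by (auto simp: chart_ball_def)
    have "ennreal (a / \<Gamma> * norm (?u b - ?u 0)) \<le> (\<integral>\<^sup>+ t \<in> {0..1}. ennreal (l t) \<partial>lborel)"
    proof (rule norm_increment_le[where S = S])
      have c01: "continuous_on {0..b} \<sigma>" by (rule continuous_on_subset[OF cont]) (use b t0p in auto)
      show "continuous_on {0..b} ?u"
        by (rule continuous_on_compose[OF c01 continuous_on_subset[OF continuous_chart_map[OF c]]])
          (use V(1) in auto)
      fix s assume s: "s \<in> {0<..<b} - S"
      have r: "regular \<sigma> s" using \<sigma> s b t0p by (simp add: regular_path_def)
      show "C1_at ?u s" by (rule regularD[OF r c]) (use V s in auto)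
      have "a * norm (velocity c \<sigma> s) \<le> cnorm c (\<sigma> s) (velocity c \<sigma> s)"
        using a(2)[of "?u s" "velocity c \<sigma> s"] V[of s] s c by (auto simp: less_imp_le)
      also have "\<dots> \<le> \<Gamma> * l s"
        using speed_in_chart[OF r c] \<Gamma>(2)[of s] V(1)[of s] s b t0p by auto
      finally show "a / \<Gamma> * norm (frechet_derivative ?u (at s) 1) \<le> l s"
        using \<Gamma>(1) by (simp add: velocity_def field_simps)
    qed (use b t0p \<sigma> a \<Gamma> in \<open>auto simp: regular_path_def\<close>)
    then have "a / \<Gamma> * norm (?u b - ?u 0) \<le> q" unfolding q using q0 a \<Gamma> by (simp add: ennreal_le_iff)
    then show ?thesis using a(1) \<Gamma>(1) by (simp add: dist_norm norm_minus_commute field_simps)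
  qed
  \<comment> \<open>until time \<open>t0\<close> the path stays in a compact part of the chart ball, which excludes an exit at \<open>t0\<close>\<close>
  define \<rho> where "\<rho> = R + q * \<Gamma> / a"
  have \<rho>: "\<rho> < 2 * R" using qR by (simp add: \<rho>_def)
  have sub: "cball x \<rho> \<subseteq> chart_map c ` chart_dom c" using R(2) \<rho> by (auto simp: subset_iff)
  let ?C = "chart_inv c ` cball x \<rho>"
  have "compact ?C"
    by (rule compact_continuous_image[OF continuous_on_subset[OF continuous_chart_inv[OF c] sub] compact_cball])
  then have Ccl: "closed ?C" by (rule compact_imp_closed)
  have inC: "\<sigma> s \<in> ?C" if s: "0 \<le> s" "s < t0" for s
  proof -
    have "dist x (?u s) \<le> dist x (?u 0) + dist (?u 0) (?u s)" by (rule dist_triangle)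
    also have "\<dots> \<le> \<rho>" unfolding \<rho>_def
      using close[OF s] 0 by (intro add_mono) (auto simp: chart_ball_def)
    finally have "?u s \<in> cball x \<rho>" by simp
    moreover have "chart_inv c (?u s) = \<sigma> s" using before[OF s] c by (simp add: chart_ball_def)
    ultimately show ?thesis by (metis image_eqI)
  qed
  have "\<sigma> t0 \<in> ?C"
  proof -
    have "closed ({0..1} \<inter> \<sigma> -` ?C)" using cont Ccl by (intro continuous_closed_preimage) auto
    moreover have "{0<..<t0} \<subseteq> {0..1} \<inter> \<sigma> -` ?C" using inC t0p by auto
    ultimately have "closure {0<..<t0} \<subseteq> {0..1} \<inter> \<sigma> -` ?C" by (rule closure_minimal[rotated])
    then show ?thesis using t0p by (auto simp: subset_iff)
  qed
  then have "\<sigma> t0 \<in> chart_ball c x (2 * R)"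
    using sub \<rho> c by (auto simp: chart_ball_def subset_iff)
  then show False using t0 by (simp add: T_def)
qed


text \<open>
  The paths \<open>\<sigma>\<close> have length at most \<open>\<delta> / 2\<close>, and the sections exist for all expanding maps at once.
\<close>
definition small_nbhd :: "real \<Rightarrow> 'a \<Rightarrow> 'a set \<Rightarrow> bool" where
  "small_nbhd \<delta> p V \<longleftrightarrow> open V \<and> connected V \<and> p \<in> V \<and> (\<forall>E. expands E \<longrightarrow> sections_over E V) \<and>
     (\<forall>x\<in>V. \<forall>y\<in>V. \<exists>\<sigma>. regular_path {} \<sigma> \<and> \<sigma> 0 = x \<and> \<sigma> 1 = y \<and>
        (\<forall>t\<in>{0<..<1}. speed \<sigma> t \<le> \<delta> / 2) \<and> \<sigma> ` {0..1} \<subseteq> V)"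

text \<open>
  Segments in a chart serve as short paths; the length of a segment is at most \<open>B\<close> times its Euclidean
  length.
\<close>
lemma small_nbhd_exists:
  assumes cpt: "compact (UNIV :: 'a set)" and \<delta>: "\<delta> > 0"
  shows "\<exists>V. small_nbhd \<delta> p V"
proof -
  define c where "c = chart_at A p"
  have c: "c \<in> A" "p \<in> chart_dom c" using chart_at by (auto simp: c_def)
  obtain R a B where "controlled_ball c (chart_map c p) R a B"
    using controlled_ball_exists[of p] unfolding c_def by blast
  then have R: "R > 0" "B > 0" "cball (chart_map c p) (2 * R) \<subseteq> chart_map c ` chart_dom c"
    "\<And>y v. y \<in> cball (chart_map c p) (2 * R) \<Longrightarrow> cnorm c (chart_inv c y) v \<le> B * norm v"
    by (simp_all add: controlled_ball_def)
  define r where "r = min R (\<delta> / (4 * B))"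
  have r: "r > 0" "r \<le> 2 * R" "B * (2 * r) \<le> \<delta> / 2" using R(1,2) \<delta> by (auto simp: r_def min_def field_simps)
  let ?V = "chart_ball c (chart_map c p) r"
  let ?K = "ball (chart_map c p) r"
  have K: "cball (chart_map c p) r \<subseteq> cball (chart_map c p) (2 * R)" using r by auto
  have K1: "?K \<subseteq> chart_map c ` chart_dom c" "?K \<subseteq> cball (chart_map c p) (2 * R)"
    using K R(3) ball_subset_cball by blast+
  have seg: "\<exists>\<sigma>. regular_path {} \<sigma> \<and> \<sigma> 0 = x \<and> \<sigma> 1 = y \<and> (\<forall>t\<in>{0<..<1}. speed \<sigma> t \<le> \<delta> / 2) \<and>
         \<sigma> ` {0..1} \<subseteq> ?V"
    if xy: "x \<in> ?V" "y \<in> ?V" for x y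
  proof -
    let ?a = "chart_map c x" and ?b = "chart_map c y"
    let ?\<sigma> = "chart_inv c \<circ> linepath ?a ?b"
    have ab: "?a \<in> ?K" "?b \<in> ?K" "x \<in> chart_dom c" "y \<in> chart_dom c" using xy by (auto simp: chart_ball_def)
    have BK: "\<And>y v. y \<in> ?K \<Longrightarrow> cnorm c (chart_inv c y) v \<le> B * norm v" using R(4) K1(2) by blast
    have "norm (?b - ?a) \<le> 2 * r"
      using dist_triangle[of ?b ?a "chart_map c p"] ab by (simp add: dist_norm dist_commute[of _ "chart_map c p"])
        (simp add: norm_minus_commute)
    then have "B * norm (?b - ?a) \<le> B * (2 * r)" using R(2) by (intro mult_left_mono) auto
    then have le: "B * norm (?b - ?a) \<le> \<delta> / 2" using r(3) by simp
    have "regular_path {} ?\<sigma>"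
      by (rule chart_segment(1)[OF c(1) convex_ball K1(1) ab(1,2) BK])
    moreover have "speed ?\<sigma> t \<le> \<delta> / 2" if "t \<in> {0<..<1}" for t
      using chart_segment(2)[OF c(1) convex_ball K1(1) ab(1,2) BK that] le by simp
    moreover have "?\<sigma> ` {0..1} \<subseteq> ?V"
    proof
      fix z assume "z \<in> ?\<sigma> ` {0..1}"
      then obtain t where t: "t \<in> {0..1}" "z = chart_inv c (linepath ?a ?b t)" by auto
      have "linepath ?a ?b t \<in> ?K"
        using t(1) closed_segment_subset[OF ab(1,2) convex_ball] linepath_in_path[of t ?a ?b] by auto
      then show "z \<in> ?V"
        using t(2) chart_ball_eq_image[OF c(1) order_trans[OF K R(3)]] by blast
    qed
    ultimately show ?thesis using ab c(1) by (intro exI[of _ ?\<sigma>]) (simp add: linepath_0' linepath_1')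
  qed
  note V = order_trans[OF K R(3)]
  have "small_nbhd \<delta> p ?V"
    unfolding small_nbhd_def using open_chart_ball[OF c(1)] connected_chart_ball[OF c(1) V]
      sections_over_chart_ball[OF cpt _ c(1) V] seg c(2) r(1)
    by (simp add: chart_ball_def)
  then show ?thesis by blast
qed

text \<open>
  Points of a common chart ball are linked, so the set of points linked to \<open>x\<close> is open and closed.
\<close>
lemma linked_UNIV:
  assumes cpt: "compact (UNIV :: 'a set)" and conn: "connected (UNIV :: 'a set)"
  shows "linked x y"
proof -
  have loc: "\<exists>V. open V \<and> p \<in> V \<and> (\<forall>x\<in>V. \<forall>y\<in>V. linked x y)" for p
  proof -
    obtain V where V: "small_nbhd 1 p V" using small_nbhd_exists[OF cpt zero_less_one] by metis
    then have "linked x y" if "x \<in> V" "y \<in> V" for x y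
      using that unfolding small_nbhd_def linked_def by (metis Diff_empty)
    then show ?thesis using V by (intro exI[of _ V]) (simp add: small_nbhd_def)
  qed
  have "linked x y = linked x x"
  proof (rule connected_local_const[OF conn], simp_all, intro allI)
    fix a
    obtain V where V: "open V" "a \<in> V" "\<And>x y. x \<in> V \<Longrightarrow> y \<in> V \<Longrightarrow> linked x y"
      using loc[of a] by metis
    have "\<forall>\<^sub>F b in nhds a. b \<in> V" using V by (simp add: eventually_nhds_in_open)
    then have "\<forall>\<^sub>F b in at a. b \<in> V" by (simp add: eventually_at_filter eventually_mono)
    then show "\<forall>\<^sub>F b in at a. linked x a = linked x b"
      by eventually_elim (use V linked_trans in blast)
  qed
  then show ?thesis using loc[of x] by blast
qed

text \<open>
  The infimum in the definition of the distance is finite because \<open>x\<close> and \<open>y\<close> are linked.  Otherwise the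
  conversion to a real number would yield the distance \<open>0\<close> without any path from \<open>x\<close> to \<open>y\<close>.
\<close>
lemma rdist_lessD:
  assumes cpt: "compact (UNIV :: 'a set)" and conn: "connected (UNIV :: 'a set)"
    and less: "rdist A g x y < \<delta>"
  obtains \<gamma> S where "regular_path S \<gamma>" "\<gamma> 0 = x" "\<gamma> 1 = y" "path_length_riem A g \<gamma> < ennreal \<delta>"
proof -
  let ?P = "{\<gamma>. piecewise_C1_path A \<gamma> \<and> pathstart \<gamma> = x \<and> pathfinish \<gamma> = y}"
  let ?I = "INF \<gamma> \<in> ?P. path_length_riem A g \<gamma>"
  obtain \<gamma> S B where 1: "regular_path S \<gamma>" "\<gamma> 0 = x" "\<gamma> 1 = y" "\<And>t. t \<in> {0<..<1} - S \<Longrightarrow> speed \<gamma> t \<le> B"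
    using linked_UNIV[OF cpt conn, of x y] unfolding linked_def by blast
  have "path_length_riem A g \<gamma> \<le> ennreal B"
    by (rule path_length_bound[OF _ 1(4)]) (use 1(1) in \<open>auto simp: regular_path_def\<close>)
  moreover have "?I \<le> path_length_riem A g \<gamma>"
    by (rule INF_lower) (use 1 in \<open>auto simp: piecewise_C1_path_iff pathstart_def pathfinish_def\<close>)
  ultimately have "?I \<le> ennreal B" by (meson order_trans)
  then have "?I < \<infinity>" using le_less_trans[OF _ ennreal_less_top] by simp
  moreover have "enn2real ?I < \<delta>" using less unfolding rdist_def .
  ultimately have "?I < ennreal \<delta>"
    by (cases ?I rule: ennreal_cases) (auto simp: ennreal_less_iff)
  then obtain \<gamma>' where "\<gamma>' \<in> ?P" "path_length_riem A g \<gamma>' < ennreal \<delta>" unfolding INF_less_iff by blast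
  then show thesis using that by (auto simp: piecewise_C1_path_iff pathstart_def pathfinish_def)
qed

section \<open>Uniform local injectivity and the degree\<close>

text \<open>
  Finitely many balls \<open>?V p (R p)\<close> cover the manifold, and paths of length less than \<open>\<Gamma> \<delta>\<close> that start in such
  a ball stay in \<open>?V p (2 * R p)\<close>.  A path \<open>\<gamma>\<close> from \<open>x\<close> to \<open>y\<close> of length less than \<open>\<delta>\<close> is a lift of
  \<open>F \<circ> \<gamma>\<close>, which stays in a ball of this kind; by uniqueness of lifts \<open>\<gamma>\<close> runs inside the image of the
  section \<open>G\<close> through \<open>x\<close>.  On this image \<open>F\<close> is injective.  The choice of \<open>\<delta>\<close> does not depend on \<open>F\<close>.
\<close>
lemma uniform_local_injectivity:
  assumes cpt: "compact (UNIV :: 'a set)" and conn: "connected (UNIV :: 'a set)" and \<kappa>: "1 < \<kappa>" and \<Gamma>: "0 < \<Gamma>"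
  shows "\<exists>\<delta>>0. \<forall>F\<in>expanding_maps A g \<kappa> \<Gamma>. \<forall>x. \<exists>U. open U \<and> {y. rdist A g x y < \<delta>} \<subseteq> U \<and> inj_on F U"
proof -
  define c where "c p = chart_at A p" for p
  have "\<forall>p. \<exists>R a B. controlled_ball (c p) (chart_map (c p) p) R a B"
    using controlled_ball_exists unfolding c_def by blast
  then obtain R a B where ctl: "\<And>p. controlled_ball (c p) (chart_map (c p) p) (R p) (a p) (B p)" by metis
  have c: "c p \<in> A" "p \<in> chart_dom (c p)" "R p > 0" "a p > 0"
    "cball (chart_map (c p) p) (2 * R p) \<subseteq> chart_map (c p) ` chart_dom (c p)" for p
    using ctl[of p] chart_at by (auto simp: controlled_ball_def c_def)
  let ?V = "\<lambda>p. chart_ball (c p) (chart_map (c p) p)"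
  have "p \<in> ?V p (R p)" for p using c by (simp add: chart_ball_def)
  then obtain P where P: "finite P" "UNIV \<subseteq> (\<Union>p\<in>P. ?V p (R p))"
    by (rule_tac compactE_image[OF cpt, of UNIV "\<lambda>p. ?V p (R p)"]) (use open_chart_ball c in auto)
  have "P \<noteq> {}" using P(2) by auto
  define \<delta> where "\<delta> = Min ((\<lambda>p. a p * R p / \<Gamma>) ` P)"
  have \<delta>: "\<delta> > 0" "\<And>p. p \<in> P \<Longrightarrow> \<delta> \<le> a p * R p / \<Gamma>"
    using P(1) \<open>P \<noteq> {}\<close> c \<Gamma> by (auto simp: \<delta>_def)
  show ?thesis
  proof (intro exI[of _ \<delta>] conjI ballI allI)
    fix F x assume F: "F \<in> expanding_maps A g \<kappa> \<Gamma>"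
    have ex: "expands F" by (rule expanding_maps_expands[OF F \<kappa>])
    note inj = expands_locally_injective[OF ex]
    obtain p where p: "p \<in> P" "F x \<in> ?V p (R p)" using P(2) by blast
    let ?W = "?V p (2 * R p)"
    have "F x \<in> ?W" using p(2) c(3)[of p] by (auto simp: chart_ball_def)
    moreover have "sections_over F ?W" by (rule sections_over_chart_ball[OF cpt ex c(1) c(5)])
    ultimately obtain G where G: "continuous_on ?W G" "\<And>w. w \<in> ?W \<Longrightarrow> F (G w) = w" "G (F x) = x"
      unfolding sections_over_def by blast
    have "open (G ` ?W)"
      by (rule section_image_open[OF expands_cont[OF ex] inj open_chart_ball[OF c(1)] G(1,2)])
    moreover have "inj_on F (G ` ?W)" by (rule inj_on_inverseI[of _ G]) (use G(2) in auto)
    moreover have "{y. rdist A g x y < \<delta>} \<subseteq> G ` ?W"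
    proof
      fix y assume "y \<in> {y. rdist A g x y < \<delta>}"
      then have "rdist A g x y < \<delta>" by simp
      then obtain \<gamma> S where \<gamma>: "regular_path S \<gamma>" "\<gamma> 0 = x" "\<gamma> 1 = y"
          "path_length_riem A g \<gamma> < ennreal \<delta>"
        by (rule rdist_lessD[OF cpt conn])
      have r\<gamma>: "regular \<gamma> t" if "t \<in> {0<..<1} - S" for t using \<gamma>(1) that by (simp add: regular_path_def)
      have cF: "continuous_on (\<gamma> ` {0..1}) F" using expands_cont[OF ex] by (rule continuous_on_subset) simp
      have c\<gamma>: "continuous_on {0..1} \<gamma>" using \<gamma>(1) by (simp add: regular_path_def path_def)
      have cF\<gamma>: "continuous_on {0..1} (F \<circ> \<gamma>)" by (rule continuous_on_compose[OF c\<gamma> cF])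
      have reg: "regular_path S (F \<circ> \<gamma>)"
        using \<gamma>(1) regular_image[OF r\<gamma> expands_C1[OF ex]] cF\<gamma> by (simp add: regular_path_def path_def)
      have len: "(\<integral>\<^sup>+ t \<in> {0..1}. ennreal (speed \<gamma> t) \<partial>lborel) < ennreal (a p * R p / \<Gamma>)"
        using \<gamma>(4) \<delta>(2)[OF p(1)] unfolding path_length_eq by (meson ennreal_leI order_less_le_trans)
      have stay: "(F \<circ> \<gamma>) t \<in> ?W" if t: "t \<in> {0..1}" for t
      proof (rule short_path_stays[OF reg c(1) ctl _ \<Gamma> _ len t])
        show "(F \<circ> \<gamma>) 0 \<in> ?V p (R p)" using p(2) \<gamma>(2) by simp
        show "speed (F \<circ> \<gamma>) s \<le> \<Gamma> * speed \<gamma> s" if "s \<in> {0<..<1} - S" for s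
          by (rule speed_push[OF F r\<gamma>[OF that]])
      qed
      have cGF: "continuous_on {0..1} (G \<circ> (F \<circ> \<gamma>))"
        by (rule continuous_on_compose[OF cF\<gamma> continuous_on_subset[OF G(1)]]) (use stay in auto)
      have "(G \<circ> (F \<circ> \<gamma>)) 1 = \<gamma> 1"
        by (rule lift_unique[OF inj _ cGF c\<gamma>, of 0]) (use G stay \<gamma>(2) in auto)
      then have "y = G (F y)" using \<gamma>(3) by simp
      moreover have "F y \<in> ?W" using stay[of 1] \<gamma>(3) by simp
      ultimately show "y \<in> G ` ?W" by (rule image_eqI)
    qed
    ultimately show "\<exists>U. open U \<and> {y. rdist A g x y < \<delta>} \<subseteq> U \<and> inj_on F U" by blast
  qed (rule \<delta>(1))
qed

lemma finite_fibre: "compact (UNIV :: 'a set) \<Longrightarrow> expands F \<Longrightarrow> finite (F -` {y})"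
  by (rule finite_fibres[OF _ expands_cont expands_locally_injective])

lemma card_fibre_eq:
  assumes cpt: "compact (UNIV :: 'a set)" and conn: "connected (UNIV :: 'a set)" and F: "expands F"
  shows "card (F -` {y}) = card (F -` {y'})"
proof (rule card_fibre_const[OF finite_fibre[OF cpt F] expands_locally_injective[OF F] conn])
  fix p
  obtain V where "small_nbhd 1 p V" using small_nbhd_exists[OF cpt zero_less_one] by metis
  then show "\<exists>V. open V \<and> connected V \<and> p \<in> V \<and> sections_over F V"
    using F unfolding small_nbhd_def by blast
qed

section \<open>The integral of the Jacobian is the degree\<close>

text \<open>
  The determinant does not vanish on the segment of positive definite matrices from the identity to the Gram
  matrix, and it is \<open>1\<close> at the identity.
\<close>
lemma det_metric_pos:
  assumes "c \<in> A" "p \<in> chart_dom c" shows "det (g c p) > 0"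
proof -
  define M where "M t = (1 - t) *\<^sub>R mat 1 + t *\<^sub>R g c p" for t :: real
  have nz: "det (M t) \<noteq> 0" if t: "0 \<le> t" "t \<le> 1" for t
  proof -
    have "v = 0" if "M t *v v = 0" for v
    proof (rule ccontr)
      assume v: "v \<noteq> 0"
      have pos: "v \<bullet> v > 0" "v \<bullet> (g c p *v v) > 0" using v metric_pos[OF assms v] by auto
      have "v \<bullet> (M t *v v) = (1 - t) * (v \<bullet> v) + t * (v \<bullet> (g c p *v v))"
        by (simp add: M_def matrix_vector_mult_add_rdistrib scaleR_matrix_vector_assoc[symmetric] inner_add_right)
      moreover have "\<dots> > 0"
      proof (cases "t = 0")
        case False
        have "(1 - t) * (v \<bullet> v) \<ge> 0" "t * (v \<bullet> (g c p *v v)) > 0" using t False pos by auto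
        then show ?thesis by linarith
      qed (use pos in simp)
      ultimately show False using that by simp
    qed
    then have "inj ((*v) (M t))" by (simp add: linear_injective_0)
    then show ?thesis using det_nz_iff_inj[of "(*v) (M t)"] by simp
  qed
  have cont: "continuous_on {0..1} (\<lambda>t. det (M t))"
    unfolding det_def M_def by (intro continuous_intros)
  have M01: "det (M 0) = 1" "M 1 = g c p" by (auto simp: M_def)
  show ?thesis
  proof (rule ccontr)
    assume "\<not> det (g c p) > 0"
    then have "\<exists>x\<ge>0. x \<le> 1 \<and> det (M x) = 0"
      using IVT2'[of "\<lambda>t. det (M t)" 1 0 0] cont M01 by auto
    then show False using nz by auto
  qed
qed

lemma sqrt_det_metric_trans:
  assumes "c \<in> A" "c' \<in> A" "p \<in> chart_dom c" "p \<in> chart_dom c'"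
  shows "sqrt (det (g c p)) = \<bar>det (matrix (dmap c c' id p))\<bar> * sqrt (det (g c' p))"
proof -
  let ?T = "matrix (dmap c c' id p)"
  have "det (g c p) = (det ?T)\<^sup>2 * det (g c' p)"
    by (subst metric_trans[OF assms]) (simp add: det_mul power2_eq_square)
  then show ?thesis by (simp add: real_sqrt_mult)
qed

definition chart_jacobian :: "('a, 'n) chart \<Rightarrow> ('a, 'n) chart \<Rightarrow> ('a \<Rightarrow> 'a) \<Rightarrow> 'a \<Rightarrow> real" where
  "chart_jacobian c c' F p = \<bar>det (matrix (dmap c c' F p))\<bar> * sqrt (det (g c' (F p))) / sqrt (det (g c p))"

text \<open>
  The Jacobians of the coordinate changes cancel.
\<close>
lemma riem_jacobian_in_charts:
  assumes F: "C1_map F" and c: "c \<in> A" "c' \<in> A" "p \<in> chart_dom c" "F p \<in> chart_dom c'"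
  shows "riem_jacobian A g F p = chart_jacobian c c' F p"
proof -
  let ?b = "chart_at A p" and ?b' = "chart_at A (F p)"
  let ?T = "det (matrix (dmap c ?b id p))" and ?T' = "det (matrix (dmap ?b' c' id (F p)))"
  let ?D = "det (matrix (dmap ?b ?b' F p))"
  have 1: "dmap c c' (id \<circ> F) p = dmap ?b' c' id (F p) \<circ> dmap c ?b' F p"
    by (rule dmap_comp[OF C1_map_id F]) (use c chart_at in auto)
  have 2: "dmap c ?b' (F \<circ> id) p = dmap ?b ?b' F (id p) \<circ> dmap c ?b id p"
    by (rule dmap_comp[OF F C1_map_id]) (use c chart_at in auto)
  have lin: "linear (dmap ?b' c' id (F p))" "linear (dmap c ?b' F p)" "linear (dmap ?b ?b' F p)" "linear (dmap c ?b id p)"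
    using dmap_linear[OF C1_map_id] dmap_linear[OF F] c chart_at by auto
  have "matrix (dmap c c' F p) = matrix (dmap ?b' c' id (F p)) ** (matrix (dmap ?b ?b' F p) ** matrix (dmap c ?b id p))"
    using 1 2 lin by (simp add: matrix_compose)
  then have D: "det (matrix (dmap c c' F p)) = ?T' * (?D * ?T)" by (simp add: det_mul)
  have s: "sqrt (det (g c p)) = \<bar>?T\<bar> * sqrt (det (g ?b p))"
    "sqrt (det (g ?b' (F p))) = \<bar>?T'\<bar> * sqrt (det (g c' (F p)))"
    by (rule sqrt_det_metric_trans; use c chart_at in auto)+
  have "sqrt (det (g c p)) > 0" using det_metric_pos c by simp
  then have "?T \<noteq> 0" using s(1) by auto
  have "riem_jacobian A g F p = \<bar>?D\<bar> * sqrt (det (g ?b' (F p))) / sqrt (det (g ?b p))"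
    by (simp add: riem_jacobian_def tderiv_eq_dmap gram_def)
  also have "\<dots> = chart_jacobian c c' F p"
    unfolding chart_jacobian_def D s using \<open>?T \<noteq> 0\<close> by (simp add: abs_mult)
  finally show ?thesis .
qed

lemma isCont_det_metric_chart:
  assumes "c \<in> A" "p \<in> chart_dom c"
  shows "isCont (\<lambda>x. det (g c (chart_inv c x))) (chart_map c p)"
proof (rule isCont_det)
  have "Ck_on 0 (\<lambda>x. g c (chart_inv c x)) (chart_map c ` chart_dom c)"
    using rm assms unfolding riemannian_manifold_def riemannian_metric_def smooth_on_def by blast
  then have "isCont (\<lambda>x. g c (chart_inv c x)) (chart_map c p)"
    using open_chart_range assms by (simp add: continuous_on_eq_continuous_at)
  then show "isCont (\<lambda>x. g c (chart_inv c x) $ i $ j) (chart_map c p)" for i j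
    by (intro continuous_intros)
qed

lemma isCont_det_metric:
  assumes "c \<in> A" "p \<in> chart_dom c"
  shows "isCont (\<lambda>q. det (g c q)) p"
proof -
  have "isCont (\<lambda>q. det (g c (chart_inv c (chart_map c q)))) p"
    by (rule isCont_o2[OF isCont_chart_map[OF assms] isCont_det_metric_chart[OF assms]])
  moreover have "\<forall>\<^sub>F q in nhds p. det (g c (chart_inv c (chart_map c q))) = det (g c q)"
    using eventually_nhds_in_open[OF open_chart_dom[OF assms(1)] assms(2)]
    by eventually_elim (use assms in simp)
  ultimately show ?thesis by (simp add: isCont_cong)
qed

lemma isCont_riem_jacobian:
  assumes F: "C1_map F" shows "isCont (riem_jacobian A g F) p"
proof -
  let ?c = "chart_at A p" and ?c' = "chart_at A (F p)"
  let ?H = "chart_map ?c' \<circ> F \<circ> chart_inv ?c"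
  have c: "?c \<in> A" "?c' \<in> A" "p \<in> chart_dom ?c" "F p \<in> chart_dom ?c'" using chart_at by auto
  have "isCont (\<lambda>x. det (matrix (frechet_derivative ?H (at x)))) (chart_map ?c p)"
    by (intro isCont_det isCont_matrix_entry C1_mapD[OF F c])
  then have 1: "isCont (\<lambda>q. det (matrix (dmap ?c ?c' F q))) p"
    unfolding dmap_def by (rule isCont_o2[OF isCont_chart_map[OF c(1,3)]])
  have 2: "isCont (\<lambda>q. det (g ?c' (F q))) p"
    by (rule isCont_o2[OF C1_map_isCont[OF F] isCont_det_metric[OF c(2,4)]])
  have 3: "isCont (\<lambda>q. det (g ?c q)) p" by (rule isCont_det_metric[OF c(1,3)])
  have "isCont (chart_jacobian ?c ?c' F) p"
    unfolding chart_jacobian_def using 1 2 3 det_metric_pos[OF c(1,3)] by (intro continuous_intros) auto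
  moreover have "\<forall>\<^sub>F q in nhds p. riem_jacobian A g F q = chart_jacobian ?c ?c' F q"
    using eventually_nhds_in_open[OF open_chart_dom[OF c(1)] c(3)]
      isCont_eventually_nhds[OF C1_map_isCont[OF F] open_chart_dom[OF c(2)] c(4)]
    by eventually_elim (rule riem_jacobian_in_charts[OF F c(1,2)])
  ultimately show ?thesis by (simp add: isCont_cong)
qed

lemma riem_jacobian_nonneg: "C1_map F \<Longrightarrow> 0 \<le> riem_jacobian A g F p"
  using riem_jacobian_in_charts[of F "chart_at A p" "chart_at A (F p)" p]
    det_metric_pos[OF chart_at, of p] det_metric_pos[OF chart_at, of "F p"] chart_at
  by (simp add: chart_jacobian_def)

definition volume_density :: "('a, 'n) chart \<Rightarrow> real ^ 'n \<Rightarrow> real" where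
  "volume_density c x = sqrt (det (g c (chart_inv c x)))"

lemma continuous_volume_density: "c \<in> A \<Longrightarrow> continuous_on (chart_map c ` chart_dom c) (volume_density c)"
  unfolding volume_density_def
  by (intro continuous_at_imp_continuous_on ballI, elim imageE, hypsubst)
    (intro continuous_real_sqrt isCont_det_metric_chart)

lemma borel_chart_image:
  assumes "c \<in> A" "P \<in> sets borel" "P \<subseteq> chart_dom c" shows "chart_map c ` P \<in> sets borel"
  by (rule sets_borel_homeomorphic_image[OF open_chart_range chart_homeomorphism]) (use assms in auto)

text \<open>
  The defining property of the volume says that on \<open>P\<close> it is the image of the measure with density
  \<open>sqrt (det g)\<close> in coordinates; hence it extends from sets to functions.
\<close>
lemma nn_integral_chart:
  assumes m: "riemannian_volume A g m" and c: "c \<in> A" and P: "P \<in> sets borel" "P \<subseteq> chart_dom c"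
    and h: "h \<in> borel_measurable borel"
  shows "(\<integral>\<^sup>+p. h p * indicator P p \<partial>m) =
    (\<integral>\<^sup>+x. h (chart_inv c x) * ennreal (volume_density c x) * indicator (chart_map c ` P) x \<partial>lborel)"
proof -
  let ?R = "chart_map c ` chart_dom c" and ?S = "chart_map c ` P"
  have sm: "sets m = sets borel" using m by (simp add: riemannian_volume_def)
  have vol: "emeasure m B = (\<integral>\<^sup>+ x. ennreal (sqrt (det (g c (chart_inv c x)))) * indicator (chart_map c ` B) x \<partial>lborel)"
    if "B \<in> sets borel" "B \<subseteq> chart_dom c" for B
    by (rule m[unfolded riemannian_volume_def, THEN conjunct2, rule_format, OF c that])
  \<comment> \<open>outside the range of the chart any Borel function would do\<close>
  define K where "K x = (if x \<in> ?R then chart_inv c x else undefined)" for x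
  have K: "K \<in> borel_measurable borel" unfolding K_def
    by (rule borel_measurable_continuous_on_if)
      (use open_chart_range[OF c] continuous_chart_inv[OF c] in auto)
  have S: "?S \<in> sets borel" by (rule borel_chart_image[OF c P])
  have D: "(\<lambda>x. ennreal (volume_density c x) * indicator ?S x) \<in> borel_measurable borel"
    by (rule borel_measurable_cont_indicator[OF continuous_volume_density[OF c] open_chart_range[OF c] S]) (use P in auto)
  have eq: "emeasure m (P \<inter> X) = (\<integral>\<^sup>+x. (ennreal (volume_density c x) * indicator ?S x) * indicator (K -` X) x \<partial>lborel)"
    if X: "X \<in> sets borel" for X
  proof -
    have "emeasure m (P \<inter> X) = (\<integral>\<^sup>+ x. ennreal (sqrt (det (g c (chart_inv c x)))) * indicator (chart_map c ` (P \<inter> X)) x \<partial>lborel)"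
      by (rule vol) (use P X in auto)
    also have "\<dots> = (\<integral>\<^sup>+ x. (ennreal (volume_density c x) * indicator ?S x) * indicator (K -` X) x \<partial>lborel)"
    proof (rule nn_integral_cong)
      fix x
      have "x \<in> chart_map c ` (P \<inter> X) \<longleftrightarrow> x \<in> ?S \<and> x \<in> K -` X"
      proof
        assume "x \<in> chart_map c ` (P \<inter> X)"
        then obtain p where p: "p \<in> P" "p \<in> X" "x = chart_map c p" by (elim imageE IntE) simp
        then have "p \<in> chart_dom c" using P by blast
        then have "K x = p" using p c by (simp add: K_def)
        then show "x \<in> ?S \<and> x \<in> K -` X" using p by simp
      next
        assume "x \<in> ?S \<and> x \<in> K -` X"
        then obtain p where p: "p \<in> P" "x = chart_map c p" "K x \<in> X" by (elim conjE imageE) simp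
        then have "p \<in> chart_dom c" using P by blast
        then have "K x = p" using p c by (simp add: K_def)
        then show "x \<in> chart_map c ` (P \<inter> X)" using p by (intro image_eqI[of _ _ p]) simp_all
      qed
      then show "ennreal (sqrt (det (g c (chart_inv c x)))) * indicator (chart_map c ` (P \<inter> X)) x =
        (ennreal (volume_density c x) * indicator ?S x) * indicator (K -` X) x"
        by (simp add: volume_density_def indicator_def)
    qed
    finally show ?thesis .
  qed
  have "(\<integral>\<^sup>+p. h p * indicator P p \<partial>m) =
      (\<integral>\<^sup>+x. (ennreal (volume_density c x) * indicator ?S x) * (h (K x) * indicator P (K x)) \<partial>lborel)"
    by (rule nn_integral_transfer[OF sm P(1) K D _ eq]) (intro borel_measurable_times_ennreal h borel_measurable_indicator P(1))
  also have "\<dots> = (\<integral>\<^sup>+x. h (chart_inv c x) * ennreal (volume_density c x) * indicator ?S x \<partial>lborel)"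
  proof (rule nn_integral_cong)
    fix x
    have "K x = chart_inv c x" "chart_inv c x \<in> P" if "x \<in> ?S"
      using that P(2) c by (auto simp: K_def subset_iff)
    then show "(ennreal (volume_density c x) * indicator ?S x) * (h (K x) * indicator P (K x)) =
        h (chart_inv c x) * ennreal (volume_density c x) * indicator ?S x"
      by (cases "x \<in> ?S") (simp_all add: mult.commute)
  qed
  finally show ?thesis .
qed

text \<open>
  The change of variables formula in charts: the factor \<open>sqrt (det g)\<close> at \<open>p\<close> cancels the denominator of the
  Riemannian Jacobian, the one at \<open>F p\<close> is the density of the volume in the target.
\<close>
lemma emeasure_image_expands:
  assumes m: "riemannian_volume A g m" and F: "expands F"
    and c: "c \<in> A" "c' \<in> A" and U: "open U" "U \<subseteq> chart_dom c" "F ` U \<subseteq> chart_dom c'" "inj_on F U"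
    and P: "P \<in> sets borel" "P \<subseteq> U"
  shows "F ` P \<in> sets borel"
    and "emeasure m (F ` P) = (\<integral>\<^sup>+p. ennreal (riem_jacobian A g F p) * indicator P p \<partial>m)"
proof -
  let ?H = "chart_map c' \<circ> F \<circ> chart_inv c"
  let ?D = "\<lambda>x. frechet_derivative ?H (at x)"
  let ?T = "chart_map c ` U" and ?S = "chart_map c ` P"
  note C1 = expands_C1[OF F]
  have T: "open ?T" by (rule open_chart_image[OF c(1) U(1,2)])
  have S: "?S \<in> sets borel" "?S \<subseteq> ?T" using borel_chart_image[OF c(1) P(1)] P U by auto
  note rep = chart_rep_eq[OF c U(2,3)] chart_rep_image[OF c U(2,3)] chart_rep_inj[OF c U(2,3)]
  have C: "C1_at ?H x" if "x \<in> ?T" for x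
    using that C1_mapD[OF C1 c] U by blast
  have der: "(?H has_derivative ?D x) (at x)" if "x \<in> ?T" for x
    by (rule C1_at_has_derivative[OF C[OF that]])
  have cont: "continuous_on ?T (\<lambda>x. det (matrix (?D x)))"
    by (intro continuous_at_imp_continuous_on ballI isCont_det isCont_matrix_entry C)
  have inj: "inj_on ?H ?T" by (rule rep(3)[OF U(4)])
  have HS: "?H ` ?S = chart_map c' ` (F ` P)" by (rule rep(2)[OF P(2)])
  have cH: "continuous_on ?T ?H"
    by (intro continuous_at_imp_continuous_on ballI has_derivative_continuous[OF der])
  obtain h where hom: "homeomorphism ?T (?H ` ?T) ?H h"
    by (rule invariance_of_domain_homeomorphism[OF T cH _ inj]) auto
  have HSb: "?H ` ?S \<in> sets borel"
    by (rule sets_borel_homeomorphic_image[OF invariance_of_domain[OF cH T inj] hom S])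
  have FP: "F ` P \<subseteq> chart_dom c'" using P U by blast
  have inv_im: "chart_inv c' ` (chart_map c' ` (F ` P)) = F ` P"
    using FP c(2) by (force simp: image_image)
  have "chart_inv c' ` (?H ` ?S) \<in> sets borel"
  proof (rule sets_borel_homeomorphic_image[OF open_chart_dom[OF c(2)] _ HSb])
    show "homeomorphism (chart_map c' ` chart_dom c') (chart_dom c') (chart_inv c') (chart_map c')"
      using chart_homeomorphism[OF c(2)] by (rule homeomorphism_symD)
    show "?H ` ?S \<subseteq> chart_map c' ` chart_dom c'" unfolding HS using FP by blast
  qed
  then show FPb: "F ` P \<in> sets borel" unfolding HS inv_im .
  have u: "(\<lambda>y. ennreal (volume_density c' y) * indicator (?H ` ?S) y) \<in> borel_measurable borel"
    by (rule borel_measurable_cont_indicator[OF continuous_volume_density[OF c(2)] open_chart_range[OF c(2)] HSb])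
      (unfold HS, use FP in blast)
  have "emeasure m (F ` P) = (\<integral>\<^sup>+p. 1 * indicator (F ` P) p \<partial>m)"
    using FPb m by (simp add: riemannian_volume_def)
  also have "\<dots> = (\<integral>\<^sup>+y. 1 * ennreal (volume_density c' y) * indicator (chart_map c' ` (F ` P)) y \<partial>lborel)"
    by (rule nn_integral_chart[OF m c(2) FPb FP]) simp
  also have "\<dots> = (\<integral>\<^sup>+y. ennreal (volume_density c' y) * indicator (?H ` ?S) y \<partial>lborel)"
    by (simp only: HS mult_1)
  also have "\<dots> = (\<integral>\<^sup>+x. ennreal \<bar>det (matrix (?D x))\<bar> * ennreal (volume_density c' (?H x)) * indicator ?S x \<partial>lborel)"
    by (rule nn_integral_image[OF T der cont inj S u])
  also have "\<dots> = (\<integral>\<^sup>+x. ennreal (riem_jacobian A g F (chart_inv c x)) * ennreal (volume_density c x) * indicator ?S x \<partial>lborel)"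
  proof (rule nn_integral_cong)
    fix x
    show "ennreal \<bar>det (matrix (?D x))\<bar> * ennreal (volume_density c' (?H x)) * indicator ?S x =
      ennreal (riem_jacobian A g F (chart_inv c x)) * ennreal (volume_density c x) * indicator ?S x"
    proof (cases "x \<in> ?S")
      case True
      then obtain p where p: "p \<in> P" "x = chart_map c p" by blast
      have pU: "p \<in> U" "p \<in> chart_dom c" "F p \<in> chart_dom c'" using p P U by auto
      have d: "volume_density c x = sqrt (det (g c p))" "volume_density c' (?H x) = sqrt (det (g c' (F p)))"
        using p pU c rep(1)[OF pU(1)] by (simp_all add: volume_density_def)
      have pos: "sqrt (det (g c p)) > 0" "sqrt (det (g c' (F p))) > 0" using det_metric_pos c pU by auto
      have "riem_jacobian A g F (chart_inv c x) = \<bar>det (matrix (?D x))\<bar> * volume_density c' (?H x) / volume_density c x"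
        unfolding d using riem_jacobian_in_charts[OF C1 c pU(2,3)] p pU c by (simp add: chart_jacobian_def dmap_def)
      then have "riem_jacobian A g F (chart_inv c x) * volume_density c x = \<bar>det (matrix (?D x))\<bar> * volume_density c' (?H x)"
        using pos d by simp
      moreover have "0 \<le> volume_density c x" "0 \<le> volume_density c' (?H x)" using pos d by auto
      moreover have "0 \<le> riem_jacobian A g F (chart_inv c x)" by (rule riem_jacobian_nonneg[OF C1])
      ultimately show ?thesis by (simp add: ennreal_mult[symmetric] del: o_apply)
    qed simp
  qed
  also have "\<dots> = (\<integral>\<^sup>+p. ennreal (riem_jacobian A g F p) * indicator P p \<partial>m)"
  proof (rule nn_integral_chart[OF m c(1) P(1), symmetric])
    have "riem_jacobian A g F \<in> borel_measurable borel"
      using isCont_riem_jacobian[OF C1]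
      by (intro borel_measurable_continuous_onI continuous_at_imp_continuous_on) auto
    then show "(\<lambda>p. ennreal (riem_jacobian A g F p)) \<in> borel_measurable borel" by measurable
  qed (use P U in blast)
  finally show "emeasure m (F ` P) = (\<integral>\<^sup>+p. ennreal (riem_jacobian A g F p) * indicator P p \<partial>m)" .
qed

text \<open>
  Cut the manifold into finitely many Borel pieces \<open>P i\<close> on which \<open>F\<close> is injective.  The integral is the sum of
  the volumes of the images \<open>F ` P i\<close>, and each point lies in as many of these images as it has
  preimages.
\<close>
lemma integral_riem_jacobian:
  assumes m: "riemannian_volume A g m" "emeasure m UNIV = 1" and F: "expands F"
    and cpt: "compact (UNIV :: 'a set)" and conn: "connected (UNIV :: 'a set)"
  shows "(\<integral>x. riem_jacobian A g F x \<partial>m) = real (card (F -` {y0}))"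
proof -
  note C1 = expands_C1[OF F]
  have sm: "sets m = sets borel" using m by (simp add: riemannian_volume_def)
  have spm: "space m = UNIV" using sets_eq_imp_space_eq[OF sm] by simp
  have "riem_jacobian A g F \<in> borel_measurable borel"
    using isCont_riem_jacobian[OF C1]
    by (intro borel_measurable_continuous_onI continuous_at_imp_continuous_on) auto
  then have Jm: "riem_jacobian A g F \<in> borel_measurable m" by (simp add: measurable_cong_sets[OF sm])
  let ?J = "\<lambda>p. ennreal (riem_jacobian A g F p)"
  have "\<exists>U. open U \<and> p \<in> U \<and> U \<subseteq> chart_dom (chart_at A p) \<and> F ` U \<subseteq> chart_dom (chart_at A (F p)) \<and> inj_on F U" for p
    by (rule local_diffeo[OF F chart_at(1) chart_at(1) chart_at(2) chart_at(2), of p]) metis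
  then obtain U where U: "\<And>p. open (U p) \<and> p \<in> U p \<and> U p \<subseteq> chart_dom (chart_at A p) \<and>
      F ` U p \<subseteq> chart_dom (chart_at A (F p)) \<and> inj_on F (U p)"
    by metis
  obtain X where X: "finite X" "UNIV \<subseteq> (\<Union>p\<in>X. U p)"
    by (rule compactE_image[OF cpt, of UNIV U]) (use U in auto)
  obtain h :: "nat \<Rightarrow> 'a" and k where h: "X = h ` {..<k}"
    using finite_imp_nat_seg_image_inj_on[OF X(1)] by (metis lessThan_def)
  define V where "V i = (if i < k then U (h i) else {})" for i
  have VU: "(\<Union>i. V i) = UNIV"
  proof -
    have "x \<in> (\<Union>i. V i)" for x
    proof -
      obtain p where "p \<in> X" "x \<in> U p" using X(2) by blast
      then obtain i where "i < k" "x \<in> U (h i)" using h by auto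
      then have "x \<in> V i" by (simp add: V_def)
      then show ?thesis by blast
    qed
    then show ?thesis by blast
  qed
  have Vo: "open (V i)" for i using U by (simp add: V_def)
  \<comment> \<open>the pieces with \<open>i \<ge> k\<close> are empty\<close>
  define P where "P = disjointed V"
  have PV: "P i \<subseteq> V i" for i unfolding P_def by (rule disjointed_subset)
  have Pb: "P i \<in> sets borel" for i
  proof -
    have "range V \<subseteq> sets borel" using Vo by auto
    then show ?thesis unfolding P_def using sets.range_disjointed_sets by blast
  qed
  have disj: "disjoint_family P" unfolding P_def by (rule disjoint_family_disjointed)
  have PU: "(\<Union>i. P i) = UNIV" unfolding P_def UN_disjointed_eq VU ..
  have Pk: "P i = {}" if "\<not> i < k" for i using PV[of i] that by (simp add: V_def)
  have PUk: "(\<Union>i<k. P i) = UNIV"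
  proof -
    have "x \<in> (\<Union>i<k. P i)" for x
    proof -
      have "x \<in> (\<Union>i. P i)" using PU by simp
      then obtain i where "x \<in> P i" by blast
      then show ?thesis using Pk[of i] by auto
    qed
    then show ?thesis by blast
  qed
  have piece: "F ` P i \<in> sets borel" "emeasure m (F ` P i) = (\<integral>\<^sup>+p. ?J p * indicator (P i) p \<partial>m)" "inj_on F (P i)"
    if i: "i < k" for i
  proof -
    have PUi: "P i \<subseteq> U (h i)" using PV[of i] i by (simp add: V_def)
    have Ui: "open (U (h i))" "U (h i) \<subseteq> chart_dom (chart_at A (h i))"
      "F ` U (h i) \<subseteq> chart_dom (chart_at A (F (h i)))" "inj_on F (U (h i))" using U by auto
    show "F ` P i \<in> sets borel" "emeasure m (F ` P i) = (\<integral>\<^sup>+p. ?J p * indicator (P i) p \<partial>m)"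
      by (rule emeasure_image_expands[OF m(1) F chart_at(1) chart_at(1) Ui Pb PUi])+
    show "inj_on F (P i)" by (rule inj_on_subset[OF Ui(4) PUi])
  qed
  have count: "(\<Sum>i<k. indicator (F ` P i) y) = (of_nat (card (F -` {y0})) :: ennreal)" for y
  proof -
    have "F -` {y} = (\<Union>i\<in>{..<k}. P i \<inter> F -` {y})" using PUk by blast
    then have "card (F -` {y}) = card (\<Union>i\<in>{..<k}. P i \<inter> F -` {y})" by simp
    also have "\<dots> = (\<Sum>i<k. card (P i \<inter> F -` {y}))"
    proof (rule card_UN_disjoint)
      show "\<forall>i\<in>{..<k}. finite (P i \<inter> F -` {y})" using finite_fibre[OF cpt F] by blast
      show "\<forall>i\<in>{..<k}. \<forall>j\<in>{..<k}. i \<noteq> j \<longrightarrow> (P i \<inter> F -` {y}) \<inter> (P j \<inter> F -` {y}) = {}"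
        using disj unfolding disjoint_family_on_def by blast
    qed simp
    also have "\<dots> = (\<Sum>i<k. indicator (F ` P i) y)"
    proof (rule sum.cong[OF refl])
      fix i assume "i \<in> {..<k}"
      then have inj: "inj_on F (P i)" using piece(3) by simp
      show "card (P i \<inter> F -` {y}) = indicator (F ` P i) y"
      proof (cases "y \<in> F ` P i")
        case True
        then obtain x where x: "x \<in> P i" "y = F x" by blast
        then have "P i \<inter> F -` {y} = {x}" using inj by (auto dest: inj_onD)
        then show ?thesis using True by simp
      next
        case False
        then have "P i \<inter> F -` {y} = {}" by blast
        then show ?thesis using False by simp
      qed
    qed
    finally have "card (F -` {y0}) = (\<Sum>i<k. indicator (F ` P i) y)"
      using card_fibre_eq[OF cpt conn F, of y y0] by simp
    then have "(of_nat (card (F -` {y0})) :: ennreal) = (\<Sum>i<k. of_nat (indicator (F ` P i) y))" by simp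
    also have "\<dots> = (\<Sum>i<k. indicator (F ` P i) y)" by (intro sum.cong) (auto simp: indicator_def)
    finally show ?thesis by simp
  qed
  have "(\<integral>\<^sup>+p. ?J p \<partial>m) = (\<integral>\<^sup>+p. (\<Sum>i<k. ?J p * indicator (P i) p) \<partial>m)"
  proof (rule nn_integral_cong)
    fix p
    obtain i where i: "i < k" "p \<in> P i" using PUk by blast
    have "(\<Sum>j<k. ?J p * indicator (P j) p) = (\<Sum>j<k. if j = i then ?J p else 0)"
      using disj i by (intro sum.cong) (auto simp: indicator_def disjoint_family_on_def)
    also have "\<dots> = ?J p" using i(1) by simp
    finally show "?J p = (\<Sum>j<k. ?J p * indicator (P j) p)" by simp
  qed
  also have "\<dots> = (\<Sum>i<k. \<integral>\<^sup>+p. ?J p * indicator (P i) p \<partial>m)"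
    using Jm Pb sm by (intro nn_integral_sum) auto
  also have "\<dots> = (\<Sum>i<k. \<integral>\<^sup>+y. indicator (F ` P i) y \<partial>m)"
    using piece sm by (intro sum.cong) auto
  also have "\<dots> = (\<integral>\<^sup>+y. (\<Sum>i<k. indicator (F ` P i) y) \<partial>m)"
    using piece sm by (intro nn_integral_sum[symmetric]) auto
  also have "\<dots> = of_nat (card (F -` {y0}))"
    unfolding count using m(2) spm by simp
  finally have "(\<integral>\<^sup>+p. ?J p \<partial>m) = ennreal (real (card (F -` {y0})))" by (simp add: ennreal_of_nat_eq_real_of_nat)
  then show ?thesis
    using riem_jacobian_nonneg[OF C1] Jm by (subst integral_eq_nn_integral) auto
qed

end

section \<open>Entropy and growth of the degree\<close>

lemma iter_split:
  assumes "i \<le> n" shows "iter f n = iter (\<lambda>j. f (i + j)) (n - i) \<circ> iter f i"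
proof -
  have "iter f (i + k) = iter (\<lambda>j. f (i + j)) k \<circ> iter f i" for k
    by (induction k) (auto simp: comp_assoc)
  from this[of "n - i"] show ?thesis using assms by simp
qed

text \<open>
  Two orbits with the same point at time \<open>n\<close> that visit the same \<open>V i\<close> coincide, going back one step at a
  time.
\<close>
lemma iter_inj_on_join:
  assumes "\<And>i. i < n \<Longrightarrow> inj_on (f i) (V i)"
    and "\<And>i. i < n \<Longrightarrow> iter f i x \<in> V i" "\<And>i. i < n \<Longrightarrow> iter f i x' \<in> V i"
    and "iter f n x = iter f n x'"
  shows "x = x'"
  using assms
proof (induction n)
  case (Suc n)
  have "f n (iter f n x) = f n (iter f n x')" using Suc.prems(4) by simp
  then have "iter f n x = iter f n x'"
    using Suc.prems(1-3)[of n] by (auto dest: inj_onD)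
  then show ?case using Suc.IH Suc.prems(1-3) by simp
qed simp

lemma min_subcover_card_le:
  assumes "C \<subseteq> \<U>" "finite C" "\<Union>C = UNIV" shows "min_subcover_card \<U> \<le> card C"
  unfolding min_subcover_card_def by (rule Least_le) (use assms in blast)

text \<open>
  Without a finite subcover, \<open>min_subcover_card\<close> would be an arbitrary number.
\<close>
lemma min_subcover_card_attained:
  assumes "C \<subseteq> \<U>" "finite C" "\<Union>C = UNIV"
  obtains C' where "C' \<subseteq> \<U>" "finite C'" "\<Union>C' = UNIV" "card C' = min_subcover_card \<U>"
proof -
  have "\<exists>C\<subseteq>\<U>. finite C \<and> \<Union>C = UNIV \<and> card C = min_subcover_card \<U>"
    unfolding min_subcover_card_def by (rule LeastI[of _ "card C"]) (use assms in blast)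
  then show thesis using that by blast
qed

context riem
begin

text \<open>
  The upper bound: one element of the join for each sheet over each of finitely many small chart balls.
\<close>
lemma small_subcover:
  assumes cpt: "compact (UNIV :: 'a set)" and conn: "connected (UNIV :: 'a set)"
    and ex: "\<And>n. expands (f n)" and \<delta>: "\<delta> > 0" and leb: "\<And>n. lebesgue_number (rdist A g) (\<U> n) \<delta>"
  shows "\<exists>K. \<forall>n. \<exists>C\<subseteq>pullback_join f \<U> n. finite C \<and> \<Union>C = UNIV \<and> card C \<le> K * card (iter f n -` {y0})"
proof -
  \<comment> \<open>the neighbourhoods serve all \<open>n\<close> because their sections exist for every expanding map\<close>
  obtain V where V: "\<And>p. small_nbhd \<delta> p (V p)" using small_nbhd_exists[OF cpt \<delta>] by metis
  obtain Q where Q: "finite Q" "UNIV \<subseteq> (\<Union>p\<in>Q. V p)"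
    by (rule compactE_image[OF cpt, of UNIV V]) (use V in \<open>auto simp: small_nbhd_def\<close>)
  show ?thesis
  proof (intro exI[of _ "card Q"] allI)
    fix n
    let ?F = "iter f n"
    have F: "expands ?F" by (rule expands_iter[OF ex])
    note inj = expands_locally_injective[OF F]
    define sec where "sec p x G \<longleftrightarrow> continuous_on (V p) G \<and> (\<forall>w\<in>V p. ?F (G w) = w) \<and> G p = x"
      for p x G
    have ex_sec: "\<exists>G. sec p x G" if "?F x = p" for p x
    proof -
      have "sections_over ?F (V p)" "p \<in> V p" using V[of p] F by (auto simp: small_nbhd_def)
      then show ?thesis using that unfolding sections_over_def sec_def by blast
    qed
    define G where "G p x = (SOME G. sec p x G)" for p x
    have G0: "sec p x (G p x)" if "?F x = p" for p x
      unfolding G_def by (rule someI_ex[OF ex_sec[OF that]])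
    have G: "continuous_on (V p) (G p x)" "\<And>w. w \<in> V p \<Longrightarrow> ?F (G p x w) = w" "G p x p = x" if "?F x = p" for p x
      using G0[OF that] by (simp_all add: sec_def)
    \<comment> \<open>the image under \<open>iter f i\<close> of the lifted path is itself a lift, with respect to the remaining maps \<open>?E\<close>, of a short path\<close>
    have ball: "rdist A g (iter f i x) (iter f i (G p x w)) < \<delta>" if i: "i < n" and x: "?F x = p" and w: "w \<in> V p" for i p x w
    proof -
      have "p \<in> V p" using V[of p] by (simp add: small_nbhd_def)
      then obtain \<sigma> where \<sigma>: "regular_path {} \<sigma>" "\<sigma> 0 = p" "\<sigma> 1 = w" "\<And>t. t \<in> {0<..<1} \<Longrightarrow> speed \<sigma> t \<le> \<delta> / 2"
          "\<sigma> ` {0..1} \<subseteq> V p"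
        using V[of p] w unfolding small_nbhd_def by metis
      let ?E = "iter (\<lambda>j. f (i + j)) (n - i)"
      have E: "expands ?E" by (rule expands_iter) (rule ex)
      have c\<sigma>: "continuous_on {0..1} \<sigma>" using \<sigma>(1) by (simp add: regular_path_def path_def)
      have "continuous_on {0..1} (G p x \<circ> \<sigma>)"
        by (rule continuous_on_compose[OF c\<sigma> continuous_on_subset[OF G(1)[OF x] \<sigma>(5)]])
      moreover have "continuous_on ((G p x \<circ> \<sigma>) ` {0..1}) (iter f i)"
        by (rule continuous_on_subset[OF expands_cont[OF expands_iter[OF ex]]]) simp
      ultimately have path: "path (iter f i \<circ> (G p x \<circ> \<sigma>))"
        unfolding path_def by (rule continuous_on_compose)
      have eq: "?E ((iter f i \<circ> (G p x \<circ> \<sigma>)) t) = \<sigma> t" if t: "t \<in> {0..1}" for t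
      proof -
        have "?E ((iter f i \<circ> (G p x \<circ> \<sigma>)) t) = ?F (G p x (\<sigma> t))"
          using iter_split[of i n f] i by simp
        also have "\<dots> = \<sigma> t" by (rule G(2)[OF x]) (use \<sigma>(5) t in blast)
        finally show ?thesis .
      qed
      have "path_length_riem A g \<sigma> \<le> ennreal (\<delta> / 2)"
        by (rule path_length_bound[of "{}"]) (use \<sigma>(4) in auto)
      also have "\<dots> < ennreal \<delta>" using \<delta> by (simp add: ennreal_less_iff)
      finally have len: "path_length_riem A g \<sigma> < ennreal \<delta>" .
      have "rdist A g ((iter f i \<circ> (G p x \<circ> \<sigma>)) 0) ((iter f i \<circ> (G p x \<circ> \<sigma>)) 1) < \<delta>"
        by (rule rdist_lift[OF E path \<sigma>(1) _ len]) (rule eq)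
      then show ?thesis using G(3)[OF x] \<sigma>(2,3) by simp
    qed
    have "\<exists>W. W \<in> \<U> i \<and> {y. rdist A g a y < \<delta>} \<subseteq> W" for i a
      using leb[of i] unfolding lebesgue_number_def by blast
    then obtain W where W: "\<And>i a. W i a \<in> \<U> i \<and> {y. rdist A g a y < \<delta>} \<subseteq> W i a" by metis
    \<comment> \<open>an element of the join that contains the sheet through \<open>x\<close>\<close>
    define J where "J x = (\<Inter>i<n. iter f i -` W i (iter f i x))" for x
    define X where "X = (\<Union>p\<in>Q. ?F -` {p})"
    have finX: "finite X" unfolding X_def using Q(1) finite_fibre[OF cpt F] by blast
    have "J x \<in> pullback_join f \<U> n" for x
    proof -
      have "\<forall>i<n. W i (iter f i x) \<in> \<U> i" using W by simp
      then show ?thesis unfolding pullback_join_def J_def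
        by (intro CollectI exI[of _ "\<lambda>i. W i (iter f i x)"]) simp
    qed
    then have "J ` X \<subseteq> pullback_join f \<U> n" by blast
    moreover have "finite (J ` X)" using finX by simp
    moreover have "\<Union>(J ` X) = UNIV"
    proof -
      have "z \<in> \<Union>(J ` X)" for z
      proof -
        have "?F z \<in> (\<Union>p\<in>Q. V p)" using Q(2) by blast
        then obtain p where p: "p \<in> Q" "?F z \<in> V p" by blast
        have Vp: "connected (V p)" "p \<in> V p" "sections_over ?F (V p)" using V[of p] F by (auto simp: small_nbhd_def)
        obtain G' where G': "continuous_on (V p) G'" "\<forall>w\<in>V p. ?F (G' w) = w" "G' (?F z) = z"
          using Vp(3) p(2) unfolding sections_over_def by blast
        let ?x = "G' p"
        have x: "?F ?x = p" using G' Vp by blast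
        have "G p ?x (?F z) = G' (?F z)"
        proof (rule lift_unique[OF inj Vp(1), where ?h1.0 = "G p ?x" and ?h2.0 = G' and ?s0.0 = p])
          show "continuous_on (V p) (G p ?x)" "G p ?x p = G' p" by (rule G(1)[OF x], rule G(3)[OF x])
          show "?F (G p ?x s) = ?F (G' s)" if "s \<in> V p" for s using G(2)[OF x that] G'(2) that by simp
        qed (use G' Vp p in auto)
        then have z: "z = G p ?x (?F z)" using G'(3) by simp
        have "iter f i z \<in> W i (iter f i ?x)" if "i < n" for i
          using ball[OF that x p(2)] W[of i "iter f i ?x"] z by auto
        then have "z \<in> J ?x" by (simp add: J_def)
        moreover have "?x \<in> X" unfolding X_def using x p(1) by blast
        ultimately show ?thesis by blast
      qed
      then show ?thesis by blast
    qed
    moreover have "card (J ` X) \<le> card Q * card (?F -` {y0})"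
    proof -
      have "card (J ` X) \<le> card X" by (rule card_image_le[OF finX])
      also have "\<dots> \<le> (\<Sum>p\<in>Q. card (?F -` {p}))" unfolding X_def by (rule card_UN_le[OF Q(1)])
      also have "\<dots> = (\<Sum>p\<in>Q. card (?F -` {y0}))"
        by (intro sum.cong refl card_fibre_eq[OF cpt conn F])
      finally show ?thesis by simp
    qed
    ultimately show "\<exists>C\<subseteq>pullback_join f \<U> n. finite C \<and> \<Union>C = UNIV \<and> card C \<le> card Q * card (?F -` {y0})"
      by (intro exI[of _ "J ` X"]) simp
  qed
qed

text \<open>
  The lower bound: since orbits in an element of the join are determined by their last point, such an element
  contains at most one point of the fibre.
\<close>
lemma card_fibre_le_subcover:
  assumes cpt: "compact (UNIV :: 'a set)" and ex: "\<And>n. expands (f n)"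
    and \<U>: "\<And>i W. W \<in> \<U> i \<Longrightarrow> inj_on (f i) W"
    and C: "C \<subseteq> pullback_join f \<U> n" "finite C" "\<Union>C = UNIV"
  shows "card (iter f n -` {y}) \<le> card C"
proof -
  let ?X = "iter f n -` {y}"
  have fin: "finite ?X" by (rule finite_fibre[OF cpt expands_iter[OF ex]])
  have one: "card (J \<inter> ?X) \<le> 1" if "J \<in> C" for J
  proof -
    have "J \<in> pullback_join f \<U> n" using that C(1) by blast
    then obtain V where V: "J = (\<Inter>i<n. iter f i -` V i)" "\<And>i. i < n \<Longrightarrow> V i \<in> \<U> i"
      unfolding pullback_join_def by blast
    have "x = x'" if "x \<in> J \<inter> ?X" "x' \<in> J \<inter> ?X" for x x'
      by (rule iter_inj_on_join[where n = n and f = f and V = V]) (use that V \<U> in auto)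
    then show ?thesis using fin by (simp add: card_le_Suc0_iff_eq)
  qed
  have "\<exists>J\<in>C. x \<in> J" for x using C(3) by (metis UNIV_I UnionE)
  then have "?X = (\<Union>J\<in>C. J \<inter> ?X)" by auto
  then have "card ?X = card (\<Union>J\<in>C. J \<inter> ?X)" by simp
  also have "\<dots> \<le> (\<Sum>J\<in>C. card (J \<inter> ?X))" by (rule card_UN_le[OF C(2)])
  also have "\<dots> \<le> (\<Sum>J\<in>C. 1)" by (rule sum_mono[OF one])
  finally show ?thesis by simp
qed

lemma card_fibre_pos:
  assumes "compact (UNIV :: 'a set)" "connected (UNIV :: 'a set)" "expands F"
  shows "card (F -` {y}) \<ge> 1"
proof -
  have "F -` {F y} \<noteq> {}" by blast
  then have "card (F -` {F y}) > 0" using finite_fibre[OF assms(1,3)] by (simp add: card_gt_0_iff)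
  then show ?thesis using card_fibre_eq[OF assms, of y "F y"] by simp
qed

lemma top_entropy_eq_degree_growth:
  assumes cpt: "compact (UNIV :: 'a set)" and conn: "connected (UNIV :: 'a set)"
    and \<kappa>: "1 < \<kappa>" and \<Gamma>: "0 < \<Gamma>" and f: "\<And>n. f n \<in> expanding_maps A g \<kappa> \<Gamma>"
  shows "top_entropy (rdist A g) f = limsup (\<lambda>n. ereal (ln (real (card (iter f n -` {y0}))) / real n))"
    (is "_ = limsup (\<lambda>n. ereal (?h n))")
proof (rule antisym)
  have ex: "expands (f n)" for n by (rule expanding_maps_expands[OF f \<kappa>])
  let ?N = "\<lambda>n. card (iter f n -` {y0})"
  have N: "?N n \<ge> 1" for n by (rule card_fibre_pos[OF cpt conn expands_iter[OF ex]])
  show "top_entropy (rdist A g) f \<le> limsup (\<lambda>n. ereal (?h n))"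
    unfolding top_entropy_def
  proof (rule SUP_least)
    fix \<U> :: "nat \<Rightarrow> 'a set set" assume "\<U> \<in> {\<U>. (\<forall>n. open_cover (\<U> n)) \<and> (\<exists>\<delta>>0. \<forall>n. lebesgue_number (rdist A g) (\<U> n) \<delta>)}"
    then obtain \<delta> where \<delta>: "\<delta> > 0" "\<And>n. lebesgue_number (rdist A g) (\<U> n) \<delta>" by blast
    obtain K where "\<forall>n. \<exists>C\<subseteq>pullback_join f \<U> n. finite C \<and> \<Union>C = UNIV \<and> card C \<le> K * ?N n"
      using small_subcover[where f = f and \<U> = \<U> and ?y0.0 = y0, OF cpt conn ex \<delta>] by (elim exE)
    note K = this[rule_format]
    have le: "min_subcover_card (pullback_join f \<U> n) \<le> K * ?N n" for n
    proof -
      obtain C where "C \<subseteq> pullback_join f \<U> n" "finite C" "\<Union>C = UNIV" "card C \<le> K * ?N n"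
        using K[of n] by (elim exE conjE)
      then show ?thesis using min_subcover_card_le[of C "pullback_join f \<U> n"] by simp
    qed
    have K1: "K \<ge> 1"
    proof (rule ccontr)
      assume "\<not> K \<ge> 1"
      obtain C where C: "C \<subseteq> pullback_join f \<U> 0" "finite C" "\<Union>C = UNIV" "card C \<le> K * ?N 0"
        using K[of 0] by (elim exE conjE)
      have "K = 0" using \<open>\<not> K \<ge> 1\<close> by simp
      then have "card C = 0" using C(4) by (simp del: card_eq_0_iff)
      then have "C = {}" using C(2) by simp
      then show False using C(3) by simp
    qed
    have "cover_entropy f \<U> \<le> limsup (\<lambda>n. ereal (ln (real K) / real n) + ereal (?h n))"
      unfolding cover_entropy_def
    proof (intro Limsup_mono always_eventually allI)
      fix n
      have pos: "real K * real (?N n) \<ge> 1"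
        using K1 N[of n] by (metis mult_le_mono nat_mult_1 of_nat_1 of_nat_le_iff of_nat_mult)
      have "ln (real (min_subcover_card (pullback_join f \<U> n))) \<le> ln (real K * real (?N n))"
      proof (cases "min_subcover_card (pullback_join f \<U> n) = 0")
        case True then show ?thesis using pos by simp
      next
        case False
        have "real (min_subcover_card (pullback_join f \<U> n)) \<le> real K * real (?N n)"
          using le[of n] by (metis of_nat_le_iff of_nat_mult)
        then show ?thesis using False by simp
      qed
      also have "\<dots> = ln (real K) + ln (real (?N n))" using K1 N[of n] by (intro ln_mult_pos) auto
      finally have "ln (real (min_subcover_card (pullback_join f \<U> n))) / real n \<le> (ln (real K) + ln (real (?N n))) / real n"
        by (rule divide_right_mono) simp
      then show "ereal (ln (real (min_subcover_card (pullback_join f \<U> n))) / real n)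
          \<le> ereal (ln (real K) / real n) + ereal (?h n)"
        by (simp add: add_divide_distrib)
    qed
    also have "\<dots> = 0 + limsup (\<lambda>n. ereal (?h n))"
    proof (rule ereal_limsup_lim_add)
      show "(\<lambda>n. ereal (ln (real K) / real n)) \<longlonglongrightarrow> 0"
        using lim_const_over_n[of "ln (real K)"] by (simp add: zero_ereal_def)
    qed simp
    finally show "cover_entropy f \<U> \<le> limsup (\<lambda>n. ereal (?h n))" by simp
  qed
  obtain \<delta> where \<delta>: "\<delta> > 0"
    "\<And>F x. F \<in> expanding_maps A g \<kappa> \<Gamma> \<Longrightarrow> \<exists>U. open U \<and> {y. rdist A g x y < \<delta>} \<subseteq> U \<and> inj_on F U"
    using uniform_local_injectivity[OF cpt conn \<kappa> \<Gamma>] by (elim exE conjE) simp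
  define \<U> where "\<U> n = {W. open W \<and> inj_on (f n) W}" for n
  have leb: "lebesgue_number (rdist A g) (\<U> n) \<delta>" for n
    unfolding lebesgue_number_def \<U>_def using \<delta>(1) \<delta>(2)[OF f[of n]] by blast
  have cov: "open_cover (\<U> n)" for n
  proof -
    have "x \<in> \<Union>(\<U> n)" for x
      using expands_locally_injective[OF ex[of n]] unfolding locally_injective_def \<U>_def by blast
    then show ?thesis unfolding open_cover_def \<U>_def by blast
  qed
  obtain K where "\<forall>n. \<exists>C\<subseteq>pullback_join f \<U> n. finite C \<and> \<Union>C = UNIV \<and> card C \<le> K * ?N n"
    using small_subcover[where f = f and \<U> = \<U> and ?y0.0 = y0, OF cpt conn ex \<delta>(1) leb] by (elim exE)
  note K = this[rule_format]
  have ge: "?N n \<le> min_subcover_card (pullback_join f \<U> n)" for n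
  proof -
    obtain C where C: "C \<subseteq> pullback_join f \<U> n" "finite C" "\<Union>C = UNIV" using K[of n] by (elim exE conjE)
    obtain C' where C': "C' \<subseteq> pullback_join f \<U> n" "finite C'" "\<Union>C' = UNIV"
        "card C' = min_subcover_card (pullback_join f \<U> n)"
      by (rule min_subcover_card_attained[OF C])
    have "?N n \<le> card C'"
      by (rule card_fibre_le_subcover[OF cpt ex _ C'(1-3)]) (simp add: \<U>_def)
    then show ?thesis using C'(4) by simp
  qed
  have "limsup (\<lambda>n. ereal (?h n)) \<le> cover_entropy f \<U>"
    unfolding cover_entropy_def
  proof (intro Limsup_mono always_eventually allI)
    fix n
    have "ln (real (?N n)) \<le> ln (real (min_subcover_card (pullback_join f \<U> n)))"
      using ge[of n] N[of n] by (intro ln_mono) auto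
    then show "ereal (?h n) \<le> ereal (ln (real (min_subcover_card (pullback_join f \<U> n))) / real n)"
      by (simp add: divide_right_mono)
  qed
  also have "\<dots> \<le> top_entropy (rdist A g) f"
    unfolding top_entropy_def by (rule SUP_upper) (use cov leb \<delta>(1) in blast)
  finally show "limsup (\<lambda>n. ereal (?h n)) \<le> top_entropy (rdist A g) f" .
qed

end

theorem theorem5p5:
  fixes A :: "('a::t2_space, 'n::finite) chart set"
    and g :: "('a, 'n) metric_tensor"
    and m :: "'a measure"
    and \<kappa> \<Gamma> :: real
    and f :: "nat \<Rightarrow> 'a \<Rightarrow> 'a"
  assumes "riemannian_manifold A g"
    and "compact (UNIV :: 'a set)"
    and "connected (UNIV :: 'a set)"
    and "riemannian_volume A g m"
    and "emeasure m UNIV = 1"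
    and "1 < \<kappa>" and "\<kappa> < \<Gamma>"
    and "\<And>n. f n \<in> expanding_maps A g \<kappa> \<Gamma>"
  shows "top_entropy (rdist A g) f =
    limsup (\<lambda>n. ereal (ln (\<integral>x. riem_jacobian A g (iter f n) x \<partial>m) / real n))"
proof -
  interpret riem A g by (rule riem.intro[OF assms(1)])
  have "expands (iter f n)" for n
    by (rule expands_iter[OF expanding_maps_expands[OF assms(8,6)]])
  \<comment> \<open>the degree may be read off at any point, here \<open>undefined\<close>\<close>
  then have "(\<integral>x. riem_jacobian A g (iter f n) x \<partial>m) = real (card (iter f n -` {undefined}))" for n
    by (rule integral_riem_jacobian[OF assms(4,5) _ assms(2,3)])
  moreover have "top_entropy (rdist A g) f =
      limsup (\<lambda>n. ereal (ln (real (card (iter f n -` {undefined}))) / real n))"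
    by (rule top_entropy_eq_degree_growth[OF assms(2,3,6) _ assms(8)]) (use assms(6,7) in simp)
  ultimately show ?thesis by simp
qed

end
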